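(* The space $(S^1)^{(3)}\cong P/{\sim}$ has an explicit simplicial decomposition which is isomorphic to the Barnette sphere $S_B^3$. Precisely: let $K$ be the simplicial complex on the vertex set $\{0,1,\dots,11\}$ and $S_B^3$ the Barnette sphere on the vertex set $\{0,1,2,3,8,9,10,11\}$, with the facets listed in the context, and let $q\colon\{0,\dots,11\}\to\{0,1,2,3,8,9,10,11\}$ be given by $q(i)=i-4$ for $4\le i\le 7$ and $q(i)=i$ otherwise. Then $K$ gives a simplicial decomposition of the prism $P$, that is, there is a homeomorphism $h\colon |K|\to P$ such that - $h$ sends the vertices $0,1,2,4,5,6$ of $K$ to the vertices $\mathbf 0,\mathbf 1,\mathbf 2,\mathbf 4,\mathbf 5,\mathbf 6$ of $P$, the vertices $3$ and $7$ to the barycenters of the bottom face $[\mathbf 0,\mathbf 1,\mathbf 2]$ and of the top face $[\mathbf 4,\mathbf 5,\mathbf 6]$ respectively, the vertices $8,9,10$ to the midpoints of the vertical edges $[\mathbf 1,\mathbf 6]$, $[\mathbf 2,\mathbf 4]$, $[\mathbf 0,\mathbf 5]$ respectively, and the vertex $11$ to a point in the interior of $P$; - $q$ defines a simplicial map $q\colon K\to S_B^3$, the decomposition $K$ of $P$ induces a simplicial decomposition of $P/{\sim}$, and $q$ induces an isomorphism of simplicial complexes $\bar q\colon P/{\sim}\xrightarrow{\cong} S_B^3$ (i.e., for $u,v\in|K|$ one has $h(u)\sim h(v)$ if and only if $|q|(u)=|q|(v)$, and the induced map $P/{\sim}\to|S_B^3|$ is a homeomorphism carrying the induced simplices to the simplices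 of $S_B^3$). Moreover, under this simplicial decomposition, $S/{\sim}$ is the $2$-dimensional subcomplex of $S_B^3$ with vertices $0,1,2,8,9,10$ and facets $[0,1,8],[0,2,8],[0,1,9],[1,2,9],[0,2,10],[1,2,10]$, which is a full and a half twisted Möbius band, and $D/{\sim}$ is its boundary, namely the $1$-dimensional subcomplex with vertices $0,1,2,8,9,10$ and facets $[1,8],[2,8],[0,9],[2,9],[0,10],[1,10]$.
   Context: For a topological space $X$ and a positive integer $k$, the $k$-th symmetric potency $(X)^{(k)}$ is the set of non-empty subsets of $X$ of cardinality at most $k$ with the quotient topology given by $X^k\to (X)^{(k)}$, $(x_1,\dots,x_k)\mapsto\{x_1,\dots,x_k\}$. Morton's prism and its subspaces are $P=\{(x,y,z)\in\mathbb{R}^3 : x\le y\le z\le x+1,\ 0\le x+y+z\le 1\}$, $S=\{(x,y,z)\in P : x=y\text{ or }y=z\text{ or }z=x+1\}$, $D=\{(x,y,z)\in P : x=y=z\text{ or }x=y=z-1\text{ or }x+1=y=z\}$. The vertices of $P$ are $\mathbf 0=(0,0,0)$, $\mathbf 1=(-2/3,1/3,1/3)$, $\mathbf 2=(-1/3,-1/3,2/3)$, $\mathbf 4=(0,0,1)$, $\mathbf 5=(1/3,1/3,1/3)$, $\mathbf 6=(-1/3,2/3,2/3)$. Let $p\colon P\to (S^1)^{(3)}$, $p(x,y,z)=\{e^{2\pi i x},e^{2\pi i y},e^{2\pi i z}\}$. The equivalence relation $\sim$ on $P$ is $(x,y,z)\sim(x',y',z')\Leftrightarrow p(x,y,z)=p(x',y',z')$,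 and $P/{\sim}$ has the quotient topology; $S/{\sim}$ and $D/{\sim}$ are the images of $S$ and $D$. The map $p$ induces a homeomorphism $P/{\sim}\to (S^1)^{(3)}$. Notation: $[a,b,\dots]$ denotes the simplex with vertices $a,b,\dots$; a facet is a maximal simplex; $|K|$ is the geometric realization and $|q|$ the induced map of realizations. Facets of $K$ (19 of them): $[4,5,7,9]$, $[5,6,7,10]$, $[4,6,7,8]$, $[4,7,8,9]$, $[5,7,9,10]$, $[6,7,8,10]$, $[4,1,8,9]$, $[5,2,9,10]$, $[0,6,8,10]$, $[0,8,10,11]$, $[1,8,9,11]$, $[2,9,10,11]$, $[0,1,8,11]$, $[1,2,9,11]$, $[0,2,10,11]$, $[7,8,9,10]$, $[8,9,10,11]$, $[0,1,2,11]$, $[0,1,2,3]$. The Barnette sphere $S_B^3$ is the simplicial complex with vertices $0,1,2,3,8,9,10,11$ and the following 19 facets: $[0,1,3,9]$, $[1,2,3,10]$, $[0,2,3,8]$, $[0,3,8,9]$, $[1,3,9,10]$, $[2,3,8,10]$, $[0,1,8,9]$, $[1,2,9,10]$, $[0,2,8,10]$, $[0,8,10,11]$, $[1,8,9,11]$, $[2,9,10,11]$, $[0,1,8,11]$, $[1,2,9,11]$, $[0,2,10,11]$, $[3,8,9,10]$, $[8,9,10,11]$, $[0,1,2,11]$, $[0,1,2,3]$. It is a simplicial decomposition of the $3$-sphere. A "full and a half twisted Möbius band" in a $3$-sphere is an unknotted band with three half twists (a full twist plus a half twist), i.e. up to a homeomorphism with $S^3=\mathbb{R}^3\cup\{\infty\}$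 the subset $\{((2+t\cos\tfrac{3\theta}{2})\cos\theta,\,(2+t\cos\tfrac{3\theta}{2})\sin\theta,\,t\sin\tfrac{3\theta}{2}) : \theta\in[0,2\pi],\ t\in[-1,1]\}$; handedness is not specified. *)

theory Defs
  imports "HOL-Analysis.Analysis"
begin

definition quotient_topology :: "'a topology \<Rightarrow> ('a \<Rightarrow> 'b) \<Rightarrow> 'b topology" where
  "quotient_topology X f =
     topology (\<lambda>U. U \<subseteq> f ` topspace X \<and> openin X {x \<in> topspace X. f x \<in> U})"

lemma openin_quotient_topology:
  "openin (quotient_topology X f) U \<longleftrightarrow>
     U \<subseteq> f ` topspace X \<and> openin X {x \<in> topspace X. f x \<in> U}"
proof -
  have "istopology (\<lambda>U. U \<subseteq> f ` topspace X \<and> openin X {x \<in> topspace X. f x \<in> U})"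
    unfolding istopology_def
  proof (intro conjI allI impI; (elim conjE)?)
    fix S T
    assume "openin X {x \<in> topspace X. f x \<in> S}" "openin X {x \<in> topspace X. f x \<in> T}"
    then have "openin X ({x \<in> topspace X. f x \<in> S} \<inter> {x \<in> topspace X. f x \<in> T})"
      by (rule openin_Int)
    also have "{x \<in> topspace X. f x \<in> S} \<inter> {x \<in> topspace X. f x \<in> T} =
        {x \<in> topspace X. f x \<in> S \<inter> T}" by auto
    finally show "openin X {x \<in> topspace X. f x \<in> S \<inter> T}" .
  next
    fix \<K>
    assume *: "\<forall>U\<in>\<K>. U \<subseteq> f ` topspace X \<and> openin X {x \<in> topspace X. f x \<in> U}"
    have "openin X (\<Union>U\<in>\<K>. {x \<in> topspace X. f x \<in> U})" using * by auto
    also have "(\<Union>U\<in>\<K>. {x \<in> topspace X. f x \<in> U}) = {x \<in> topspace X. f x \<in> \<Union>\<K>}" by auto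
    finally show "openin X {x \<in> topspace X. f x \<in> \<Union>\<K>}" .
  qed auto
  then show ?thesis
    by (simp add: quotient_topology_def topology_inverse')
qed

lemma topspace_quotient_topology [simp]:
  "topspace (quotient_topology X f) = f ` topspace X"
proof -
  have "{x \<in> topspace X. f x \<in> f ` topspace X} = topspace X" by auto
  then have "openin (quotient_topology X f) (f ` topspace X)"
    by (simp add: openin_quotient_topology)
  then show ?thesis
    by (metis openin_quotient_topology openin_subset openin_topspace subset_antisym)
qed

lemma quotient_map_quotient_topology: "quotient_map X (quotient_topology X f) f"
  by (auto simp: quotient_map_def openin_quotient_topology)

definition symmetric_potency :: "nat \<Rightarrow> 'a topology \<Rightarrow> 'a set topology" where
  "symmetric_potency k X =
     quotient_topology (product_topology (\<lambda>_. X) {..<k}) (\<lambda>x. x ` {..<k})"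

lemma topspace_symmetric_potency:
  assumes "0 < k"
  shows "topspace (symmetric_potency k X) =
    {A. A \<subseteq> topspace X \<and> A \<noteq> {} \<and> finite A \<and> card A \<le> k}" (is "?L = ?R")
proof
  show "?L \<subseteq> ?R"
    using assms
    by (auto simp: symmetric_potency_def PiE_iff intro: card_image_le[of "{..<k}", simplified])
  show "?R \<subseteq> ?L"
  proof
    fix A assume A: "A \<in> ?R"
    then obtain a where a: "a \<in> A" by auto
    from A obtain f where f: "bij_betw f {..<card A} A"
      using ex_bij_betw_nat_finite lessThan_atLeast0 by (metis (lifting) mem_Collect_eq)
    define x where "x = (\<lambda>i. if i < card A then f i else if i < k then a else undefined)"
    have "x ` {..<k} = f ` {..<card A}"
    proof
      show "f ` {..<card A} \<subseteq> x ` {..<k}"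
        using A by (force simp: x_def)
      show "x ` {..<k} \<subseteq> f ` {..<card A}"
        using a f by (auto simp: x_def bij_betw_def)
    qed
    then have "x ` {..<k} = A" using f by (simp add: bij_betw_def)
    moreover from this have "x \<in> (\<Pi>\<^sub>E i\<in>{..<k}. topspace X)"
      using A by (auto simp: PiE_iff extensional_def x_def)
    ultimately show "A \<in> ?L"
      by (auto simp: symmetric_potency_def)
  qed
qed

abbreviation circle_top :: "complex topology" where
  "circle_top \<equiv> top_of_set (sphere 0 1)"

definition prism :: "(real \<times> real \<times> real) set" where
  "prism = {(x, y, z). x \<le> y \<and> y \<le> z \<and> z \<le> x + 1 \<and> 0 \<le> x + y + z \<and> x + y + z \<le> 1}"

definition prism_S :: "(real \<times> real \<times> real) set" where
  "prism_S = {(x, y, z) \<in> prism. x = y \<or> y = z \<or> z = x + 1}"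

definition prism_D :: "(real \<times> real \<times> real) set" where
  "prism_D = {(x, y, z) \<in> prism.
     (x = y \<and> y = z) \<or> (x = y \<and> y = z - 1) \<or> (x + 1 = y \<and> y = z)}"

definition P0 :: "real \<times> real \<times> real" where "P0 = (0, 0, 0)"
definition P1 :: "real \<times> real \<times> real" where "P1 = (-2/3, 1/3, 1/3)"
definition P2 :: "real \<times> real \<times> real" where "P2 = (-1/3, -1/3, 2/3)"
definition P4 :: "real \<times> real \<times> real" where "P4 = (0, 0, 1)"
definition P5 :: "real \<times> real \<times> real" where "P5 = (1/3, 1/3, 1/3)"
definition P6 :: "real \<times> real \<times> real" where "P6 = (-1/3, 2/3, 2/3)"

definition barycenter3 :: "'a::real_vector \<Rightarrow> 'a \<Rightarrow> 'a \<Rightarrow> 'a" where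
  "barycenter3 a b c = (1/3) *\<^sub>R (a + b + c)"

fun prism_map :: "real \<times> real \<times> real \<Rightarrow> complex set" where
  "prism_map (x, y, z) = {cis (2 * pi * x), cis (2 * pi * y), cis (2 * pi * z)}"

definition prism_rel :: "((real \<times> real \<times> real) \<times> (real \<times> real \<times> real)) set" where
  "prism_rel = {(u, v). u \<in> prism \<and> v \<in> prism \<and> prism_map u = prism_map v}"

definition prism_class :: "real \<times> real \<times> real \<Rightarrow> (real \<times> real \<times> real) set" where
  "prism_class u = prism_rel `` {u}"

definition prism_quotient :: "(real \<times> real \<times> real) set topology" where
  "prism_quotient = quotient_topology (top_of_set prism) prism_class"

lemma topspace_prism_quotient: "topspace prism_quotient = prism // prism_rel"
  by (auto simp: prism_quotient_def prism_class_def quotient_def)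

text \<open>The empty simplex is not a member of a complex.\<close>

definition abstract_complex :: "'v set set \<Rightarrow> bool" where
  "abstract_complex K \<longleftrightarrow>
     (\<forall>\<sigma>\<in>K. finite \<sigma> \<and> \<sigma> \<noteq> {} \<and> (\<forall>\<tau>. \<tau> \<subseteq> \<sigma> \<longrightarrow> \<tau> \<noteq> {} \<longrightarrow> \<tau> \<in> K))"

definition generated_complex :: "'v set set \<Rightarrow> 'v set set" where
  "generated_complex F = {\<sigma>. \<sigma> \<noteq> {} \<and> (\<exists>\<tau>\<in>F. \<sigma> \<subseteq> \<tau>)}"

definition complex_vertices :: "'v set set \<Rightarrow> 'v set" where
  "complex_vertices K = \<Union>K"

definition complex_facets :: "'v set set \<Rightarrow> 'v set set" where
  "complex_facets K = {\<sigma>\<in>K. \<forall>\<tau>\<in>K. \<sigma> \<subseteq> \<tau> \<longrightarrow> \<tau> = \<sigma>}"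

definition complex_dim :: "'v set set \<Rightarrow> nat" where
  "complex_dim K = Max (card ` K) - 1"

definition subcomplex :: "'v set set \<Rightarrow> 'v set set \<Rightarrow> bool" where
  "subcomplex L K \<longleftrightarrow> abstract_complex L \<and> abstract_complex K \<and> L \<subseteq> K"

definition simplicial_map :: "'v set set \<Rightarrow> 'w set set \<Rightarrow> ('v \<Rightarrow> 'w) \<Rightarrow> bool" where
  "simplicial_map K L f \<longleftrightarrow>
     abstract_complex K \<and> abstract_complex L \<and> (\<forall>\<sigma>\<in>K. f ` \<sigma> \<in> L)"

definition simplicial_iso :: "'v set set \<Rightarrow> 'w set set \<Rightarrow> ('v \<Rightarrow> 'w) \<Rightarrow> bool" where
  "simplicial_iso K L f \<longleftrightarrow>
     bij_betw f (complex_vertices K) (complex_vertices L) \<and>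
     simplicial_map K L f \<and> simplicial_map L K (inv_into (complex_vertices K) f)"

text \<open>Points of the realization are given by their barycentric coordinates.  The subspace topology
  of the product topology is the usual topology of the realization for finite complexes; for
  infinite ones it may be coarser.\<close>

definition closed_simplex :: "'v set \<Rightarrow> ('v \<Rightarrow> real) set" where
  "closed_simplex \<sigma> = {b. (\<forall>v. 0 \<le> b v) \<and> {v. b v \<noteq> 0} \<subseteq> \<sigma> \<and> sum b \<sigma> = 1}"

definition realization :: "'v set set \<Rightarrow> ('v \<Rightarrow> real) set" where
  "realization K = (\<Union>\<sigma>\<in>K. closed_simplex \<sigma>)"

definition vertex_point :: "'v \<Rightarrow> 'v \<Rightarrow> real" where
  "vertex_point v = (\<lambda>w. if w = v then 1 else 0)"

definition realization_map :: "('v \<Rightarrow> 'w) \<Rightarrow> ('v \<Rightarrow> real) \<Rightarrow> 'w \<Rightarrow> real" where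
  "realization_map f b = (\<lambda>w. \<Sum>v | b v \<noteq> 0 \<and> f v = w. b v)"

definition simplicial_decomposition ::
    "'v set set \<Rightarrow> 'a topology \<Rightarrow> (('v \<Rightarrow> real) \<Rightarrow> 'a) \<Rightarrow> bool" where
  "simplicial_decomposition K X h \<longleftrightarrow>
     finite K \<and> abstract_complex K \<and> homeomorphic_map (top_of_set (realization K)) X h"

text \<open>Let \<open>h\<close> decompose a space according to \<open>K\<close>, and let \<open>f\<close> be the projection of that space to a
  quotient \<open>Y\<close>.  The vertices of the induced complex are the images in \<open>Y\<close> of the vertices of the
  decomposition, and its simplices are spanned by the images of the vertices of simplices of \<open>K\<close>.\<close>

definition induced_vertex :: "(('v \<Rightarrow> real) \<Rightarrow> 'a) \<Rightarrow> ('a \<Rightarrow> 'b) \<Rightarrow> 'v \<Rightarrow> 'b" where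
  "induced_vertex h f v = f (h (vertex_point v))"

definition induced_complex ::
    "'v set set \<Rightarrow> (('v \<Rightarrow> real) \<Rightarrow> 'a) \<Rightarrow> ('a \<Rightarrow> 'b) \<Rightarrow> 'b set set" where
  "induced_complex K h f = (\<lambda>\<sigma>. induced_vertex h f ` \<sigma>) ` K"

definition induces_decomposition ::
    "'v set set \<Rightarrow> (('v \<Rightarrow> real) \<Rightarrow> 'a) \<Rightarrow> ('a \<Rightarrow> 'b) \<Rightarrow> 'b topology \<Rightarrow> bool" where
  "induces_decomposition K h f Y \<longleftrightarrow>
     (\<forall>\<sigma>\<in>K. inj_on (\<lambda>u. f (h u)) (closed_simplex \<sigma>)) \<and>
     (\<exists>g. simplicial_decomposition (induced_complex K h f) Y g \<and>
          (\<forall>u\<in>realization K. g (realization_map (induced_vertex h f) u) = f (h u)))"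

definition prism_facets :: "nat set set" where
  "prism_facets =
    {{4,5,7,9}, {5,6,7,10}, {4,6,7,8}, {4,7,8,9}, {5,7,9,10}, {6,7,8,10},
     {4,1,8,9}, {5,2,9,10}, {0,6,8,10}, {0,8,10,11}, {1,8,9,11}, {2,9,10,11},
     {0,1,8,11}, {1,2,9,11}, {0,2,10,11}, {7,8,9,10}, {8,9,10,11}, {0,1,2,11}, {0,1,2,3}}"

definition prism_complex :: "nat set set" where
  "prism_complex = generated_complex prism_facets"

definition barnette_facets :: "nat set set" where
  "barnette_facets =
    {{0,1,3,9}, {1,2,3,10}, {0,2,3,8}, {0,3,8,9}, {1,3,9,10}, {2,3,8,10},
     {0,1,8,9}, {1,2,9,10}, {0,2,8,10}, {0,8,10,11}, {1,8,9,11}, {2,9,10,11},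
     {0,1,8,11}, {1,2,9,11}, {0,2,10,11}, {3,8,9,10}, {8,9,10,11}, {0,1,2,11}, {0,1,2,3}}"

definition barnette_sphere :: "nat set set" where
  "barnette_sphere = generated_complex barnette_facets"

definition prism_q :: "nat \<Rightarrow> nat" where
  "prism_q i = (if 4 \<le> i \<and> i \<le> 7 then i - 4 else i)"

definition band_complex :: "nat set set" where
  "band_complex = generated_complex {{0,1,8}, {0,2,8}, {0,1,9}, {1,2,9}, {0,2,10}, {1,2,10}}"

definition band_boundary_complex :: "nat set set" where
  "band_boundary_complex = generated_complex {{1,8}, {2,8}, {0,9}, {2,9}, {0,10}, {1,10}}"

lemma generated_complex_UN: "generated_complex F = (\<Union>\<tau>\<in>F. Pow \<tau>) - {{}}"
  by (auto simp: generated_complex_def)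

lemma complex_vertices_generated: "complex_vertices (generated_complex F) = \<Union>F"
  by (auto simp: complex_vertices_def generated_complex_def)

lemma finite_generated_complex: "finite F \<Longrightarrow> (\<And>\<tau>. \<tau> \<in> F \<Longrightarrow> finite \<tau>) \<Longrightarrow> finite (generated_complex F)"
  by (auto simp: generated_complex_UN)

lemma generated_complex_iff: "\<sigma> \<in> generated_complex F \<longleftrightarrow> \<sigma> \<noteq> {} \<and> (\<exists>\<tau>\<in>F. \<sigma> \<subseteq> \<tau>)"
  by (simp add: generated_complex_def)
lemma abstract_complex_generated:
  assumes "\<And>\<tau>. \<tau> \<in> F \<Longrightarrow> finite \<tau>"
  shows "abstract_complex (generated_complex F)"
  unfolding abstract_complex_def
proof (intro ballI conjI allI impI)
  fix \<sigma> assume "\<sigma> \<in> generated_complex F"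
  then obtain \<rho> where \<rho>: "\<sigma> \<noteq> {}" "\<rho> \<in> F" "\<sigma> \<subseteq> \<rho>"
    unfolding generated_complex_iff by (elim conjE bexE)
  show "finite \<sigma>" by (rule finite_subset[OF \<rho>(3) assms[OF \<rho>(2)]])
  show "\<sigma> \<noteq> {}" by fact
  fix \<tau> assume "\<tau> \<subseteq> \<sigma>" "\<tau> \<noteq> {}"
  then show "\<tau> \<in> generated_complex F"
    unfolding generated_complex_iff
    by (intro conjI bexI[of _ \<rho>] order_trans[OF _ \<rho>(3)] \<rho>(2))
qed

lemma complex_facets_generated:
  assumes ne: "{} \<notin> F"
    and anti: "\<And>\<sigma> \<tau>. \<sigma> \<in> F \<Longrightarrow> \<tau> \<in> F \<Longrightarrow> \<sigma> \<subseteq> \<tau> \<Longrightarrow> \<sigma> = \<tau>"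
  shows "complex_facets (generated_complex F) = F"
proof (intro set_eqI iffI)
  fix \<sigma> assume *: "\<sigma> \<in> complex_facets (generated_complex F)"
  then have "\<sigma> \<noteq> {}" "\<exists>\<tau>\<in>F. \<sigma> \<subseteq> \<tau>"
    by (simp_all add: complex_facets_def generated_complex_iff)
  then obtain \<tau> where \<tau>: "\<tau> \<in> F" "\<sigma> \<subseteq> \<tau>" by (elim bexE)
  from ne \<tau>(1) have "\<tau> \<noteq> {}" by (elim contrapos_nn) simp
  with \<tau>(1) have "\<tau> \<in> generated_complex F"
    unfolding generated_complex_iff by (intro conjI bexI[of _ \<tau>] order_refl)
  with * \<tau>(2) have "\<tau> = \<sigma>" by (simp add: complex_facets_def)
  with \<tau>(1) show "\<sigma> \<in> F" by simp
next
  fix \<sigma> assume \<sigma>: "\<sigma> \<in> F"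
  have "\<sigma> \<noteq> {}" using ne \<sigma> by (elim contrapos_nn) simp
  with \<sigma> have "\<sigma> \<in> generated_complex F"
    unfolding generated_complex_iff by (intro conjI bexI[of _ \<sigma>] order_refl)
  moreover have "\<tau> = \<sigma>" if \<tau>: "\<tau> \<in> generated_complex F" "\<sigma> \<subseteq> \<tau>" for \<tau>
  proof -
    from \<tau>(1) obtain \<rho> where \<rho>: "\<rho> \<in> F" "\<tau> \<subseteq> \<rho>" unfolding generated_complex_iff by (elim conjE bexE)
    have "\<sigma> = \<rho>" by (rule anti[OF \<sigma> \<rho>(1) order_trans[OF \<tau>(2) \<rho>(2)]])
    with \<rho>(2) \<tau>(2) show ?thesis by (simp add: subset_antisym)
  qed
  ultimately show "\<sigma> \<in> complex_facets (generated_complex F)"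
    by (simp add: complex_facets_def)
qed
lemma complex_facets_generated_uniform:
  assumes "\<And>\<sigma>. \<sigma> \<in> F \<Longrightarrow> card \<sigma> = Suc n"
  shows "complex_facets (generated_complex F) = F"
proof (rule complex_facets_generated)
  show "{} \<notin> F" using assms[of "{}"] by (intro notI) simp
next
  fix \<sigma> \<tau> assume *: "\<sigma> \<in> F" "\<tau> \<in> F" "\<sigma> \<subseteq> \<tau>"
  have "finite \<tau>" by (rule card_ge_0_finite) (simp add: assms[OF *(2)])
  then show "\<sigma> = \<tau>" by (rule card_subset_eq) (simp_all add: * assms)
qed
lemma complex_facets_prism: "complex_facets prism_complex = prism_facets"
  unfolding prism_complex_def
  by (rule complex_facets_generated_uniform[where n = 3]) (auto simp: prism_facets_def)

lemma complex_facets_barnette: "complex_facets barnette_sphere = barnette_facets"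
  unfolding barnette_sphere_def
  by (rule complex_facets_generated_uniform[where n = 3]) (auto simp: barnette_facets_def)

lemma complex_vertices_prism: "complex_vertices prism_complex = {0,1,2,3,4,5,6,7,8,9,10,11}"
  unfolding prism_complex_def complex_vertices_generated prism_facets_def
  by (intro subset_antisym; simp)

lemma complex_vertices_barnette: "complex_vertices barnette_sphere = {0,1,2,3,8,9,10,11}"
  unfolding barnette_sphere_def complex_vertices_generated barnette_facets_def
  by (intro subset_antisym; simp)

abbreviation S3_top :: "(real \<times> real \<times> real) option topology" where
  "S3_top \<equiv> Alexandroff_compactification euclidean"

definition three_half_twist :: "real \<Rightarrow> real \<Rightarrow> real \<times> real \<times> real" where
  "three_half_twist \<theta> t =
     ((2 + t * cos (3 * \<theta> / 2)) * cos \<theta>, (2 + t * cos (3 * \<theta> / 2)) * sin \<theta>, t * sin (3 * \<theta> / 2))"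

definition standard_band :: "(real \<times> real \<times> real) set" where
  "standard_band = {three_half_twist \<theta> t | \<theta> t. \<theta> \<in> {0..2*pi} \<and> t \<in> {-1..1}}"

definition standard_band_boundary :: "(real \<times> real \<times> real) set" where
  "standard_band_boundary = {three_half_twist \<theta> t | \<theta> t. \<theta> \<in> {0..2*pi} \<and> t \<in> {-1, 1}}"

text \<open>The homeomorphism of pairs carries \<open>B\<close> to the edge \<open>t = 1\<close>, \<open>t = -1\<close> of the band, so \<open>B\<close> is the manifold
  boundary of \<open>A\<close>.  It may reverse the orientation, so both directions of twisting are admitted.\<close>

definition twisted_band_with_boundary :: "'a topology \<Rightarrow> 'a set \<Rightarrow> 'a set \<Rightarrow> bool" where
  "twisted_band_with_boundary Y A B \<longleftrightarrow>
     (\<exists>\<Phi>. homeomorphic_map Y S3_top \<Phi> \<and> A \<subseteq> topspace Y \<and> B \<subseteq> topspace Y \<and>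
          \<Phi> ` A = Some ` standard_band \<and> \<Phi> ` B = Some ` standard_band_boundary)"

end

theory Submission
  imports Defs
begin

text \<open>To find the homeomorphism from \<open>|K|\<close> to \<open>P\<close>, eleven flips turn \<open>K\<close> into the cone over its boundary, and five inverse
  stellar subdivisions turn that into a cone over eight triangles, which is mapped linearly onto \<open>P\<close>.  The flips fix the
  boundary, so the homeomorphism is affine on the boundary triangles; there \<open>\<sim>\<close> is an affine gluing of triangles and can be
  compared with \<open>q\<close> directly.

  Gluing the top of \<open>P\<close> to its bottom by a third of a turn gives a solid torus, and \<open>P/\<sim>\<close> folds the boundary torus two to
  one onto the band \<open>S/\<sim>\<close>.  In the join \<open>|u| + |w| = 1\<close> of two circles, that is the 3-sphere, the complement of a band around
  the circle \<open>w = 0\<close> that makes three half twists is filled by the ellipses around the cross sections of the band, and this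
  exhibits it as the same solid torus with folded boundary.\<close>

section \<open>Bistellar moves on geometric realizations\<close>

text \<open>The obstacle is that the positions of the vertices are prescribed while some tetrahedra
  of \<open>K\<close> have coplanar vertices there, so no map that is affine on every simplex of
  \<open>K\<close> can work. Each bistellar move is instead a piecewise linear homeomorphism that is
  the identity outside the star of the removed face. Away from the boundary nothing is glued: for
  \<open>\<sim>\<close> because the inequalities of the prism are strict there, for \<open>q\<close>
  by a finite check.

  The three half twists have a simple origin. A two-point set with angles \<open>p\<close> and
  \<open>q\<close>, in turns, comes from the triples \<open>(p, p, q)\<close> and
  \<open>(p, q, q)\<close> on the two sides of the fold. The sum \<open>p + q\<close> is the angle
  along the band, and the bisector of the coordinate sums \<open>2 * p + q\<close> and
  \<open>p + 2 * q\<close>, which is 3/2 of \<open>p + q\<close>, gives the direction of its cross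
  section. A band alone does not determine its position in the sphere, hence the effort to extend
  these coordinates over the whole solid torus.\<close>

lemma realization_generated_iff:
  assumes "\<And>T. T \<in> F \<Longrightarrow> finite T"
  shows "b \<in> realization (generated_complex F) \<longleftrightarrow>
    (\<forall>v. 0 \<le> b v) \<and> (\<exists>T\<in>F. {v. b v \<noteq> 0} \<subseteq> T \<and> sum b T = 1)"
proof
  assume "b \<in> realization (generated_complex F)"
  then obtain \<sigma> T where *: "b \<in> closed_simplex \<sigma>" "T \<in> F" "\<sigma> \<subseteq> T"
    by (auto simp: realization_def generated_complex_def)
  have "sum b T = sum b \<sigma>"
    using * assms by (intro sum.mono_neutral_right) (auto simp: closed_simplex_def)
  then show "(\<forall>v. 0 \<le> b v) \<and> (\<exists>T\<in>F. {v. b v \<noteq> 0} \<subseteq> T \<and> sum b T = 1)"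
    using * by (auto simp: closed_simplex_def)
next
  assume "(\<forall>v. 0 \<le> b v) \<and> (\<exists>T\<in>F. {v. b v \<noteq> 0} \<subseteq> T \<and> sum b T = 1)"
  then obtain T where "T \<in> F" "b \<in> closed_simplex T"
    by (auto simp: closed_simplex_def)
  moreover from this have "T \<noteq> {}" by (auto simp: closed_simplex_def)
  ultimately show "b \<in> realization (generated_complex F)"
    by (auto simp: realization_def generated_complex_def)
qed

text \<open>The move pushes a point along the affine dependence between the barycentres of \<open>A\<close> and \<open>B\<close> until
  it leaves the simplex \<open>A\<close>.  If \<open>A\<close> and \<open>B\<close> have five vertices together this realizes a bistellar flip;
  if one of them is a singleton, a stellar subdivision or its inverse.\<close>

definition bistellar :: "'v set \<Rightarrow> 'v set \<Rightarrow> ('v \<Rightarrow> real) \<Rightarrow> 'v \<Rightarrow> real" where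
  "bistellar A B b = (\<lambda>v. b v - (if v \<in> A then Min (b ` A) else 0)
     + (if v \<in> B then Min (b ` A) * card A / card B else 0))"

lemma continuous_on_Min_image:
  fixes A :: "'v set"
  assumes "finite A" "A \<noteq> {}"
  shows "continuous_on UNIV (\<lambda>b::'v \<Rightarrow> real. Min (b ` A))"
  using assms
proof (induction rule: finite_ne_induct)
  case (singleton x)
  then show ?case by (auto intro: continuous_intros)
next
  case (insert x F)
  then show ?case by (auto intro!: continuous_intros)
qed

lemma continuous_on_bistellar:
  fixes A :: "'v set"
  assumes "finite A" "A \<noteq> {}"
  shows "continuous_on S (bistellar A B)"
proof -
  have "continuous_on UNIV (\<lambda>b::'v \<Rightarrow> real. bistellar A B b v)" for v
    using continuous_on_Min_image[OF assms]
    by (cases "v \<in> A"; cases "v \<in> B") (auto simp: bistellar_def divide_inverse intro!: continuous_intros)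
  then show ?thesis
    using continuous_on_coordinatewise_then_product continuous_on_subset subset_UNIV by blast
qed

text \<open>The minimum of \<open>b\<close> over \<open>B\<close> is 0 before the move, so
  afterwards it is exactly the amount that each vertex of \<open>B\<close> has received; the reverse
  move takes away just that amount.\<close>

lemma bistellar_bistellar:
  assumes "finite A" "A \<noteq> {}" "finite B" "B \<noteq> {}" "A \<inter> B = {}" "Min (b ` B) = 0"
  shows "bistellar B A (bistellar A B b) = b"
proof -
  let ?m = "Min (b ` A)" and ?c = "bistellar A B b"
  have "?c ` B = (\<lambda>x. x + ?m * card A / card B) ` b ` B"
    using assms(5) unfolding image_image by (intro image_cong) (auto simp: bistellar_def)
  moreover have "Min ((\<lambda>x. x + ?m * card A / card B) ` b ` B) = Min (b ` B) + ?m * card A / card B"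
    using assms by (intro Min_add_commute[symmetric, where f = "\<lambda>x. x", simplified]
       mono_Min_commute[symmetric]) (auto intro: monoI)
  ultimately have "Min (?c ` B) = ?m * card A / card B" using assms(6) by simp
  then have "Min (?c ` B) * card B / card A = ?m"
    using assms by (simp add: card_gt_0_iff)
  with \<open>Min (?c ` B) = _\<close> show ?thesis
    using assms(5) by (auto simp: bistellar_def[of B A] bistellar_def[of A B b])
qed

text \<open>The star of \<open>A\<close> makes way for the simplices that join \<open>B\<close> to
  the boundary of \<open>A\<close> and to the link of \<open>A\<close>. A facet \<open>T\<close> may
  already contain a part of \<open>B\<close>, hence the union.\<close>

definition bistellar_facets :: "'v set \<Rightarrow> 'v set \<Rightarrow> 'v set set \<Rightarrow> 'v set set" where
  "bistellar_facets A B F = (\<Union>T\<in>F. if A \<subseteq> T then (\<lambda>a. T - {a} \<union> B) ` A else {T})"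

lemma bistellar_facets_eq:
  "bistellar_facets A B F = {T \<in> F. \<not> A \<subseteq> T} \<union> {T - {a} \<union> B | T a. T \<in> F \<and> A \<subseteq> T \<and> a \<in> A}"
  by (auto simp: bistellar_facets_def split: if_splits)

text \<open>\<open>B\<close> has to be a new face, and the last condition says that every proper
  face of \<open>B\<close>, joined with a facet around \<open>A\<close>, is already present. This
  keeps the reverse move inside the complex generated by \<open>F\<close>.\<close>

definition bistellar_ok :: "'v set \<Rightarrow> 'v set \<Rightarrow> 'v set set \<Rightarrow> bool" where
  "bistellar_ok A B F \<longleftrightarrow> A \<noteq> {} \<and> B \<noteq> {} \<and> A \<inter> B = {} \<and> finite A \<and> finite B \<and>
     (\<forall>T\<in>F. finite T \<and> \<not> B \<subseteq> T \<and> (A \<subseteq> T \<longrightarrow> (\<forall>b\<in>B. \<exists>U\<in>F. T \<union> B - {b} \<subseteq> U)))"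

lemma Min_image_eq_0:
  fixes b :: "'v \<Rightarrow> real"
  assumes "\<And>v. 0 \<le> b v" "{v. b v \<noteq> 0} \<subseteq> T" "\<not> B \<subseteq> T" "finite B"
  shows "Min (b ` B) = 0"
proof -
  obtain v where "v \<in> B" "b v = 0" using assms by auto
  then show ?thesis using assms by (intro Min_eqI) (auto simp: rev_image_eqI)
qed

lemma Min_image_realization_eq_0:
  assumes b: "b \<in> realization (generated_complex F)" and F: "\<And>T. T \<in> F \<Longrightarrow> finite T \<and> \<not> B \<subseteq> T"
    and B: "finite B"
  shows "Min (b ` B) = 0"
proof -
  obtain T where "T \<in> F" "{v. b v \<noteq> 0} \<subseteq> T" "\<And>v. 0 \<le> b v"
    using realization_generated_iff[of F b, THEN iffD1, OF _ b] F by blast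
  then show ?thesis using F B by (intro Min_image_eq_0[of b T]) auto
qed

text \<open>A vertex \<open>a\<close> of \<open>A\<close> at which \<open>b\<close> is smallest
  loses all its weight and drops out of the support. The weight that leaves \<open>A\<close> is
  \<open>card A\<close> times the minimum and is shared equally by \<open>B\<close>.\<close>

lemma bistellar_in_closed_simplex:
  assumes A: "finite A" "A \<noteq> {}" and B: "finite B" "B \<noteq> {}" and AB: "A \<inter> B = {}" and "finite T" "A \<subseteq> T"
    and b: "b \<in> closed_simplex T"
  shows "\<exists>a\<in>A. bistellar A B b \<in> closed_simplex (T - {a} \<union> B)"
proof -
  let ?m = "Min (b ` A)"
  have "?m \<in> b ` A" using A by (intro Min_in) auto
  then obtain a where a: "a \<in> A" "b a = ?m" by auto
  have le: "?m \<le> b v" if "v \<in> A" for v using A that by auto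
  have nn: "0 \<le> b v" for v using b by (auto simp: closed_simplex_def)
  have m0: "0 \<le> ?m" using nn a by metis
  have supp: "v \<in> T" if "b v \<noteq> 0" for v using that b by (auto simp: closed_simplex_def)
  let ?c = "bistellar A B b"
  have c0: "0 \<le> ?c v" for v using le[of v] m0 nn[of v] by (auto simp: bistellar_def)
  have cs: "{v. ?c v \<noteq> 0} \<subseteq> T - {a} \<union> B"
    using a supp assms(7) by (auto simp: bistellar_def split: if_splits)
  have "sum ?c (T \<union> B) = sum b (T \<union> B) - (\<Sum>v\<in>T \<union> B. if v \<in> A then ?m else 0)
     + (\<Sum>v\<in>T \<union> B. if v \<in> B then ?m * card A / card B else 0)"
    by (simp add: bistellar_def sum.distrib sum_subtractf)
  also have "(\<Sum>v\<in>T \<union> B. if v \<in> A then ?m else 0) = (\<Sum>v\<in>A. ?m)"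
    using assms by (intro sum.mono_neutral_cong_right) auto
  also have "(\<Sum>v\<in>T \<union> B. if v \<in> B then ?m * card A / card B else 0) = (\<Sum>v\<in>B. ?m * card A / card B)"
    using assms by (intro sum.mono_neutral_cong_right) auto
  also have "sum b (T \<union> B) = sum b T"
    using assms supp by (intro sum.mono_neutral_right) auto
  finally have "sum ?c (T \<union> B) = 1"
    using b B by (simp add: closed_simplex_def)
  moreover have "sum ?c (T \<union> B) = sum ?c (T - {a} \<union> B)"
    using assms cs by (intro sum.mono_neutral_right) auto
  ultimately show ?thesis using c0 cs a by (auto simp: closed_simplex_def intro!: bexI[of _ a])
qed

text \<open>\<open>F\<close> and \<open>G\<close> are linked only by containments, so that one
  argument serves a move and, with \<open>A\<close> and \<open>B\<close> exchanged, its
  inverse.\<close>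

lemma bistellar_realization:
  assumes ok: "A \<noteq> {}" "B \<noteq> {}" "A \<inter> B = {}" "finite A" "finite B"
    and F: "\<And>T. T \<in> F \<Longrightarrow> finite T" and G: "\<And>T. T \<in> G \<Longrightarrow> finite T"
    and FG: "\<And>T. T \<in> F \<Longrightarrow> \<not> A \<subseteq> T \<Longrightarrow> \<exists>U\<in>G. T \<subseteq> U"
      "\<And>T a. T \<in> F \<Longrightarrow> A \<subseteq> T \<Longrightarrow> a \<in> A \<Longrightarrow> \<exists>U\<in>G. T - {a} \<union> B \<subseteq> U"
    and b: "b \<in> realization (generated_complex F)"
  shows "bistellar A B b \<in> realization (generated_complex G)"
proof -
  have sub: "c \<in> realization (generated_complex G)"
    if "c \<in> closed_simplex T" "T \<subseteq> U" "U \<in> G" for c T U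
    using that by (auto simp: realization_def generated_complex_def closed_simplex_def intro!: exI[of _ T])
  obtain T where T: "T \<in> F" "b \<in> closed_simplex T"
    using b F by (subst (asm) realization_generated_iff) (auto simp: closed_simplex_def)
  show ?thesis
  proof (cases "A \<subseteq> T")
    case True
    with bistellar_in_closed_simplex[of A B T b] T ok F
    obtain a where "a \<in> A" "bistellar A B b \<in> closed_simplex (T - {a} \<union> B)" by blast
    then show ?thesis using FG(2)[OF T(1) True] sub by blast
  next
    case False
    then have "Min (b ` A) = 0"
      using T ok by (intro Min_image_eq_0) (auto simp: closed_simplex_def)
    then have "bistellar A B b = b" by (auto simp: bistellar_def)
    then show ?thesis using FG(1)[OF T(1) False] sub T by metis
  qed
qed

lemma bij_betw_bistellar:
  assumes "bistellar_ok A B F"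
  shows "bij_betw (bistellar A B) (realization (generated_complex F))
    (realization (generated_complex (bistellar_facets A B F)))"
proof -
  let ?G = "bistellar_facets A B F"
  note ok = assms[unfolded bistellar_ok_def]
  have F: "finite T \<and> \<not> B \<subseteq> T" if "T \<in> F" for T using that ok by auto
  have G: "finite T \<and> \<not> A \<subseteq> T" if "T \<in> ?G" for T
    using that ok by (auto simp: bistellar_facets_eq)
  have "bistellar A B b \<in> realization (generated_complex ?G)"
    if "b \<in> realization (generated_complex F)" for b
  proof (rule bistellar_realization[OF _ _ _ _ _ _ _ _ _ that])
    show "\<exists>U\<in>?G. T - {a} \<union> B \<subseteq> U" if "T \<in> F" "A \<subseteq> T" "a \<in> A" for T a
      using that by (intro bexI[of _ "T - {a} \<union> B"]) (auto simp: bistellar_facets_eq)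
    show "\<exists>U\<in>?G. T \<subseteq> U" if "T \<in> F" "\<not> A \<subseteq> T" for T
      using that by (intro bexI[of _ "T"]) (auto simp: bistellar_facets_eq)
  qed (use ok F G in auto)
  moreover have "bistellar B A b \<in> realization (generated_complex F)"
    if "b \<in> realization (generated_complex ?G)" for b
  proof (rule bistellar_realization[OF _ _ _ _ _ _ _ _ _ that])
    show "\<exists>U\<in>F. T \<subseteq> U" if T: "T \<in> ?G" "\<not> B \<subseteq> T" for T
      using that by (intro bexI[of _ "T"]) (auto simp: bistellar_facets_eq)
    show "\<exists>U\<in>F. T - {c} \<union> A \<subseteq> U" if T: "T \<in> ?G" "B \<subseteq> T" "c \<in> B" for T c
    proof -
      obtain U a where U: "U \<in> F" "A \<subseteq> U" "a \<in> A" "T = U - {a} \<union> B"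
        using T ok by (auto simp: bistellar_facets_eq)
      \<comment> \<open>Putting \<open>A\<close> back into \<open>T - {c}\<close> gives
        \<open>U\<close> joined with \<open>B\<close> without \<open>c\<close>, which
        \<open>bistellar_ok\<close> places inside a facet of \<open>F\<close>.\<close>
      then obtain X where "X \<in> F" "U \<union> B - {c} \<subseteq> X" using ok T(3) by metis
      then show ?thesis using U T(3) ok by (intro bexI[of _ X]) auto
    qed
  qed (use ok F G in auto)
  moreover have "bistellar B A (bistellar A B b) = b" if "b \<in> realization (generated_complex F)" for b
    using Min_image_realization_eq_0[OF that F] ok by (intro bistellar_bistellar) auto
  moreover have "bistellar A B (bistellar B A b) = b" if "b \<in> realization (generated_complex ?G)" for b
    using Min_image_realization_eq_0[OF that G] ok by (intro bistellar_bistellar) auto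
  ultimately show ?thesis
    by (intro bij_betw_byWitness[where f' = "bistellar B A"]) auto
qed

section \<open>Moves on lists of facets, checked by evaluation\<close>

definition list_subset :: "'v list \<Rightarrow> 'v list \<Rightarrow> bool" where
  "list_subset xs ys = list_all (\<lambda>x. list_ex (\<lambda>y. x = y) ys) xs"

lemma list_subset_iff: "list_subset xs ys \<longleftrightarrow> set xs \<subseteq> set ys"
  by (auto simp: list_subset_def list_all_iff list_ex_iff)

text \<open>Sorting gives a new facet one normal form, so that \<open>remdups\<close> merges facets
  that arise from different \<open>T\<close> and \<open>a\<close>, and the lists stay short along a
  path.\<close>

definition bistellar_list :: "'v::linorder list \<Rightarrow> 'v list \<Rightarrow> 'v list list \<Rightarrow> 'v list list" where
  "bistellar_list A B F = remdups (concat (map (\<lambda>T. if list_subset A T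
     then map (\<lambda>a. sort (remdups (filter (\<lambda>x. x \<noteq> a) T @ B))) A else [T]) F))"

abbreviation list_complex :: "'v list list \<Rightarrow> 'v set set" where
  "list_complex Fs \<equiv> generated_complex (set ` set Fs)"

lemma set_bistellar_list:
  "set ` set (bistellar_list A B F) = bistellar_facets (set A) (set B) (set ` set F)"
proof -
  define f where "f = (\<lambda>T. if list_subset A T
     then map (\<lambda>a. sort (remdups (filter (\<lambda>x. x \<noteq> a) T @ B))) A else [T])"
  have f: "set ` set (f T) = (if set A \<subseteq> set T then (\<lambda>a. set T - {a} \<union> set B) ` set A else {set T})" for T
    by (auto simp: f_def list_subset_iff image_image intro!: image_cong)
  have "set ` set (bistellar_list A B F) = (\<Union>T\<in>set F. set ` set (f T))"
    unfolding bistellar_list_def f_def[symmetric] by auto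
  also have "\<dots> = bistellar_facets (set A) (set B) (set ` set F)"
    unfolding f bistellar_facets_def by blast
  finally show ?thesis .
qed

definition bistellar_list_ok :: "'v list \<Rightarrow> 'v list \<Rightarrow> 'v list list \<Rightarrow> bool" where
  "bistellar_list_ok A B F \<longleftrightarrow> A \<noteq> [] \<and> B \<noteq> [] \<and> list_all (\<lambda>x. list_all (\<lambda>y. x \<noteq> y) B) A \<and>
     list_all (\<lambda>T. \<not> list_subset B T \<and> (list_subset A T \<longrightarrow>
       list_all (\<lambda>b. list_ex (list_subset (filter (\<lambda>x. x \<noteq> b) (T @ B))) F) B)) F"

lemma bistellar_list_ok_imp:
  assumes "bistellar_list_ok A B F"
  shows "bistellar_ok (set A) (set B) (set ` set F)"
proof -
  have *: "set (filter (\<lambda>x. x \<noteq> b) (T @ B)) = set T \<union> set B - {b}" for b and T :: "'a list" by auto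
  show ?thesis
    using assms unfolding bistellar_list_ok_def bistellar_ok_def list_all_iff list_ex_iff list_subset_iff *
    by auto
qed

fun bistellar_path :: "('v list \<times> 'v list) list \<Rightarrow> ('v \<Rightarrow> real) \<Rightarrow> 'v \<Rightarrow> real" where
  "bistellar_path [] b = b"
| "bistellar_path ((A, B) # ms) b = bistellar_path ms (bistellar (set A) (set B) b)"

fun bistellar_path_list :: "('v::linorder list \<times> 'v list) list \<Rightarrow> 'v list list \<Rightarrow> 'v list list" where
  "bistellar_path_list [] F = F"
| "bistellar_path_list ((A, B) # ms) F = bistellar_path_list ms (bistellar_list A B F)"

fun bistellar_path_ok :: "('v::linorder list \<times> 'v list) list \<Rightarrow> 'v list list \<Rightarrow> bool" where
  "bistellar_path_ok [] F = True"
| "bistellar_path_ok ((A, B) # ms) F = (bistellar_list_ok A B F \<and> bistellar_path_ok ms (bistellar_list A B F))"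

lemma bij_betw_bistellar_path:
  assumes "bistellar_path_ok ms F"
  shows "bij_betw (bistellar_path ms) (realization (list_complex F))
    (realization (list_complex (bistellar_path_list ms F)))"
  using assms
proof (induction ms F rule: bistellar_path_ok.induct)
  case (1 F)
  then show ?case by (simp add: bij_betw_def inj_on_def)
next
  case (2 A B ms F)
  have "bij_betw (bistellar (set A) (set B)) (realization (list_complex F))
    (realization (list_complex (bistellar_list A B F)))"
    using bij_betw_bistellar[OF bistellar_list_ok_imp, of A B F] 2(2) by (simp add: set_bistellar_list)
  moreover have "bij_betw (bistellar_path ms) (realization (list_complex (bistellar_list A B F)))
    (realization (generated_complex (set ` set (bistellar_path_list ((A, B) # ms) F))))"
    using 2 by simp
  ultimately have "bij_betw (bistellar_path ms \<circ> bistellar (set A) (set B)) (realization (list_complex F))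
    (realization (generated_complex (set ` set (bistellar_path_list ((A, B) # ms) F))))"
    by (rule bij_betw_trans)
  then show ?case by (simp add: comp_def)
qed

lemma continuous_on_bistellar_path:
  assumes "bistellar_path_ok ms F"
  shows "continuous_on S (bistellar_path ms)"
  using assms
proof (induction ms F arbitrary: S rule: bistellar_path_ok.induct)
  case (1 F)
  have "bistellar_path [] = id" by auto
  then show ?case by (simp add: continuous_on_id)
next
  case (2 A B ms F)
  have "bistellar_path ((A, B) # ms) = bistellar_path ms \<circ> bistellar (set A) (set B)" by auto
  moreover have "continuous_on S (bistellar (set A) (set B))"
    using 2(2) by (intro continuous_on_bistellar) (auto simp: bistellar_list_ok_def)
  ultimately show ?case
    using 2 by (simp only: continuous_on_compose bistellar_path_ok.simps)
qed

section \<open>A decomposition of the prism\<close>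

text \<open>A path of flips found by computer search.  It leads from \<open>K\<close> to the cone with apex \<open>11\<close> over the boundary
  of \<open>K\<close> and never touches that boundary.\<close>

definition prism_flips :: "(nat list \<times> nat list) list" where
  "prism_flips =
     [([0,8,10], [6,11]), ([6,8,10], [7,11]), ([6,7,8], [4,11]), ([8,10], [7,9,11]), ([7,8],
     [4,9,11]), ([4,7,9], [5,11]), ([7,9], [5,10,11]), ([0,1,2], [3,11]), ([9,10], [2,5,11]),
     ([8,9], [1,4,11]), ([7,10], [5,6,11])]"

text \<open>Inverse stellar subdivisions.  They remove the barycentres \<open>3\<close>, \<open>7\<close> and the midpoints \<open>8\<close>, \<open>9\<close>, \<open>10\<close>, and
  therefore commute with the linear map below.\<close>

definition prism_welds :: "(nat list \<times> nat list) list" where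
  "prism_welds =
     [([3], [0,1,2]), ([7], [4,5,6]), ([8], [1,6]), ([9], [2,4]), ([10], [0,5])]"

definition prism_facet_list :: "nat list list" where
  "prism_facet_list =
     [[4,5,7,9], [5,6,7,10], [4,6,7,8], [4,7,8,9], [5,7,9,10], [6,7,8,10], [1,4,8,9], [2,5,9,10],
     [0,6,8,10], [0,8,10,11], [1,8,9,11], [2,9,10,11], [0,1,8,11], [1,2,9,11], [0,2,10,11],
     [7,8,9,10], [8,9,10,11], [0,1,2,11], [0,1,2,3]]"

definition prism_boundary_list :: "nat list list" where
  "prism_boundary_list = [[0,1,3], [0,2,3], [1,2,3], [4,5,7], [4,6,7], [5,6,7],
     [0,1,8], [0,6,8], [0,6,10], [5,6,10], [1,2,9], [1,4,9], [1,4,8], [4,6,8],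
     [0,2,10], [2,5,10], [2,5,9], [4,5,9]]"

definition prism_base_list :: "nat list list" where
  "prism_base_list = [[0,1,2], [4,5,6], [0,1,6], [0,5,6], [1,2,4], [1,4,6], [0,2,5], [2,4,5]]"

lemma set_prism_facet_list: "set ` set prism_facet_list = prism_facets"
  by (simp add: prism_facet_list_def prism_facets_def insert_commute)

lemma prism_flips_ok: "bistellar_path_ok prism_flips prism_facet_list"
  by code_simp

text \<open>Equality of the generated complexes, tested by mutual containment of facets, which is
  independent of the order of the facets and of their vertices.\<close>

definition list_equiv :: "'v list list \<Rightarrow> 'v list list \<Rightarrow> bool" where
  "list_equiv F G \<longleftrightarrow> list_all (\<lambda>T. list_ex (list_subset T) G) F \<and> list_all (\<lambda>T. list_ex (list_subset T) F) G"

lemma prism_flips_result: 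
  "list_equiv (bistellar_path_list prism_flips prism_facet_list) (map (\<lambda>T. T @ [11]) prism_boundary_list)"
  by code_simp

lemma prism_welds_ok: "bistellar_path_ok prism_welds (map (\<lambda>T. T @ [11]) prism_boundary_list)"
  by code_simp

lemma prism_welds_result: 
  "list_equiv (bistellar_path_list prism_welds (map (\<lambda>T. T @ [11]) prism_boundary_list))
    (map (\<lambda>T. T @ [11]) prism_base_list)"
  by code_simp

lemma realization_list_cases:
  assumes "b \<in> realization (list_complex Fs)"
  obtains T where "T \<in> set Fs" "\<And>v. 0 \<le> b v" "\<And>v. v \<notin> set T \<Longrightarrow> b v = 0" "sum b (set T) = 1"
proof -
  have "\<exists>T\<in>set ` set Fs. (\<forall>v. 0 \<le> b v) \<and> {v. b v \<noteq> 0} \<subseteq> T \<and> sum b T = 1"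
    using realization_generated_iff[of "set ` set Fs" b] assms by auto
  then show ?thesis using that by blast
qed

lemma realization_listI:
  assumes "T \<in> set Fs" "\<And>v. 0 \<le> b v" "\<And>v. v \<notin> set T \<Longrightarrow> b v = 0" "sum b (set T) = 1"
  shows "b \<in> realization (list_complex Fs)"
  using assms by (subst realization_generated_iff) (auto intro!: bexI[of _ T])

lemma realization_mono_list:
  assumes "list_all (\<lambda>T. list_ex (list_subset T) G) F"
  shows "realization (list_complex F) \<subseteq> realization (list_complex G)"
proof -
  have "list_complex F \<subseteq> list_complex G"
    using assms by (fastforce simp: list_all_iff list_ex_iff list_subset_iff generated_complex_def)
  then show ?thesis by (auto simp: realization_def)
qed

lemma realization_list_equiv:
  assumes "list_equiv F G"
  shows "realization (list_complex F) = realization (list_complex G)"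
  using assms realization_mono_list[of F G] realization_mono_list[of G F] by (simp add: list_equiv_def subset_antisym)

text \<open>The support of \<open>b\<close> lies in a facet of \<open>F\<close>, and no such facet
  contains a removed face. Hence each minimum is 0, each move leaves \<open>b\<close> in place, and
  the argument repeats along the path.\<close>

lemma bistellar_path_fixed:
  assumes "list_all (\<lambda>(A, B). list_all (\<lambda>T. \<not> list_subset A T) F) ms"
    and b: "b \<in> realization (list_complex F)"
  shows "bistellar_path ms b = b"
  using assms(1)
proof (induction ms)
  case (Cons m ms)
  obtain A B where m: "m = (A, B)" by (cases m)
  have "Min (b ` set A) = 0"
    using Cons.prems m by (intro Min_image_realization_eq_0[OF b]) (auto simp: list_all_iff list_subset_iff)
  then have "bistellar (set A) (set B) b = b" by (auto simp: bistellar_def)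
  with Cons show ?case by (simp add: m)
qed simp

text \<open>The vertices \<open>0, \<dots>, 10\<close> go to their prescribed places and \<open>11\<close> to the centre \<open>(-1/6, 1/6, 1/2)\<close>.  On \<open>K\<close>
  itself this map is not injective: \<open>[0,1,2,3]\<close> and three tetrahedra at the sides become flat.\<close>

definition prism_linear :: "(nat \<Rightarrow> real) \<Rightarrow> real \<times> real \<times> real" where
  "prism_linear b =
     (- 2/3 * b 1 - 1/3 * b 2 - 1/3 * b 3 + 1/3 * b 5 - 1/3 * b 6 - 1/2 * b 8 - 1/6 * b 9 + 1/6 * b 10 - 1/6 * b 11,
      1/3 * b 1 - 1/3 * b 2 + 1/3 * b 5 + 2/3 * b 6 + 1/3 * b 7 + 1/2 * b 8 - 1/6 * b 9 + 1/6 * b 10 + 1/6 * b 11,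
      1/3 * b 1 + 2/3 * b 2 + 1/3 * b 3 + b 4 + 1/3 * b 5 + 2/3 * b 6 + 2/3 * b 7 + 1/2 * b 8 + 5/6 * b 9
        + 1/6 * b 10 + 1/2 * b 11)"

lemma prism_linear_welds: "prism_linear (bistellar_path prism_welds b) = prism_linear b"
  by (simp add: prism_linear_def prism_welds_def bistellar_def) (simp add: field_simps)

lemma prism_welds_11: "bistellar_path prism_welds b 11 = b 11"
  by (simp add: prism_welds_def bistellar_def)

section \<open>The cone over eight triangles is the prism\<close>

definition base_point :: "real \<Rightarrow> real \<Rightarrow> real \<Rightarrow> real \<Rightarrow> real \<Rightarrow> real \<Rightarrow> real \<Rightarrow> nat \<Rightarrow> real" where
  "base_point t0 t1 t2 t4 t5 t6 t11 =
     (\<lambda>_. 0)(0 := t0, 1 := t1, 2 := t2, 4 := t4, 5 := t5, 6 := t6, 11 := t11)"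

abbreviation "prism_base \<equiv> realization (list_complex (map (\<lambda>T. T @ [11]) prism_base_list))"

text \<open>One disjunct for each of the eight triangles, naming the three vertices that it
  misses.\<close>

definition base_zeros :: "real \<Rightarrow> real \<Rightarrow> real \<Rightarrow> real \<Rightarrow> real \<Rightarrow> real \<Rightarrow> bool" where
  "base_zeros t0 t1 t2 t4 t5 t6 \<longleftrightarrow>
    t4 = 0 \<and> t5 = 0 \<and> t6 = 0 \<or> t0 = 0 \<and> t1 = 0 \<and> t2 = 0 \<or> t2 = 0 \<and> t4 = 0 \<and> t5 = 0 \<or>
    t1 = 0 \<and> t2 = 0 \<and> t4 = 0 \<or> t0 = 0 \<and> t5 = 0 \<and> t6 = 0 \<or> t0 = 0 \<and> t2 = 0 \<and> t5 = 0 \<or>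
    t1 = 0 \<and> t4 = 0 \<and> t6 = 0 \<or> t0 = 0 \<and> t1 = 0 \<and> t6 = 0"

lemma base_point_in:
  assumes "0 \<le> t0" "0 \<le> t1" "0 \<le> t2" "0 \<le> t4" "0 \<le> t5" "0 \<le> t6" "0 \<le> t11"
    and "t0 + t1 + t2 + t4 + t5 + t6 + t11 = 1"
    and "base_zeros t0 t1 t2 t4 t5 t6"
  shows "base_point t0 t1 t2 t4 t5 t6 t11 \<in> prism_base"
proof -
  let ?b = "base_point t0 t1 t2 t4 t5 t6 t11"
  have nn: "0 \<le> ?b v" for v using assms by (simp add: base_point_def)
  have "\<exists>T\<in>set prism_base_list. (\<forall>v. v \<notin> set (T @ [11]) \<longrightarrow> ?b v = 0) \<and> sum ?b (set (T @ [11])) = 1"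
    using assms(9) unfolding base_zeros_def
    by (elim disjE; use assms(8) in \<open>simp add: prism_base_list_def base_point_def\<close>)
  then obtain T where T: "T \<in> set prism_base_list" "\<And>v. v \<notin> set (T @ [11]) \<Longrightarrow> ?b v = 0"
    "sum ?b (set (T @ [11])) = 1" by blast
  show ?thesis
    by (rule realization_listI[OF _ nn T(2) T(3)]) (use T(1) in simp)
qed

lemma prism_linear_base_point:
  "prism_linear (base_point t0 t1 t2 t4 t5 t6 t11) =
     (- 2/3 * t1 - 1/3 * t2 + 1/3 * t5 - 1/3 * t6 - 1/6 * t11,
      1/3 * t1 - 1/3 * t2 + 1/3 * t5 + 2/3 * t6 + 1/6 * t11,
      1/3 * t1 + 2/3 * t2 + t4 + 1/3 * t5 + 2/3 * t6 + 1/2 * t11)"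
  by (simp add: prism_linear_def base_point_def)

lemma prism_base_cases:
  assumes "b \<in> prism_base"
  obtains t0 t1 t2 t4 t5 t6 t11 where "b = base_point t0 t1 t2 t4 t5 t6 t11"
    "0 \<le> t0" "0 \<le> t1" "0 \<le> t2" "0 \<le> t4" "0 \<le> t5" "0 \<le> t6" "0 \<le> t11"
    "t0 + t1 + t2 + t4 + t5 + t6 + t11 = 1" "base_zeros t0 t1 t2 t4 t5 t6"
proof -
  obtain T where T: "T \<in> set (map (\<lambda>T. T @ [11]) prism_base_list)" "\<And>v. 0 \<le> b v"
    "\<And>v. v \<notin> set T \<Longrightarrow> b v = 0" "sum b (set T) = 1"
    using realization_list_cases[OF assms] by blast
  have sub: "set T \<subseteq> {0,1,2,4,5,6,11}" using T(1) by (auto simp: prism_base_list_def)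
  have "sum b (set T) = sum b {0,1,2,4,5,6,11}"
    using sub T(3) by (intro sum.mono_neutral_left) auto
  then have sum: "b 0 + b 1 + b 2 + b 4 + b 5 + b 6 + b 11 = 1" using T(4) by simp
  have "b v = base_point (b 0) (b 1) (b 2) (b 4) (b 5) (b 6) (b 11) v" for v
  proof (cases "v \<in> {0,1,2,4,5,6,11}")
    case False
    with sub have "v \<notin> set T" by blast
    then show ?thesis using T(3)[of v] False by (simp add: base_point_def)
  qed (elim insertE; simp add: base_point_def)
  then have eq: "b = base_point (b 0) (b 1) (b 2) (b 4) (b 5) (b 6) (b 11)" by blast
  have "base_zeros (b 0) (b 1) (b 2) (b 4) (b 5) (b 6)"
    using T(1) T(3)[of 0] T(3)[of 1] T(3)[of 2] T(3)[of 4] T(3)[of 5] T(3)[of 6]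
    unfolding prism_base_list_def base_zeros_def by (simp, elim disjE; simp)
  with eq sum T(2) show ?thesis using that by blast
qed

text \<open>The five affine functions vanish on the five faces of the prism and are scaled to the
  value 1 at its centre. Their minimum is therefore the cone coordinate, that is, the weight of the
  apex 11.\<close>

definition prism_depth :: "real \<Rightarrow> real \<Rightarrow> real \<Rightarrow> real" where
  "prism_depth x y z = Min {3 * (y - x), 3 * (z - y), 3 * (x + 1 - z), 2 * (x + y + z), 2 - 2 * (x + y + z)}"

lemma prism_depth_le:
  "prism_depth x y z \<le> 3 * (y - x)" "prism_depth x y z \<le> 3 * (z - y)" "prism_depth x y z \<le> 3 * (x + 1 - z)"
  "prism_depth x y z \<le> 2 * (x + y + z)" "prism_depth x y z \<le> 2 - 2 * (x + y + z)"
  unfolding prism_depth_def by (rule Min_le; simp)+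

lemma prism_depth_cases:
  "prism_depth x y z = 3 * (y - x) \<or> prism_depth x y z = 3 * (z - y) \<or> prism_depth x y z = 3 * (x + 1 - z) \<or>
   prism_depth x y z = 2 * (x + y + z) \<or> prism_depth x y z = 2 - 2 * (x + y + z)"
proof -
  have "prism_depth x y z \<in> {3 * (y - x), 3 * (z - y), 3 * (x + 1 - z), 2 * (x + y + z), 2 - 2 * (x + y + z)}"
    unfolding prism_depth_def by (rule Min_in) simp_all
  then show ?thesis by simp
qed

text \<open>Each face function equals \<open>t11\<close> plus a nonnegative combination of the
  weights of the vertices off that face, and this remainder is 0 for the face that contains the
  triangle of \<open>b\<close>.\<close>

lemma prism_base_apex:
  assumes "b \<in> prism_base" "prism_linear b = (x, y, z)"
  shows "b 11 = prism_depth x y z"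
proof -
  obtain t0 t1 t2 t4 t5 t6 t11 where b: "b = base_point t0 t1 t2 t4 t5 t6 t11"
    and nn: "0 \<le> t0" "0 \<le> t1" "0 \<le> t2" "0 \<le> t4" "0 \<le> t5" "0 \<le> t6" "0 \<le> t11"
    and sum: "t0 + t1 + t2 + t4 + t5 + t6 + t11 = 1" and z: "base_zeros t0 t1 t2 t4 t5 t6"
    using prism_base_cases[OF assms(1)] by blast
  have eqs: "y - x = t1 + t6 + t11/3" "z - y = t2 + t4 + t11/3" "x + 1 - z = t0 + t5 + t11/3"
    "x + y + z = t4 + t5 + t6 + t11/2"
    using assms(2) sum unfolding b prism_linear_base_point by auto
  have "Min {3 * (t1 + t6 + t11/3), 3 * (t2 + t4 + t11/3), 3 * (t0 + t5 + t11/3),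
      2 * (t4 + t5 + t6 + t11/2), 2 - 2 * (t4 + t5 + t6 + t11/2)} = t11"
  proof (rule Min_eqI)
    show "t11 \<in> {3 * (t1 + t6 + t11/3), 3 * (t2 + t4 + t11/3), 3 * (t0 + t5 + t11/3),
      2 * (t4 + t5 + t6 + t11/2), 2 - 2 * (t4 + t5 + t6 + t11/2)}"
      using z sum unfolding base_zeros_def by (elim disjE; simp)
    show "t11 \<le> y" if "y \<in> {3 * (t1 + t6 + t11/3), 3 * (t2 + t4 + t11/3), 3 * (t0 + t5 + t11/3),
      2 * (t4 + t5 + t6 + t11/2), 2 - 2 * (t4 + t5 + t6 + t11/2)}" for y
      using that by (elim insertE emptyE; use nn sum in simp)
  qed simp
  then show ?thesis unfolding eqs prism_depth_def b by (simp add: base_point_def)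
qed

text \<open>The depth recovers the weight of the apex. The three gaps and the height then leave two
  parameters open, which the vanishing patterns of the triangles fix.\<close>

lemma inj_on_prism_linear: "inj_on prism_linear prism_base"
proof
  fix b c assume b: "b \<in> prism_base" and c: "c \<in> prism_base" and eq: "prism_linear b = prism_linear c"
  obtain x y z where xyz: "prism_linear b = (x, y, z)" by (cases "prism_linear b") auto
  have 11: "b 11 = c 11" using prism_base_apex[OF b xyz] prism_base_apex[OF c] xyz eq by simp
  from b obtain t0 t1 t2 t4 t5 t6 t11 where b': "b = base_point t0 t1 t2 t4 t5 t6 t11"
    and nn: "0 \<le> t0" "0 \<le> t1" "0 \<le> t2" "0 \<le> t4" "0 \<le> t5" "0 \<le> t6"
    and sum: "t0 + t1 + t2 + t4 + t5 + t6 + t11 = 1" and z: "base_zeros t0 t1 t2 t4 t5 t6"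
    by (rule prism_base_cases) blast
  from c obtain u0 u1 u2 u4 u5 u6 u11 where c': "c = base_point u0 u1 u2 u4 u5 u6 u11"
    and nn': "0 \<le> u0" "0 \<le> u1" "0 \<le> u2" "0 \<le> u4" "0 \<le> u5" "0 \<le> u6"
    and sum': "u0 + u1 + u2 + u4 + u5 + u6 + u11 = 1" and z': "base_zeros u0 u1 u2 u4 u5 u6"
    by (rule prism_base_cases) blast
  have "t11 = u11" using 11 by (simp add: b' c' base_point_def)
  then have e: "t1 + t6 = u1 + u6" "t2 + t4 = u2 + u4" "t0 + t5 = u0 + u5" "t4 + t5 + t6 = u4 + u5 + u6"
    using eq sum sum' unfolding b' c' prism_linear_base_point by auto
  have "t0 = u0" "t1 = u1"
    using z z' unfolding base_zeros_def
    by (elim disjE conjE; insert e nn nn'; linarith)+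
  with e have "t5 = u5" "t6 = u6" "t4 = u4" "t2 = u2" by linarith+
  with \<open>t0 = u0\<close> \<open>t1 = u1\<close> \<open>t11 = u11\<close> show "b = c" by (simp add: b' c')
qed

lemma prism_linear_base_in: "b \<in> prism_base \<Longrightarrow> prism_linear b \<in> prism"
  by (erule prism_base_cases) (simp add: prism_linear_base_point prism_def)

lemma prism_linear_base_onto:
  assumes "u \<in> prism" shows "u \<in> prism_linear ` prism_base"
proof -
  obtain x y z where u: "u = (x, y, z)" by (cases u) auto
  have P: "x \<le> y" "y \<le> z" "z \<le> x + 1" "0 \<le> x + y + z" "x + y + z \<le> 1" using assms by (auto simp: u prism_def)
  define m where "m = prism_depth x y z"
  have m: "m \<le> 3 * (y - x)" "m \<le> 3 * (z - y)" "m \<le> 3 * (x + 1 - z)"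
    "m \<le> 2 * (x + y + z)" "m \<le> 2 - 2 * (x + y + z)" unfolding m_def by (rule prism_depth_le)+
  have mc: "m = 3 * (y - x) \<or> m = 3 * (z - y) \<or> m = 3 * (x + 1 - z) \<or> m = 2 * (x + y + z) \<or> m = 2 - 2 * (x + y + z)"
    unfolding m_def by (rule prism_depth_cases)
  have "0 \<le> m" using mc P by (elim disjE) simp_all
  note m = \<open>0 \<le> m\<close> m
  \<comment> \<open>Taking away the share \<open>m\<close> of the apex leaves a point of the base of
    the cone: \<open>a\<close>, \<open>b\<close>, \<open>c\<close> are the joint weights of the
    vertical edges \<open>[1,6]\<close>, \<open>[2,4]\<close>, \<open>[0,5]\<close>, and
    \<open>\<sigma>\<close>, \<open>\<rho>\<close> those of the top and the bottom vertices.\<close>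
  define a b c \<sigma> \<rho> where d: "a = y - x - m/3" "b = z - y - m/3" "c = x + 1 - z - m/3"
    "\<sigma> = x + y + z - m/2" "\<rho> = 1 - (x + y + z) - m/2"
  have nn: "0 \<le> a" "0 \<le> b" "0 \<le> c" "0 \<le> \<sigma>" "0 \<le> \<rho>" using m by (auto simp: d)
  have s: "a + b + c + m = 1" "\<sigma> + \<rho> + m = 1" by (auto simp: d)
  have cs: "a = 0 \<or> b = 0 \<or> c = 0 \<or> \<sigma> = 0 \<or> \<rho> = 0" using mc by (auto simp: d)
  have u': "u = prism_linear (base_point t0 t1 t2 t4 t5 t6 m)"
    if "t1 + t6 = a" "t2 + t4 = b" "t0 + t5 = c" "t4 + t5 + t6 = \<sigma>" for t0 t1 t2 t4 t5 t6
    using that unfolding prism_linear_base_point u d by auto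
  \<comment> \<open>Below, \<open>fin\<close> is instantiated in the order of first occurrence,
    \<open>t1 t6 t2 t4 t0 t5\<close>. If \<open>a\<close>, \<open>b\<close> or \<open>c\<close> is
    0, the point lies on a quadrilateral, and comparing with \<open>\<sigma>\<close> tells on which
    side of the diagonal.\<close>
  have fin: ?thesis
    if "t1 + t6 = a" "t2 + t4 = b" "t0 + t5 = c" "t4 + t5 + t6 = \<sigma>" "base_zeros t0 t1 t2 t4 t5 t6"
      "0 \<le> t0" "0 \<le> t1" "0 \<le> t2" "0 \<le> t4" "0 \<le> t5" "0 \<le> t6" for t0 t1 t2 t4 t5 t6
    using u'[OF that(1-4)] base_point_in[of t0 t1 t2 t4 t5 t6 m] that s m by (intro image_eqI) auto
  from cs show ?thesis
  proof (elim disjE)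
    assume "a = 0"
    then show ?thesis
      using fin[of 0 0 b 0 "c - \<sigma>" \<sigma>]
        fin[of 0 0 \<rho> "\<sigma> - c" 0 c]
        nn s by (cases "\<sigma> \<le> c") (auto simp: base_zeros_def)
  next
    assume "b = 0"
    then show ?thesis
      using fin[of "a - \<sigma>" \<sigma> 0 0 c 0]
        fin[of 0 a 0 0 \<rho> "\<sigma> - a"]
        nn s by (cases "\<sigma> \<le> a") (auto simp: base_zeros_def)
  next
    assume "c = 0"
    then show ?thesis
      using fin[of a 0 "b - \<sigma>" \<sigma> 0 0]
        fin[of \<rho> "\<sigma> - b" 0 b 0 0]
        nn s by (cases "\<sigma> \<le> b") (auto simp: base_zeros_def)
  next
    assume "\<sigma> = 0"
    then show ?thesis
      using fin[of a 0 b 0 c 0]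
        nn s by (auto simp: base_zeros_def)
  next
    assume "\<rho> = 0"
    then show ?thesis
      using fin[of 0 a 0 b 0 c]
        nn s by (auto simp: base_zeros_def)
  qed
qed

lemma bij_betw_prism_linear: "bij_betw prism_linear prism_base prism"
  unfolding bij_betw_def
  using inj_on_prism_linear prism_linear_base_in prism_linear_base_onto by blast

section \<open>The homeomorphism from the realization of \<open>K\<close> to the prism\<close>

definition prism_homeo :: "(nat \<Rightarrow> real) \<Rightarrow> real \<times> real \<times> real" where
  "prism_homeo b = prism_linear (bistellar_path prism_flips b)"

abbreviation "prism_boundary \<equiv> realization (list_complex prism_boundary_list)"
abbreviation "prism_cone \<equiv> realization (list_complex (map (\<lambda>T. T @ [11]) prism_boundary_list))"

lemma prism_complex_eq: "prism_complex = list_complex prism_facet_list"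
  by (simp add: prism_complex_def set_prism_facet_list)

lemma bij_betw_prism_flips: "bij_betw (bistellar_path prism_flips) (realization prism_complex) prism_cone"
  using bij_betw_bistellar_path[OF prism_flips_ok] realization_list_equiv[OF prism_flips_result]
  by (simp only: prism_complex_eq)

lemma bij_betw_prism_welds: "bij_betw (bistellar_path prism_welds) prism_cone prism_base"
  using bij_betw_bistellar_path[OF prism_welds_ok] realization_list_equiv[OF prism_welds_result] by simp

lemma bij_betw_prism_homeo: "bij_betw prism_homeo (realization prism_complex) prism"
proof -
  have "bij_betw (prism_linear \<circ> (bistellar_path prism_welds \<circ> bistellar_path prism_flips))
     (realization prism_complex) prism"
    by (rule bij_betw_trans[OF bij_betw_trans[OF bij_betw_prism_flips bij_betw_prism_welds] bij_betw_prism_linear])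
  then show ?thesis by (simp add: comp_def prism_linear_welds prism_homeo_def[abs_def])
qed

lemma continuous_on_prism_homeo: "continuous_on S prism_homeo"
proof -
  have "continuous_on UNIV prism_linear"
    unfolding prism_linear_def
    by (intro continuous_intros continuous_on_product_coordinates)
  moreover have "prism_homeo = prism_linear \<circ> bistellar_path prism_flips"
    by (auto simp: prism_homeo_def)
  ultimately show ?thesis
    using continuous_on_bistellar_path[OF prism_flips_ok] continuous_on_compose continuous_on_subset
    by (metis subset_UNIV)
qed

lemma prism_boundary_subset: "prism_boundary \<subseteq> realization prism_complex"
  unfolding prism_complex_eq by (rule realization_mono_list) code_simp

lemma prism_flips_inner:
  "list_all (\<lambda>(A, B). list_all (\<lambda>T. \<not> list_subset A T) prism_boundary_list) prism_flips"
  by code_simp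

lemma prism_flips_boundary: "b \<in> prism_boundary \<Longrightarrow> bistellar_path prism_flips b = b"
  using bistellar_path_fixed[OF prism_flips_inner] .

lemma prism_homeo_boundary: "b \<in> prism_boundary \<Longrightarrow> prism_homeo b = prism_linear b"
  by (simp add: prism_homeo_def prism_flips_boundary)

text \<open>The weight of the apex survives the welds and equals the depth, so it only has to be
  nonzero. If it were 0, the flips would carry \<open>b\<close> to a boundary point; that point is
  fixed by the flips as well, and injectivity would make it \<open>b\<close> itself.\<close>

lemma prism_homeo_interior:
  assumes b: "b \<in> realization prism_complex" "b \<notin> prism_boundary" and "prism_homeo b = (x, y, z)"
  shows "x < y \<and> y < z \<and> z < x + 1 \<and> 0 < x + y + z \<and> x + y + z < 1"
proof -
  define c where "c = bistellar_path prism_flips b"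
  have c: "c \<in> prism_cone" using bij_betw_prism_flips b(1) by (auto simp: c_def bij_betw_def)
  have "c 11 \<noteq> 0"
  proof
    assume 0: "c 11 = 0"
    obtain U where U: "U \<in> set (map (\<lambda>T. T @ [11]) prism_boundary_list)" "\<And>v. 0 \<le> c v"
      "\<And>v. v \<notin> set U \<Longrightarrow> c v = 0" "sum c (set U) = 1"
      using realization_list_cases[OF c] by blast
    then obtain T where "T \<in> set prism_boundary_list" "U = T @ [11]" by auto
    with U have T: "T \<in> set prism_boundary_list" "\<And>v. 0 \<le> c v" "\<And>v. v \<notin> set (T @ [11]) \<Longrightarrow> c v = 0"
      "sum c (set (T @ [11])) = 1" by blast+
    have "sum c (set (T @ [11])) = sum c (set T)"
      using 0 by (intro sum.mono_neutral_right) auto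
    moreover have "c v = 0" if "v \<notin> set T" for v using T(3)[of v] 0 that by (cases "v = 11") auto
    ultimately have "c \<in> prism_boundary" using T by (intro realization_listI[OF T(1)]) auto
    then have "bistellar_path prism_flips c = bistellar_path prism_flips b" "c \<in> realization prism_complex"
      using prism_flips_boundary prism_boundary_subset by (auto simp: c_def)
    then have "c = b" using b(1) bij_betw_prism_flips by (auto simp: bij_betw_def inj_on_def)
    with \<open>c \<in> prism_boundary\<close> b(2) show False by simp
  qed
  moreover define t where "t = bistellar_path prism_welds c"
  have t: "t \<in> prism_base" using bij_betw_prism_welds c by (auto simp: t_def bij_betw_def)
  have "0 \<le> t 11" using t realization_list_cases by blast
  moreover have "t 11 = c 11" by (simp add: t_def prism_welds_11)
  ultimately have "0 < t 11" by simp
  moreover have "prism_linear t = (x, y, z)"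
    using assms(3) by (simp add: t_def prism_linear_welds c_def prism_homeo_def)
  ultimately show ?thesis using prism_base_apex[OF t] prism_depth_le[of x y z] by simp
qed

text \<open>Every removed face in \<open>prism_flips\<close> has at least two vertices, so the flips
  fix each vertex, including the apex 11 off the boundary.\<close>

lemma prism_homeo_vertex:
  assumes "i \<le> 11" shows "prism_homeo (vertex_point i) = prism_linear (vertex_point i)"
proof -
  have "list_all (\<lambda>(A, B). list_all (\<lambda>T. \<not> list_subset A T) [[i]]) prism_flips"
    by (auto simp: prism_flips_def list_subset_def)
  moreover have "vertex_point i \<in> realization (generated_complex (set ` set [[i]]))"
    by (rule realization_listI[of "[i]"]) (auto simp: vertex_point_def)
  ultimately show ?thesis by (simp only: prism_homeo_def bistellar_path_fixed)
qed

section \<open>Sets of at most three points on the circle\<close>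

lemma cis_2pi_eq_iff: "cis (2 * pi * a) = cis (2 * pi * b) \<longleftrightarrow> (\<exists>n::int. a = b + of_int n)"
proof -
  have "cis (2 * pi * a) = cis (2 * pi * b) \<longleftrightarrow>
      (\<exists>n::int. \<i> * complex_of_real (2 * pi * a) = \<i> * complex_of_real (2 * pi * b) + complex_of_real (of_int (2 * n) * pi) * \<i>)"
    unfolding cis_conv_exp exp_eq by simp
  also have "\<dots> \<longleftrightarrow> (\<exists>n::int. a = b + of_int n)"
  proof (rule ex_cong1)
    fix n :: int
    have "\<i> * complex_of_real (2 * pi * a) = \<i> * complex_of_real (2 * pi * b) + complex_of_real (of_int (2 * n) * pi) * \<i>
      \<longleftrightarrow> \<i> * complex_of_real (2 * pi * a) = \<i> * complex_of_real (2 * pi * b + of_int (2 * n) * pi)"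
      by (simp add: algebra_simps)
    also have "\<dots> \<longleftrightarrow> 2 * pi * a = 2 * pi * b + of_int (2 * n) * pi"
      by (simp only: mult_cancel_left of_real_eq_iff) simp
    also have "\<dots> \<longleftrightarrow> (2 * pi) * a = (2 * pi) * (b + of_int n)"
      by (simp add: algebra_simps)
    finally show "\<i> * complex_of_real (2 * pi * a) = \<i> * complex_of_real (2 * pi * b) + complex_of_real (of_int (2 * n) * pi) * \<i>
      \<longleftrightarrow> a = b + of_int n" by simp
  qed
  finally show ?thesis .
qed

lemma cis_2pi_add_int [simp]:
  "cis (2 * pi * (a + of_int n)) = cis (2 * pi * a)" "cis (2 * pi * (a - of_int n)) = cis (2 * pi * a)"
  unfolding cis_2pi_eq_iff by (auto intro: exI[of _ n] exI[of _ "- n"])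

lemma cis_2pi_add_1 [simp]:
  "cis (2 * pi * (a + 1)) = cis (2 * pi * a)" "cis (2 * pi * (a - 1)) = cis (2 * pi * a)"
  using cis_2pi_add_int[of a 1] by simp_all

lemma cis_2pi_eq_unit_interval:
  assumes "cis (2 * pi * a) = cis (2 * pi * b)" "c \<le> a" "a \<le> c + 1" "c \<le> b" "b \<le> c + 1"
  shows "a = b \<or> a = c \<and> b = c + 1 \<or> a = c + 1 \<and> b = c"
proof -
  obtain n :: int where n: "a = b + of_int n" using assms(1) unfolding cis_2pi_eq_iff by blast
  then have "real_of_int n \<le> 1" "- 1 \<le> real_of_int n" using assms by linarith+
  then have "n = -1 \<or> n = 0 \<or> n = 1" by linarith
  then show ?thesis using n assms by auto
qed

text \<open>The prism prolonged in both directions along its axis. Such a triple lifts three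
  cyclically ordered points of the circle to the line. The screw motion from
  \<open>(x, y, z)\<close> to \<open>(y, z, x + 1)\<close> leads to the next lift of the same points
  and raises the coordinate sum by 1, so the prism is one period of it.\<close>

definition cyclic_triples :: "(real \<times> real \<times> real) set" where
  "cyclic_triples = {(x, y, z). x \<le> y \<and> y \<le> z \<and> z \<le> x + 1}"

lemma prism_subset_cyclic_triples: "prism \<subseteq> cyclic_triples"
  by (auto simp: prism_def cyclic_triples_def)

text \<open>The analogue for two points, with the glide from \<open>(p, q)\<close> to
  \<open>(q, p + 1)\<close>, whose square is the translation by 1. The claim \<open>same\<close>
  treats coinciding first points; one glide reduces the other case to it.\<close>

lemma cis_pair_eq_iff:
  assumes "p \<le> q" "q \<le> p + 1" "p' \<le> q'" "q' \<le> p' + 1"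
  shows "{cis (2 * pi * p), cis (2 * pi * q)} = {cis (2 * pi * p'), cis (2 * pi * q')} \<longleftrightarrow>
    (\<exists>n::int. p' = p + of_int n \<and> q' = q + of_int n \<or> p' = q + of_int n \<and> q' = p + 1 + of_int n)"
    (is "?L \<longleftrightarrow> ?R")
proof
  have same: "q' = q + of_int n \<or> (\<exists>m::int. p' = q + of_int m \<and> q' = p + 1 + of_int m)"
    if eq: "{cis (2 * pi * p), cis (2 * pi * q)} = {cis (2 * pi * p'), cis (2 * pi * q')}" and
      n: "p' = p + of_int n" and pq: "p \<le> q" "q \<le> p + 1" "p' \<le> q'" "q' \<le> p' + 1" for p q p' q' n
  proof -
    have p': "cis (2 * pi * p') = cis (2 * pi * p)" by (simp add: n)
    have q': "cis (2 * pi * (q' - of_int n)) = cis (2 * pi * q')" by simp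
    have "cis (2 * pi * q') \<in> {cis (2 * pi * p), cis (2 * pi * q)}"
      "cis (2 * pi * q) \<in> {cis (2 * pi * p), cis (2 * pi * q')}"
      using eq p' by (metis insertI1 insertI2 singletonI)+
    then have "cis (2 * pi * (q' - of_int n)) = cis (2 * pi * q) \<or>
       cis (2 * pi * (q' - of_int n)) = cis (2 * pi * p) \<and> cis (2 * pi * q) = cis (2 * pi * p)"
      unfolding q' by auto
    then have "q' - of_int n = q \<or> (q' - of_int n = p + 1 \<or> q' - of_int n = p) \<and> (q = p \<or> q = p + 1)"
      using cis_2pi_eq_unit_interval[of "q' - of_int n" q p] cis_2pi_eq_unit_interval[of "q' - of_int n" p p]
        cis_2pi_eq_unit_interval[of q p p] pq n by auto
    then consider "q' = q + of_int n" | "q' = p + 1 + of_int n" "q = p" | "q' = p + of_int n" "q = p + 1"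
      using pq by auto
    then show ?thesis
    proof cases
      case 2 then show ?thesis using n by auto
    next
      case 3 then show ?thesis using n by (intro disjI2 exI[of _ "n - 1"]) auto
    qed auto
  qed
  show ?R if ?L
  proof -
    have "cis (2 * pi * p') = cis (2 * pi * p) \<or> cis (2 * pi * p') = cis (2 * pi * q)"
      using that by (metis insertE insertI1 singletonD)
    then consider n where "p' = p + of_int n" | n where "p' = q + of_int n"
      unfolding cis_2pi_eq_iff by blast
    then show ?thesis
    proof cases
      case 1 then show ?thesis using same[OF that 1 assms] by blast
    next
      case (2 n)
      have "{cis (2 * pi * q), cis (2 * pi * (p + 1))} = {cis (2 * pi * p'), cis (2 * pi * q')}"
        using that by auto
      from same[OF this 2] assms
      consider "q' = p + 1 + of_int n" | m :: int where "p' = p + 1 + of_int m" "q' = q + 1 + of_int m" by auto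
      then show ?thesis
      proof cases
        case 1 then show ?thesis using 2 by blast
      next
        case (2 m) then show ?thesis by (intro exI[of _ "m + 1"]) auto
      qed
    qed
  qed
  show ?L if ?R using that
  proof (elim exE disjE conjE)
    fix n :: int assume "p' = q + of_int n" "q' = p + 1 + of_int n"
    moreover have "cis (2 * pi * (p + 1 + of_int n)) = cis (2 * pi * p)" by (simp del: distrib_left)
    ultimately show ?L by auto
  qed auto
qed

lemma prism_map_shift:
  "prism_map (x + of_int n, y + of_int n, z + of_int n) = prism_map (x, y, z)"
  "prism_map (y, z, x + 1) = prism_map (x, y, z)"
  "prism_map (z - 1, x, y) = prism_map (x, y, z)"
  by auto

text \<open>Three distinct points have only one cyclic lift that begins at a given number. Since
  \<open>x'\<close> lies over one of them, the auxiliary claim, applied to the triple rotated to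
  begin there, determines \<open>y'\<close> and \<open>z'\<close>.\<close>

lemma prism_map_eq_strict:
  assumes "x < y" "y < z" "z < x + 1" "(x', y', z') \<in> cyclic_triples"
    and "prism_map (x, y, z) = prism_map (x', y', z')"
  obtains n :: int where "(x', y', z') = (x + of_int n, y + of_int n, z + of_int n) \<or>
    (x', y', z') = (y + of_int n, z + of_int n, x + 1 + of_int n) \<or>
    (x', y', z') = (z + of_int n, x + 1 + of_int n, y + 1 + of_int n)"
proof -
  have *: "y' = y + of_int n \<and> z' = z + of_int n"
    if "x < y" "y < z" "z < x + 1" "x' = x + of_int n" "prism_map (x, y, z) = prism_map (x', y', z')" for x y z n
  proof -
    have "cis (2 * pi * y) \<in> prism_map (x', y', z')" "cis (2 * pi * z) \<in> prism_map (x', y', z')"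
      unfolding that(5)[symmetric] by auto
    moreover have "prism_map (x', y', z') = prism_map (x, y' - of_int n, z' - of_int n)"
      by (simp add: that(4))
    moreover have "cis (2 * pi * y) \<noteq> cis (2 * pi * x)" "cis (2 * pi * z) \<noteq> cis (2 * pi * x)"
      using cis_2pi_eq_unit_interval[of y x x] cis_2pi_eq_unit_interval[of z x x] that by auto
    ultimately have "cis (2 * pi * y) = cis (2 * pi * (y' - of_int n)) \<or> cis (2 * pi * y) = cis (2 * pi * (z' - of_int n))"
      "cis (2 * pi * z) = cis (2 * pi * (y' - of_int n)) \<or> cis (2 * pi * z) = cis (2 * pi * (z' - of_int n))"
      by auto
    moreover have b: "x \<le> y' - of_int n" "y' - of_int n \<le> z' - of_int n" "z' - of_int n \<le> x + 1"
      using assms(4) that(4) by (auto simp: cyclic_triples_def)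
    moreover have "a = b" if "cis (2 * pi * a) = cis (2 * pi * b)" "x < a" "a < x + 1" "x \<le> b" "b \<le> x + 1" for a b
      using cis_2pi_eq_unit_interval[of a b x] that by auto
    ultimately have "(y = y' - of_int n \<or> y = z' - of_int n) \<and> (z = y' - of_int n \<or> z = z' - of_int n)"
      using that(1-3) by (smt (verit, best))
    then show ?thesis using that b by auto
  qed
  have "cis (2 * pi * x') \<in> prism_map (x, y, z)" unfolding assms(5) by auto
  then have "\<exists>n::int. x' = x + of_int n \<or> x' = y + of_int n \<or> x' = z + of_int n"
    by (auto simp: cis_2pi_eq_iff)
  then consider n :: int where "x' = x + of_int n" | n :: int where "x' = y + of_int n" | n :: int where "x' = z + of_int n"
    by blast
  then show thesis
  proof cases
    case 1
    then show ?thesis using *[OF assms(1-3) 1 assms(5)] that by blast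
  next
    case 2
    then have "y' = z + of_int n \<and> z' = x + 1 + of_int n"
      using assms(1-3) prism_map_shift(2)[of y z x] assms(5) by (intro *[OF _ _ _ 2]) simp_all
    with 2 show ?thesis using that by blast
  next
    case 3
    have "prism_map (z, x + 1, y + 1) = prism_map (x, y, z)"
      by auto
    then have "y' = x + 1 + of_int n \<and> z' = y + 1 + of_int n"
      using assms(1-3) assms(5) by (intro *[OF _ _ _ 3]) simp_all
    with 3 show ?thesis using that by blast
  qed
qed

lemma prism_map_eq_degenerate:
  assumes "(x, y, z) \<in> cyclic_triples" "(x', y', z') \<in> cyclic_triples"
    and "prism_map (x, y, z) = prism_map (x', y', z')" and "x = y \<or> y = z \<or> z = x + 1"
  shows "x' = y' \<or> y' = z' \<or> z' = x' + 1"
proof (rule ccontr)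
  assume "\<not> ?thesis"
  then have lt: "x' < y'" "y' < z'" "z' < x' + 1" using assms(2) by (auto simp: cyclic_triples_def)
  obtain n :: int where "(x, y, z) = (x' + of_int n, y' + of_int n, z' + of_int n) \<or>
    (x, y, z) = (y' + of_int n, z' + of_int n, x' + 1 + of_int n) \<or>
    (x, y, z) = (z' + of_int n, x' + 1 + of_int n, y' + 1 + of_int n)"
    using prism_map_eq_strict[OF lt assms(1) assms(3)[symmetric]] by blast
  then show False using lt assms(4) by (elim disjE Pair_inject; linarith)
qed

text \<open>Undoing the screw motion \<open>k\<close> times brings the coordinate sum between 0 and
  1. Three screw motions make a translation, hence the division of \<open>k\<close> by 3.\<close>

lemma cyclic_triple_in_prism:
  assumes "u \<in> cyclic_triples"
  obtains v where "v \<in> prism" "prism_map v = prism_map u"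
proof -
  obtain x y z where u: "u = (x, y, z)" by (cases u) auto
  define k where "k = \<lfloor>x + y + z\<rfloor>"
  define n where "n = k div 3"
  have k: "of_int k \<le> x + y + z" "x + y + z \<le> of_int k + 1" unfolding k_def by linarith+
  have o: "x \<le> y" "y \<le> z" "z \<le> x + 1" using assms by (auto simp: u cyclic_triples_def)
  have "k mod 3 = 0 \<or> k mod 3 = 1 \<or> k mod 3 = 2" by auto
  moreover have "k = 3 * n + k mod 3" by (simp add: n_def)
  ultimately consider "k = 3 * n" | "k = 3 * n + 1" | "k = 3 * n + 2" by linarith
  then show ?thesis
  proof cases
    case 1
    then show ?thesis
      using that[of "(x - of_int n, y - of_int n, z - of_int n)"] k o by (auto simp: prism_def u)
  next
    case 2
    have "prism_map (z - 1 - of_int n, x - of_int n, y - of_int n) = prism_map u"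
      by (auto simp: u simp del: distrib_left right_diff_distrib)
    with 2 show ?thesis
      using that[of "(z - 1 - of_int n, x - of_int n, y - of_int n)"] k o by (auto simp: prism_def)
  next
    case 3
    have "prism_map (y - 1 - of_int n, z - 1 - of_int n, x - of_int n) = prism_map u"
      by (auto simp: u simp del: distrib_left right_diff_distrib)
    with 3 show ?thesis
      using that[of "(y - 1 - of_int n, z - 1 - of_int n, x - of_int n)"] k o by (auto simp: prism_def)
  qed
qed

lemma prism_map_onto: "\<exists>u\<in>prism. prism_map u = {cis (2 * pi * a), cis (2 * pi * b), cis (2 * pi * c)}"
proof -
  have fr: "cis (2 * pi * frac t) = cis (2 * pi * t)" for t
    by (simp add: frac_def)
  have srt: "\<exists>u\<in>cyclic_triples. prism_map u = {cis (2 * pi * a), cis (2 * pi * b), cis (2 * pi * c)}"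
    if "0 \<le> a" "a \<le> b" "b \<le> c" "c \<le> 1" for a b c
    using that by (intro bexI[of _ "(a, b, c)"]) (auto simp: cyclic_triples_def)
  have "\<exists>u\<in>cyclic_triples. prism_map u = {cis (2 * pi * frac a), cis (2 * pi * frac b), cis (2 * pi * frac c)}"
  proof -
    have fr01: "0 \<le> frac t" "frac t \<le> 1" for t :: real using frac_lt_1[of t] by (auto simp: less_imp_le)
    have perm: "{c, a, b} = {a, b, c}" "{b, a, c} = {a, b, c}" "{a, c, b} = {a, b, c}" "{b, c, a} = {a, b, c}"
      "{c, b, a} = {a, b, c}" for a b c :: complex by blast+
    consider "frac a \<le> frac b" "frac b \<le> frac c" | "frac a \<le> frac c" "frac c \<le> frac b"
      | "frac b \<le> frac a" "frac a \<le> frac c" | "frac b \<le> frac c" "frac c \<le> frac a"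
      | "frac c \<le> frac a" "frac a \<le> frac b" | "frac c \<le> frac b" "frac b \<le> frac a"
      by linarith
    then show ?thesis
    proof cases
      case 1 show ?thesis using srt[OF fr01(1) 1 fr01(2)] by (simp only: perm)
    next
      case 2 show ?thesis using srt[OF fr01(1) 2 fr01(2)] by (simp only: perm)
    next
      case 3 show ?thesis using srt[OF fr01(1) 3 fr01(2)] by (simp only: perm)
    next
      case 4 show ?thesis using srt[OF fr01(1) 4 fr01(2)] by (simp only: perm)
    next
      case 5 show ?thesis using srt[OF fr01(1) 5 fr01(2)] by (simp only: perm)
    next
      case 6 show ?thesis using srt[OF fr01(1) 6 fr01(2)] by (simp only: perm)
    qed
  qed
  then show ?thesis unfolding fr using cyclic_triple_in_prism by metis
qed

lemma compact_prism: "compact prism"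
proof -
  have "prism = {u. fst u \<le> fst (snd u)} \<inter> {u. fst (snd u) \<le> snd (snd u)} \<inter> {u. snd (snd u) \<le> fst u + 1} \<inter>
      {u. 0 \<le> fst u + fst (snd u) + snd (snd u)} \<inter> {u. fst u + fst (snd u) + snd (snd u) \<le> 1}"
    by (auto simp: prism_def)
  moreover have "closed \<dots>"
    by (intro closed_Int closed_Collect_le continuous_intros)
  moreover have "prism \<subseteq> {-1..1} \<times> {-1..1} \<times> {-1..1}"
    by (auto simp: prism_def)
  ultimately show ?thesis
    by (metis bounded_Times bounded_closed_interval bounded_subset compact_eq_bounded_closed)
qed

section \<open>Maps out of the quotient and the symmetric potency\<close>

lemma prism_class_eq_iff:
  assumes "u \<in> prism" "v \<in> prism"
  shows "prism_class u = prism_class v \<longleftrightarrow> prism_map u = prism_map v"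
  using assms by (auto simp: prism_class_def prism_rel_def)

text \<open>The common source of the homeomorphisms to the symmetric potency, to the Barnette sphere
  and to the 3-sphere: the quotient is compact and the target Hausdorff, so the fibres of
  \<open>f\<close> are all that has to be known.\<close>

lemma prism_quotient_homeomorphism:
  assumes f: "continuous_map (top_of_set prism) Y f" "f ` prism = topspace Y" and Y: "Hausdorff_space Y"
    and ker: "\<And>u v. u \<in> prism \<Longrightarrow> v \<in> prism \<Longrightarrow> f u = f v \<longleftrightarrow> prism_map u = prism_map v"
  obtains \<phi> where "homeomorphic_map prism_quotient Y \<phi>" "\<And>u. u \<in> prism \<Longrightarrow> \<phi> (prism_class u) = f u"
proof -
  have q: "quotient_map (top_of_set prism) prism_quotient prism_class"
    unfolding prism_quotient_def by (rule quotient_map_quotient_topology)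
  obtain \<phi> where \<phi>: "continuous_map prism_quotient Y \<phi>" "\<phi> ` topspace prism_quotient = f ` topspace (top_of_set prism)"
    "\<And>u. u \<in> topspace (top_of_set prism) \<Longrightarrow> \<phi> (prism_class u) = f u"
    using quotient_map_lift_exists[OF q f(1)] ker prism_class_eq_iff by auto
  have top: "topspace prism_quotient = prism_class ` prism"
    by (simp add: prism_quotient_def)
  have "inj_on \<phi> (topspace prism_quotient)"
    unfolding top using \<phi>(3) ker by (auto simp: inj_on_def prism_class_eq_iff)
  moreover have "compact_space prism_quotient"
  proof -
    have "compactin (top_of_set prism) prism"
      using compact_prism by (simp add: compactin_subtopology)
    then have "compactin prism_quotient (prism_class ` prism)"
      using image_compactin quotient_imp_continuous_map[OF q] by blast
    then show ?thesis by (simp add: compact_space_def top)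
  qed
  ultimately have "homeomorphic_map prism_quotient Y \<phi>"
    using \<phi> f(2) Y by (intro continuous_imp_homeomorphic_map) auto
  then show ?thesis using \<phi>(3) that by simp
qed

lemma continuous_map_Min_image:
  fixes f :: "'i \<Rightarrow> 'a \<Rightarrow> real"
  assumes "finite I" "I \<noteq> {}" "\<And>i. i \<in> I \<Longrightarrow> continuous_map X euclideanreal (f i)"
  shows "continuous_map X euclideanreal (\<lambda>x. Min ((\<lambda>i. f i x) ` I))"
  using assms by (induction rule: finite_ne_induct) (auto intro: continuous_map_real_min)

text \<open>The distance of a point \<open>p\<close> from a finite set is a minimum of
  \<open>k\<close> distances, so it is continuous on tuples and descends to the quotient. It is 0
  exactly on the sets that contain \<open>p\<close>, so a point of only one of two sets separates
  them.\<close>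

lemma Hausdorff_space_symmetric_potency:
  assumes "0 < k" shows "Hausdorff_space (symmetric_potency k (top_of_set (S :: 'a::metric_space set)))"
proof -
  let ?X = "product_topology (\<lambda>_. top_of_set S) {..<k}"
  let ?Y = "symmetric_potency k (top_of_set S)"
  define d where "d p A = Min (dist p ` A)" for p :: 'a and A
  have cont: "continuous_map ?Y euclideanreal (d p)" for p
  proof -
    have "continuous_map ?X euclideanreal (\<lambda>x. Min ((\<lambda>i. dist p (x i)) ` {..<k}))"
    proof (rule continuous_map_Min_image)
      fix i assume "i \<in> {..<k}"
      then have "continuous_map ?X (top_of_set S) (\<lambda>x. x i)"
        by (rule continuous_map_product_projection)
      moreover have "continuous_map (top_of_set S) euclideanreal (dist p)"
        by (simp add: continuous_on_dist)
      ultimately have "continuous_map ?X euclideanreal (dist p \<circ> (\<lambda>x. x i))"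
        by (rule continuous_map_compose)
      then show "continuous_map ?X euclideanreal (\<lambda>x. dist p (x i))"
        by (simp only: comp_def)
    qed (use assms in auto)
    then have "continuous_map ?X euclideanreal (d p \<circ> (\<lambda>x. x ` {..<k}))"
      by (simp add: d_def comp_def image_image)
    then show ?thesis
      unfolding symmetric_potency_def
      using continuous_compose_quotient_map quotient_map_quotient_topology by blast
  qed
  have zero: "d p A = 0 \<longleftrightarrow> p \<in> A" if "A \<in> topspace ?Y" for p A
  proof -
    have A: "finite A" "A \<noteq> {}" using that assms by (simp_all add: topspace_symmetric_potency)
    then have "d p A \<in> dist p ` A" unfolding d_def by (intro Min_in) auto
    moreover have "d p A \<le> dist p a" if "a \<in> A" for a using A that by (simp add: d_def)
    ultimately show ?thesis by (metis dist_le_zero_iff dist_self imageE zero_le_dist order_antisym)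
  qed
  show ?thesis
    unfolding Hausdorff_space_def
  proof (intro allI impI, elim conjE)
    fix A B assume A: "A \<in> topspace ?Y" and B: "B \<in> topspace ?Y" and "A \<noteq> B"
    then obtain p where "p \<in> A \<longleftrightarrow> p \<notin> B" by blast
    then have "d p A \<noteq> d p B" using zero A B by metis
    then obtain U V where UV: "open U" "open V" "d p A \<in> U" "d p B \<in> V" "U \<inter> V = {}"
      using hausdorff by metis
    then show "\<exists>U V. openin ?Y U \<and> openin ?Y V \<and> A \<in> U \<and> B \<in> V \<and> disjnt U V"
      using openin_continuous_map_preimage[OF cont[of p]] A B
      by (intro exI[of _ "{A \<in> topspace ?Y. d p A \<in> U}"] exI[of _ "{A \<in> topspace ?Y. d p A \<in> V}"])
        (auto simp: disjnt_iff)
  qed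
qed

lemma ex_cis_2pi: "norm w = 1 \<Longrightarrow> \<exists>t. w = cis (2 * pi * t)"
  by (metis (no_types) complex_norm_eq_1_exp cis_conv_exp mult.commute nonzero_mult_div_cancel_left
      pi_neq_zero times_divide_eq_right zero_neq_numeral mult_eq_0_iff)

lemma prism_map_symmetric_potency:
  "continuous_map (top_of_set prism) (symmetric_potency 3 circle_top) prism_map"
  "prism_map ` prism = topspace (symmetric_potency 3 circle_top)"
proof -
  define g :: "real \<times> real \<times> real \<Rightarrow> nat \<Rightarrow> complex" where
    "g u = restrict (\<lambda>i. cis (2 * pi * (if i = 0 then fst u else if i = 1 then fst (snd u) else snd (snd u)))) {..<3}" for u
  have "continuous_on prism (\<lambda>u. cis (2 * pi * (if i = 0 then fst u else if i = 1 then fst (snd u) else snd (snd u))))" for i :: nat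
    by (cases "i = 0"; cases "i = 1") (auto intro!: continuous_intros)
  then have "continuous_map (top_of_set prism) (product_topology (\<lambda>_. circle_top) {..<3}) g"
    by (auto simp: continuous_map_componentwise g_def continuous_map_in_subtopology)
  moreover have "quotient_map (product_topology (\<lambda>_. circle_top) {..<3::nat}) (symmetric_potency 3 circle_top) (\<lambda>x. x ` {..<3})"
    unfolding symmetric_potency_def by (rule quotient_map_quotient_topology)
  ultimately have "continuous_map (top_of_set prism) (symmetric_potency 3 circle_top) ((\<lambda>x. x ` {..<3}) \<circ> g)"
    using continuous_map_compose quotient_imp_continuous_map by blast
  moreover have 3: "{..<3} = {0, 1, 2::nat}" by auto
  have "(\<lambda>x. x ` {..<3}) \<circ> g = prism_map"
    unfolding 3 by (auto simp: g_def 3)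
  ultimately show cont: "continuous_map (top_of_set prism) (symmetric_potency 3 circle_top) prism_map" by simp
  have "A \<in> prism_map ` prism" if A: "A \<in> topspace (symmetric_potency 3 circle_top)" for A
  proof -
    obtain x where x: "x \<in> topspace (product_topology (\<lambda>_. circle_top) {..<3::nat})" "A = x ` {..<3}"
      using A unfolding symmetric_potency_def by auto
    then have "norm (x i) = 1" if "i < 3" for i using that by (auto simp: PiE_iff)
    from this[of 0] this[of 1] this[of 2] have "norm (x 0) = 1" "norm (x 1) = 1" "norm (x 2) = 1"
      by simp_all
    then obtain a b c where "x 0 = cis (2 * pi * a)" "x 1 = cis (2 * pi * b)" "x 2 = cis (2 * pi * c)"
      using ex_cis_2pi by metis
    then have "A = {cis (2 * pi * a), cis (2 * pi * b), cis (2 * pi * c)}" using x(2) by (simp add: 3)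
    then show ?thesis using prism_map_onto[of a b c] by auto
  qed
  then show "prism_map ` prism = topspace (symmetric_potency 3 circle_top)"
    using cont by (auto simp: continuous_map_def)
qed

lemma prism_quotient_symmetric_potency:
  "\<exists>pbar. homeomorphic_map prism_quotient (symmetric_potency 3 circle_top) pbar \<and>
     (\<forall>u\<in>prism. pbar (prism_class u) = prism_map u)"
proof -
  obtain \<phi> where "homeomorphic_map prism_quotient (symmetric_potency 3 circle_top) \<phi>"
    "\<And>u. u \<in> prism \<Longrightarrow> \<phi> (prism_class u) = prism_map u"
    using prism_quotient_homeomorphism[OF prism_map_symmetric_potency Hausdorff_space_symmetric_potency] by auto
  then show ?thesis by blast
qed

section \<open>The quotient of the prism as a join of two circles\<close>

text \<open>Meant for polar coordinates: where the radius \<open>g\<close> vanishes the direction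
  \<open>k\<close> may jump, and its boundedness is enough for the product.\<close>

lemma continuous_on_mult_bounded:
  fixes g :: "'a::metric_space \<Rightarrow> real" and k :: "'a \<Rightarrow> 'b::real_normed_vector"
  assumes g: "continuous_on S g" and k: "continuous_on {x \<in> S. g x \<noteq> 0} k" and bd: "\<And>x. x \<in> S \<Longrightarrow> norm (k x) \<le> 1"
  shows "continuous_on S (\<lambda>x. g x *\<^sub>R k x)"
proof (rule continuous_on_eq_continuous_within[THEN iffD2], rule ballI)
  fix x assume x: "x \<in> S"
  show "continuous (at x within S) (\<lambda>x. g x *\<^sub>R k x)"
  proof (cases "g x = 0")
    case True
    have "(g \<longlongrightarrow> 0) (at x within S)" using g x True by (auto simp: continuous_on_def)
    then have "((\<lambda>y. g y *\<^sub>R k y) \<longlongrightarrow> 0) (at x within S)"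
    proof (rule Lim_null_comparison[rotated, OF tendsto_norm_zero])
      show "\<forall>\<^sub>F y in at x within S. norm (g y *\<^sub>R k y) \<le> norm (g y)"
        using bd by (auto simp: eventually_at_filter mult_left_le)
    qed
    then show ?thesis using True by (simp add: continuous_within)
  next
    case False
    have "openin (top_of_set S) (S \<inter> g -` (- {0}))"
      using g by (intro continuous_openin_preimage_gen) auto
    moreover have "S \<inter> g -` (- {0}) = {x \<in> S. g x \<noteq> 0}" by auto
    ultimately obtain U where U: "open U" "{x \<in> S. g x \<noteq> 0} = S \<inter> U"
      by (auto simp: openin_open)
    have "continuous_on (S \<inter> U) (\<lambda>x. g x *\<^sub>R k x)"
    proof (rule continuous_on_scaleR)
      show "continuous_on (S \<inter> U) g" using g by (rule continuous_on_subset) simp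
      show "continuous_on (S \<inter> U) k" using k unfolding U(2) .
    qed
    then have "continuous (at x within S \<inter> U) (\<lambda>x. g x *\<^sub>R k x)"
      using x False U(2) by (auto simp: continuous_on_eq_continuous_within)
    moreover have "at x within S \<inter> U = at x within S"
      using U x False by (intro at_within_nhd[of x U]) auto
    ultimately show ?thesis by simp
  qed
qed

text \<open>Here \<open>s\<close> is the sum of the three coordinates, \<open>r\<close> is the position on the ray from the axis of the prism
  (\<open>r = 0\<close>) to a side (\<open>r = 1\<close>), and \<open>t\<close> is the position of the end of that ray on the side.  For a fixed argument
  of \<open>u\<close> and fixed \<open>r\<close>, the point \<open>w\<close> runs on an ellipse with semi-axes \<open>1 - r/2\<close> and \<open>1 - r\<close>, in a frame that has
  turned by \<open>3/2\<close> times that argument.  The ellipses degenerate to the circle \<open>|w| = 1\<close>, where \<open>u = 0\<close>, and to a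
  slit, which sweeps out the Moebius band.\<close>

definition ray_coords :: "real \<Rightarrow> real \<Rightarrow> real \<Rightarrow> complex \<times> complex" where
  "ray_coords r s t =
     (let w = cis (2 * pi * s) * (complex_of_real (1 - 3 * r / 4) + complex_of_real (r / 4) * cis (2 * pi * t))
      in ((1 - norm w) *\<^sub>R cis (2 * pi * ((2 * s + t) / 3)), w))"

abbreviation "join_sphere \<equiv> {(u :: complex, w :: complex). norm u + norm w = 1}"

text \<open>At \<open>r = 0\<close> the quotient is \<open>0\<close> by the convention \<open>x / 0 = 0\<close>; its value does not matter there.\<close>

definition sector_coords :: "real \<times> real \<times> real \<Rightarrow> complex \<times> complex" where
  "sector_coords = (\<lambda>(x, y, z). ray_coords (1 - 3 * (y - x)) (x + y + z) (((z - y) - (y - x)) / (1 - 3 * (y - x))))"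

definition sector :: "(real \<times> real \<times> real) set" where
  "sector = {(x, y, z). x \<le> y \<and> y - x \<le> z - y \<and> y - x \<le> x + 1 - z}"

lemma norm_ray_coords_le:
  assumes "0 \<le> r" "r \<le> 1" shows "norm (snd (ray_coords r s t)) \<le> 1 - r / 2"
proof -
  have "norm (snd (ray_coords r s t)) = norm (complex_of_real (1 - 3 * r / 4) + complex_of_real (r / 4) * cis (2 * pi * t))"
    unfolding ray_coords_def Let_def snd_conv norm_mult[of "cis _"] norm_cis mult_1 ..
  also have "\<dots> \<le> norm (complex_of_real (1 - 3 * r / 4)) + norm (complex_of_real (r / 4) * cis (2 * pi * t))"
    by (rule norm_triangle_ineq)
  also have "\<dots> = 1 - r / 2" using assms by (simp add: norm_mult del: of_real_diff of_real_divide of_real_mult)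
  finally show ?thesis .
qed

lemma ray_coords_0: "ray_coords 0 s t = (0, cis (2 * pi * s))"
  by (simp add: ray_coords_def)

lemma fst_ray_coords:
  "fst (ray_coords r s t) = (1 - norm (snd (ray_coords r s t))) *\<^sub>R cis (2 * pi * ((2 * s + t) / 3))"
  by (simp add: ray_coords_def Let_def)

text \<open>The half-angle form. The factor \<open>cis (pi * (2 * s + t))\<close> is the frame,
  turned by 3/2 of the argument of \<open>u\<close>; in it the ellipse is in normal position, and
  \<open>t\<close> from 0 to 1 sweeps one half of it.\<close>

lemma snd_ray_coords:
  "snd (ray_coords r s t) = cis (pi * (2 * s + t)) * Complex ((1 - r / 2) * cos (pi * t)) (- (1 - r) * sin (pi * t))"
proof -
  have e1: "cis (2 * pi * s) = cis (pi * (2 * s + t)) * cis (- (pi * t))"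
    by (simp add: cis_mult algebra_simps)
  have e2: "cis (2 * pi * t) = cis (pi * t) * cis (pi * t)" by (simp add: cis_mult algebra_simps)
  have e3: "cis (- (pi * t)) * cis (pi * t) = 1" by (simp add: cis_mult)
  have "snd (ray_coords r s t) = cis (pi * (2 * s + t)) * (cis (- (pi * t)) * complex_of_real (1 - 3 * r / 4) +
     complex_of_real (r / 4) * (cis (- (pi * t)) * cis (pi * t)) * cis (pi * t))"
    unfolding ray_coords_def Let_def snd_conv e1 e2 by (simp add: algebra_simps)
  also have "cis (- (pi * t)) * complex_of_real (1 - 3 * r / 4) +
     complex_of_real (r / 4) * (cis (- (pi * t)) * cis (pi * t)) * cis (pi * t)
     = Complex ((1 - r / 2) * cos (pi * t)) (- (1 - r) * sin (pi * t))"
    unfolding e3 by (rule complex_eqI) (simp_all add: algebra_simps del: of_real_diff of_real_divide of_real_mult)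
  finally show ?thesis .
qed

lemma ray_coords_in_join:
  assumes "0 \<le> r" "r \<le> 1" shows "ray_coords r s t \<in> join_sphere"
proof -
  have "norm (snd (ray_coords r s t)) \<le> 1" using norm_ray_coords_le[OF assms, of s t] assms by linarith
  then have "norm (fst (ray_coords r s t)) + norm (snd (ray_coords r s t)) = 1" by (simp add: fst_ray_coords)
  then show ?thesis by (simp add: case_prod_unfold)
qed

text \<open>\<open>C\<close> and \<open>S\<close> stand for squared cosines and sines. Both
  semi-axes decrease strictly as the radius grows, so the ellipses are nested and have no common
  point.\<close>

lemma ellipse_radius_unique:
  fixes r r' C S C' S' :: real
  assumes "r < r'" "0 \<le> r" "r' \<le> 1" "0 \<le> C" "0 \<le> S" "0 \<le> C'" "0 \<le> S'" "C + S = 1" "C' + S' = 1"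
    and c: "(1 - r'/2)^2 * C' = (1 - r/2)^2 * C" and s: "(1 - r')^2 * S' = (1 - r)^2 * S"
  shows False
proof -
  have a: "(1 - r'/2)^2 < (1 - r/2)^2" "0 < (1 - r'/2)^2" using assms by (auto intro!: power_strict_mono)
  have b: "(1 - r')^2 < (1 - r)^2" using assms by (auto intro!: power_strict_mono)
  have "(1 - r'/2)^2 * C \<le> (1 - r'/2)^2 * C'" using c a assms by (simp add: mult_right_mono)
  then have "C \<le> C'" using a by (simp add: mult_le_cancel_left)
  then have "S' \<le> S" using assms by linarith
  then have "(1 - r')^2 * S' \<le> (1 - r')^2 * S" by (simp add: mult_left_mono)
  then have "(1 - r)^2 * S \<le> (1 - r')^2 * S" using s by simp
  then have "S = 0" using b assms by (metis mult_le_cancel_right not_less order_le_less)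
  then have "S' = 0" "C = 1" "C' = 1" using \<open>S' \<le> S\<close> assms by auto
  then show False using c a by simp
qed

lemma cos_pi_inj: "t = t'" if "cos (pi * t) = cos (pi * t')" "0 \<le> t" "t \<le> 1" "0 \<le> t'" "t' \<le> 1"
proof -
  have "pi * t = pi * t'"
    using that by (intro cos_inj_pi[of "pi * t" "pi * t'"]) (auto simp: mult_left_le)
  then show ?thesis by simp
qed

text \<open>Off the axis the argument of \<open>u\<close> fixes \<open>2 * s + t\<close> up to
  \<open>3 * n\<close>. For even \<open>n\<close> the frames agree and so do the half ellipses,
  point by point; for odd \<open>n\<close> they are opposite halves, which meet only at their ends
  or when the ellipse is a slit. On the axis, \<open>r = 0\<close>, the parameter \<open>t\<close>
  is lost.\<close>

lemma ray_coords_eq_cases: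
  assumes eq: "ray_coords r s t = ray_coords r' s' t'"
    and r: "0 \<le> r" "r \<le> 1" "0 \<le> r'" "r' \<le> 1" and t: "0 \<le> t" "t \<le> 1" "0 \<le> t'" "t' \<le> 1"
  shows "r = r' \<and> (\<exists>n::int. r = 0 \<and> s' = s + of_int n \<or> t' = t \<and> s' = s + 3 * of_int n \<or>
    t' = 1 - t \<and> s' = s + t + 1 + 3 * of_int n \<and> (r = 1 \<or> t = 0 \<or> t = 1))"
proof (cases "r = 0 \<or> r' = 0")
  case True
  have "norm (snd (ray_coords r s t)) = 1"
    using True eq ray_coords_0 by (metis norm_cis snd_conv)
  then have "r = 0" "r' = 0"
    using norm_ray_coords_le[of r s t] norm_ray_coords_le[of r' s' t'] r eq by auto
  then have "cis (2 * pi * s') = cis (2 * pi * s)" using eq by (simp add: ray_coords_0)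
  then show ?thesis using \<open>r = 0\<close> \<open>r' = 0\<close> by (auto simp: cis_2pi_eq_iff)
next
  case False
  then have pos: "0 < r" "0 < r'" using r by auto
  have "norm (snd (ray_coords r s t)) < 1"
    using norm_ray_coords_le[of r s t] r pos by auto
  moreover have "(1 - norm (snd (ray_coords r s t))) *\<^sub>R cis (2 * pi * ((2 * s' + t') / 3)) =
      (1 - norm (snd (ray_coords r s t))) *\<^sub>R cis (2 * pi * ((2 * s + t) / 3))"
    using fst_ray_coords[of r s t] fst_ray_coords[of r' s' t'] unfolding eq by (simp only:)
  ultimately have "cis (2 * pi * ((2 * s' + t') / 3)) = cis (2 * pi * ((2 * s + t) / 3))"
    by (subst (asm) scaleR_cancel_left) auto
  then obtain n :: int where n: "(2 * s' + t') / 3 = (2 * s + t) / 3 + of_int n"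
    unfolding cis_2pi_eq_iff by blast
  then have n': "2 * s' + t' = 2 * s + t + 3 * of_int n" by simp
  \<comment> \<open>While \<open>u\<close> makes \<open>n\<close> turns the frame makes
    \<open>3 * n\<close> half turns, which amounts to the sign of \<open>n\<close> half
    turns.\<close>
  define \<epsilon> :: real where "\<epsilon> = (if even n then 1 else - 1)"
  have \<epsilon>: "cis (pi * (3 * of_int n)) = complex_of_real \<epsilon>"
  proof -
    have "cis (pi * (3 * of_int n)) = cis (2 * pi * of_int n + pi * of_int n)"
      by (simp add: algebra_simps)
    also have "\<dots> = cis (2 * pi * of_int n) * cis (pi * of_int n)" by (simp only: cis_mult)
    also have "cis (2 * pi * of_int n) = 1" using cis_2pi_add_int(1)[of 0 n] by simp
    also have "cis (pi * of_int n) = complex_of_real \<epsilon>"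
      by (rule complex_eqI) (simp_all add: \<epsilon>_def)
    finally show ?thesis by simp
  qed
  have "cis (pi * (2 * s + t)) * Complex ((1 - r / 2) * cos (pi * t)) (- (1 - r) * sin (pi * t)) =
    cis (pi * (2 * s + t)) * (complex_of_real \<epsilon> * Complex ((1 - r' / 2) * cos (pi * t')) (- (1 - r') * sin (pi * t')))"
    using arg_cong[OF eq, of snd] unfolding snd_ray_coords n' distrib_left[of pi "2 * s + t"] cis_mult[symmetric] \<epsilon>
    by (simp add: mult.assoc)
  then have "Complex ((1 - r / 2) * cos (pi * t)) (- (1 - r) * sin (pi * t)) =
      complex_of_real \<epsilon> * Complex ((1 - r' / 2) * cos (pi * t')) (- (1 - r') * sin (pi * t'))"
    by simp
  then have C: "(1 - r / 2) * cos (pi * t) = \<epsilon> * ((1 - r' / 2) * cos (pi * t'))"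
    and S: "(1 - r) * sin (pi * t) = \<epsilon> * ((1 - r') * sin (pi * t'))"
    by (auto simp: complex_eq_iff algebra_simps)
  have \<epsilon>2: "\<epsilon>^2 = 1" by (simp add: \<epsilon>_def)
  have C2: "(1 - r / 2)^2 * (cos (pi * t))^2 = (1 - r' / 2)^2 * (cos (pi * t'))^2"
    using arg_cong[OF C, of "\<lambda>x. x^2"] \<epsilon>2 by (simp add: power_mult_distrib)
  have S2: "(1 - r)^2 * (sin (pi * t))^2 = (1 - r')^2 * (sin (pi * t'))^2"
    using arg_cong[OF S, of "\<lambda>x. x^2"] \<epsilon>2 by (simp add: power_mult_distrib)
  have "\<not> r < r'"
    using ellipse_radius_unique[of r r' "(cos (pi * t))^2" "(sin (pi * t))^2" "(cos (pi * t'))^2" "(sin (pi * t'))^2"] r C2 S2 by auto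
  moreover have "\<not> r' < r"
    using ellipse_radius_unique[of r' r "(cos (pi * t'))^2" "(sin (pi * t'))^2" "(cos (pi * t))^2" "(sin (pi * t))^2"] r C2 S2 by auto
  ultimately have rr: "r = r'" by linarith
  have "(1 - r / 2) * cos (pi * t) = (1 - r / 2) * (\<epsilon> * cos (pi * t'))" using C rr by simp
  then have C': "cos (pi * t) = \<epsilon> * cos (pi * t')" using r by (subst (asm) mult_cancel_left) auto
  show ?thesis
  proof (cases "even n")
    case True
    then have "cos (pi * t) = cos (pi * t')" using C' by (simp add: \<epsilon>_def)
    then have "t = t'" by (rule cos_pi_inj) (use t in simp_all)
    moreover obtain m where m: "n = 2 * m" using True by auto
    moreover have "s' = s + 3 * of_int m" using n' \<open>t = t'\<close> m by simp
    ultimately show ?thesis using rr by blast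
  next
    case False
    then have "cos (pi * t) = cos (pi * (1 - t'))" using C' by (simp add: \<epsilon>_def algebra_simps cos_diff)
    then have t': "t' = 1 - t" using cos_pi_inj[of t "1 - t'"] t by auto
    have "(1 - r) * (sin (pi * t) + sin (pi * t')) = 0"
      using S rr False unfolding distrib_left by (simp add: \<epsilon>_def)
    then have "r = 1 \<or> sin (pi * t) = - sin (pi * t')" by (simp add: eq_neg_iff_add_eq_0)
    moreover have "0 \<le> sin (pi * t)" "0 \<le> sin (pi * t')" using t by (auto intro!: sin_ge_zero mult_left_le)
    ultimately have "r = 1 \<or> sin (pi * t) = 0" by linarith
    moreover have "t = 0 \<or> t = 1" if "sin (pi * t) = 0"
    proof (rule ccontr)
      assume "\<not> (t = 0 \<or> t = 1)"
      then have "0 < pi * t" "pi * t < pi * 1" using t by (simp, intro mult_strict_left_mono) simp_all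
      then show False using that sin_gt_zero[of "pi * t"] by simp
    qed
    moreover obtain m where m: "n = 2 * m + 1" using False oddE by blast
    have "s' = s + t + 1 + 3 * of_int m" using n' m t' by auto
    ultimately show ?thesis using rr t' by blast
  qed
qed

lemma ray_coords_onto:
  assumes "(u, w) \<in> join_sphere"
  obtains r s t where "0 \<le> r" "r \<le> 1" "0 \<le> t" "t \<le> 1" "ray_coords r s t = (u, w)"
proof (cases "u = 0")
  case True
  then obtain s where "w = cis (2 * pi * s)" using assms ex_cis_2pi by auto
  then show ?thesis using that[of 0 0 s] True by (simp add: ray_coords_0)
next
  case False
  have nu: "norm u = 1 - norm w" using assms by auto
  moreover have "0 < norm u" using False by simp
  ultimately have w1: "norm w < 1" by linarith
  have "norm (sgn u) = 1" using False by (simp add: norm_sgn)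
  then obtain \<phi>0 where \<phi>0: "sgn u = cis (2 * pi * \<phi>0)" using ex_cis_2pi by blast
  have neg: "cis (- (3 * pi * (\<phi>0 + 1))) = - cis (- (3 * pi * \<phi>0))"
  proof -
    have "cis (- (3 * pi * (\<phi>0 + 1))) = cis (- (3 * pi * \<phi>0)) * cis (2 * pi * (0 - of_int 2)) * cis pi"
      unfolding cis_mult by (simp add: algebra_simps)
    also have "cis (2 * pi * (0 - of_int 2)) = 1" using cis_2pi_add_int(2)[of 0 2] by simp
    finally show ?thesis by simp
  qed
  \<comment> \<open>Adding one turn leaves \<open>u\<close> alone and turns the frame by three half
    turns, so \<open>w\<close> can be brought into the half plane in which the half ellipses
    lie.\<close>
  obtain \<phi> where \<phi>: "sgn u = cis (2 * pi * \<phi>)" and im: "Im (w * cis (- (3 * pi * \<phi>))) \<le> 0"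
  proof (cases "Im (w * cis (- (3 * pi * \<phi>0))) \<le> 0")
    case True then show ?thesis using that \<phi>0 by blast
  next
    case False
    have "Im (w * cis (- (3 * pi * (\<phi>0 + 1)))) \<le> 0" using False unfolding neg by simp
    moreover have "sgn u = cis (2 * pi * (\<phi>0 + 1))" by (simp only: \<phi>0 cis_2pi_add_1)
    ultimately show ?thesis using that by blast
  qed
  define W where "W = w * cis (- (3 * pi * \<phi>))"
  define X Y where "X = Re W" "Y = - Im W"
  have Y: "0 \<le> Y" using im by (simp add: X_Y_def W_def)
  have "norm W = norm w" by (simp add: W_def norm_mult)
  then have "(norm W)^2 < 1" using w1 by (simp add: power_less_one_iff)
  then have XY: "X^2 + Y^2 < 1" by (simp add: cmod_power2 X_Y_def)
  have "\<exists>r t. 0 \<le> r \<and> r \<le> 1 \<and> 0 \<le> t \<and> t \<le> 1 \<and> (1 - r / 2) * cos (pi * t) = X \<and> (1 - r) * sin (pi * t) = Y"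
  \<comment> \<open>On the long axis the slit \<open>r = 1\<close> covers the values of
    \<open>X\<close> up to 1/2 in modulus; beyond it, \<open>X\<close> is an end of the ellipse
    whose semi-axis \<open>1 - r / 2\<close> is the modulus of \<open>X\<close>.\<close>
  proof (cases "Y = 0")
    case True
    have X1: "\<bar>X\<bar> < 1" using XY True by (simp add: abs_square_less_1)
    show ?thesis
    proof (cases "\<bar>X\<bar> \<le> 1/2")
      case True2: True
      have "cos (pi * (arccos (2 * X) / pi)) = 2 * X" using True2 by (simp add: cos_arccos)
      moreover have "0 \<le> arccos (2 * X) / pi" "arccos (2 * X) / pi \<le> 1"
        using arccos_lbound[of "2 * X"] arccos_ubound[of "2 * X"] True2 by auto
      ultimately show ?thesis using True by (intro exI[of _ "1::real"] exI[of _ "arccos (2 * X) / pi"]) auto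
    next
      case False
      define t :: real where "t = (if 0 \<le> X then 0 else 1)"
      have "(1 - 2 * (1 - \<bar>X\<bar>) / 2) * cos (pi * t) = X" "sin (pi * t) = 0" by (auto simp: t_def field_simps)
      moreover have "0 \<le> t" "t \<le> 1" by (auto simp: t_def)
      ultimately show ?thesis using True False X1
        by (intro exI[of "\<lambda>r. \<exists>t. 0 \<le> r \<and> r \<le> 1 \<and> 0 \<le> t \<and> t \<le> 1 \<and> (1 - r / 2) * cos (pi * t) = X \<and>
          (1 - r) * sin (pi * t) = Y" "2 * (1 - \<bar>X\<bar>)"], intro exI[of _ t]) auto
    qed
  next
    case False
    then have Ypos: "0 < Y" using Y by simp
    \<comment> \<open>The equation of the ellipse through \<open>X\<close> and \<open>Y\<close> with
      denominators cleared: negative at \<open>r = 0\<close>, since the point is inside the unit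
      circle, and positive at \<open>r = 1\<close>.\<close>
    define g where "g r = (1 - r)^2 * X^2 + (1 - r/2)^2 * Y^2 - (1 - r/2)^2 * (1 - r)^2" for r :: real
    have "\<exists>r. 0 \<le> r \<and> r \<le> 1 \<and> g r = 0"
      using XY by (intro IVT') (auto simp: g_def intro!: continuous_intros)
    then obtain r where r: "0 \<le> r" "r \<le> 1" "g r = 0" by blast
    have "r \<noteq> 1" using r(3) Ypos by (auto simp: g_def)
    then have ab: "0 < 1 - r" "0 < 1 - r/2" using r by auto
    define c where "c = X / (1 - r/2)"
    have c2: "c^2 + (Y / (1 - r))^2 = 1"
    proof -
      have "(1 - r/2)^2 * (1 - r)^2 * (c^2 + (Y / (1 - r))^2) = (1 - r)^2 * X^2 + (1 - r/2)^2 * Y^2"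
        using ab by (simp add: c_def power_divide distrib_left)
      also have "\<dots> = (1 - r/2)^2 * (1 - r)^2 * 1" using r(3) by (simp add: g_def)
      finally show ?thesis using ab by (subst (asm) mult_cancel_left) auto
    qed
    then have "c^2 \<le> 1" by (metis le_add_same_cancel1 zero_le_power2)
    then have c1: "\<bar>c\<bar> \<le> 1" by (simp add: abs_square_le_1)
    have "sin (arccos c) = Y / (1 - r)"
    proof -
      have "sin (arccos c) = sqrt (1 - c^2)" using c1 by (intro sin_arccos) auto
      also have "1 - c^2 = (Y / (1 - r))^2" using c2 by simp
      finally show ?thesis using Y ab by simp
    qed
    then have "(1 - r) * sin (pi * (arccos c / pi)) = Y" using ab by simp
    moreover have "(1 - r / 2) * cos (pi * (arccos c / pi)) = X"
    proof -
      have "cos (pi * (arccos c / pi)) = c" using c1 by (simp add: cos_arccos_abs)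
      then show ?thesis using ab by (simp add: c_def)
    qed
    moreover have "0 \<le> arccos c / pi" "arccos c / pi \<le> 1"
      using arccos_lbound[of c] arccos_ubound[of c] c1 by auto
    ultimately show ?thesis using r by blast
  qed
  then obtain r t where rt: "0 \<le> r" "r \<le> 1" "0 \<le> t" "t \<le> 1" "(1 - r / 2) * cos (pi * t) = X" "(1 - r) * sin (pi * t) = Y"
    by blast
  define s where "s = (3 * \<phi> - t) / 2"
  have "snd (ray_coords r s t) = cis (3 * pi * \<phi>) * W"
  proof -
    have "2 * s + t = 3 * \<phi>" by (simp add: s_def field_simps)
    then have "pi * (2 * s + t) = 3 * pi * \<phi>" by simp
    moreover have "Complex ((1 - r / 2) * cos (pi * t)) (- (1 - r) * sin (pi * t)) = W"
      using rt(5,6) unfolding X_Y_def by (intro complex_eqI) (simp_all only: complex.sel mult_minus_left minus_minus)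
    ultimately show ?thesis unfolding snd_ray_coords by (simp only:)
  qed
  also have "\<dots> = w" by (simp add: W_def cis_mult mult.left_commute)
  finally have w: "snd (ray_coords r s t) = w" .
  have "fst (ray_coords r s t) = norm u *\<^sub>R sgn u"
    unfolding fst_ray_coords w \<phi> nu by (simp add: s_def field_simps)
  also have "\<dots> = u" using False by (simp add: sgn_div_norm)
  finally show ?thesis using that[OF rt(1-4), of s] w by (simp add: prod_eq_iff)
qed

section \<open>Fitting the three sectors together around the axis\<close>

lemma ray_coords_shift: "ray_coords r (s + 3 * of_int n) t = ray_coords r s t"
proof -
  have "cis (2 * pi * (s + 3 * of_int n)) = cis (2 * pi * s)"
    using cis_2pi_add_int(1)[of s "3 * n"] by simp
  moreover have "(2 * (s + 3 * of_int n) + t) / 3 = (2 * s + t) / 3 + of_int (2 * n)" by (simp add: field_simps)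
  ultimately show ?thesis unfolding ray_coords_def Let_def by (simp only: cis_2pi_add_int)
qed

lemma ray_coords_turn: "ray_coords r (s + 1) 1 = ray_coords r s 0"
proof -
  have "(2 * (s + 1) + 1) / 3 = (2 * s + 0) / 3 + 1" by (simp add: field_simps)
  then show ?thesis unfolding ray_coords_def Let_def by (simp only: cis_2pi_add_1) simp
qed

lemma sector_coords_shift:
  "sector_coords (x + of_int n, y + of_int n, z + of_int n) = sector_coords (x, y, z)"
proof -
  have "x + of_int n + (y + of_int n) + (z + of_int n) = x + y + z + 3 * of_int n" by simp
  then show ?thesis by (simp only: sector_coords_def prod.case ray_coords_shift add_diff_cancel_right)
qed

text \<open>Where the two gaps agree, the first ray of one sector, \<open>t = 0\<close>, is the last
  ray of the next one, \<open>t = 1\<close>. On the axis \<open>s\<close> enters only modulo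
  1.\<close>

lemma sector_coords_turn:
  assumes "y - x = z - y" shows "sector_coords (y, z, x + 1) = sector_coords (x, y, z)"
proof (cases "1 - 3 * (y - x) = 0")
  case True
  have "1 - 3 * (z - y) = 0" "y + z + (x + 1) = x + y + z + 1" using assms True by simp_all
  then show ?thesis
    using True by (simp only: sector_coords_def prod.case ray_coords_0 cis_2pi_add_1)
next
  case False
  have "((x + 1 - z) - (z - y)) / (1 - 3 * (z - y)) = 1"
    using assms False by (simp add: field_simps)
  moreover have "((z - y) - (y - x)) / (1 - 3 * (y - x)) = 0" using assms by simp
  moreover have "y + z + (x + 1) = x + y + z + 1" by simp
  ultimately show ?thesis
    using assms by (simp only: sector_coords_def prod.case ray_coords_turn)
qed

text \<open>Applies the screw motion or its inverse so that the smallest gap comes first.\<close>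

definition to_sector :: "real \<times> real \<times> real \<Rightarrow> real \<times> real \<times> real" where
  "to_sector = (\<lambda>(x, y, z). if y - x \<le> min (z - y) (x + 1 - z) then (x, y, z)
     else if z - y \<le> x + 1 - z then (y, z, x + 1) else (z - 1, x, y))"

definition sphere_coords :: "real \<times> real \<times> real \<Rightarrow> complex \<times> complex" where
  "sphere_coords u = sector_coords (to_sector u)"

lemma to_sector_in: "u \<in> cyclic_triples \<Longrightarrow> to_sector u \<in> sector"
  by (cases u) (auto simp: to_sector_def cyclic_triples_def sector_def)

lemma prism_map_to_sector: "prism_map (to_sector u) = prism_map u"
  by (cases u) (auto simp: to_sector_def)

lemma sector_subset: "sector \<subseteq> cyclic_triples"
  by (auto simp: sector_def cyclic_triples_def)

lemma snd_ray_coords_scaleR: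
  "snd (ray_coords r s t) =
     cis (2 * pi * s) * (complex_of_real (1 - 3 * r / 4) + complex_of_real (1 / 4) * (r *\<^sub>R cis (2 * pi * t)))"
  by (simp add: ray_coords_def Let_def scaleR_conv_of_real)

text \<open>Both singular directions occur at the axis: \<open>cis\<close> of \<open>t\<close> is
  damped by the factor \<open>r\<close>, and the direction of \<open>u\<close> by the length of
  \<open>u\<close>, and both factors vanish there.\<close>

lemma continuous_on_sector_coords: "continuous_on sector sector_coords"
proof -
  let ?a = "\<lambda>u :: real \<times> real \<times> real. fst (snd u) - fst u"
  let ?r = "\<lambda>u. 1 - 3 * ?a u"
  let ?t = "\<lambda>u. ((snd (snd u) - fst (snd u)) - ?a u) / ?r u"
  let ?s = "\<lambda>u :: real \<times> real \<times> real. fst u + fst (snd u) + snd (snd u)"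
  let ?w = "\<lambda>u. cis (2 * pi * ?s u) * (complex_of_real (1 - 3 * ?r u / 4) + complex_of_real (1 / 4) * (?r u *\<^sub>R cis (2 * pi * ?t u)))"
  have r: "continuous_on A ?r" for A by (intro continuous_intros)
  have k: "continuous_on {u \<in> sector. ?r u \<noteq> 0} (\<lambda>u. cis (2 * pi * ?t u))"
    by (intro continuous_intros) auto
  have rk: "continuous_on sector (\<lambda>u. ?r u *\<^sub>R cis (2 * pi * ?t u))"
    by (rule continuous_on_mult_bounded[OF r k]) simp
  have w: "continuous_on sector ?w"
    by (rule continuous_on_mult[OF _ continuous_on_add[OF _ continuous_on_mult[OF continuous_on_const rk]]])
      (auto intro!: continuous_intros)
  have w_eq: "snd (ray_coords (?r u) (?s u) (?t u)) = ?w u" for u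
    by (rule snd_ray_coords_scaleR)
  have "continuous_on {u \<in> sector. 1 - norm (?w u) \<noteq> 0} (\<lambda>u. cis (2 * pi * ((2 * ?s u + ?t u) / 3)))"
  proof (intro continuous_intros ballI)
    fix u assume u: "u \<in> {u \<in> sector. 1 - norm (?w u) \<noteq> 0}"
    show "?r u \<noteq> 0"
    proof
      assume "?r u = 0"
      then have "norm (?w u) = 1" by (simp add: norm_mult)
      with u show False by simp
    qed
  qed auto
  then have "continuous_on sector (\<lambda>u. (1 - norm (?w u)) *\<^sub>R cis (2 * pi * ((2 * ?s u + ?t u) / 3)))"
    by (rule continuous_on_mult_bounded[OF continuous_on_diff[OF continuous_on_const continuous_on_norm[OF w]]])
      (simp only: norm_cis order_refl)
  then have "continuous_on sector (\<lambda>u. ((1 - norm (?w u)) *\<^sub>R cis (2 * pi * ((2 * ?s u + ?t u) / 3)), ?w u))"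
    using w by (intro continuous_on_Pair)
  moreover have "sector_coords = (\<lambda>u. ((1 - norm (?w u)) *\<^sub>R cis (2 * pi * ((2 * ?s u + ?t u) / 3)), ?w u))"
  proof
    fix u
    have "sector_coords u = ray_coords (?r u) (?s u) (?t u)" by (simp add: sector_coords_def case_prod_unfold)
    then show "sector_coords u = ((1 - norm (?w u)) *\<^sub>R cis (2 * pi * ((2 * ?s u + ?t u) / 3)), ?w u)"
      using fst_ray_coords[of "?r u" "?s u" "?t u"] w_eq[of u] by (metis prod.collapse)
  qed
  ultimately show ?thesis by (simp only:)
qed

lemma continuous_on_sphere_coords: "continuous_on cyclic_triples sphere_coords"
proof -
  let ?h = "\<lambda>u :: real \<times> real \<times> real. (fst (snd u) - fst u) - min (snd (snd u) - fst (snd u)) (fst u + 1 - snd (snd u))"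
  let ?k = "\<lambda>u :: real \<times> real \<times> real. (snd (snd u) - fst (snd u)) - (fst u + 1 - snd (snd u))"
  let ?f = "\<lambda>u :: real \<times> real \<times> real. (fst (snd u), snd (snd u), fst u + 1)"
  let ?g = "\<lambda>u :: real \<times> real \<times> real. (snd (snd u) - 1, fst u, fst (snd u))"
  have turn: "sector_coords (z - 1, x, y) = sector_coords (x, y, z)" if "y - x = x + 1 - z" for x y z
    using sector_coords_turn[of x "z - 1" y] that by simp
  have turn2: "sector_coords (y, z, x + 1) = sector_coords (z - 1, x, y)" if "z - y = x + 1 - z" for x y z
    using sector_coords_turn[of z y "x + 1"] sector_coords_shift[of "z - 1" 1 x y] that by simp
  have eq: "sphere_coords u = (if ?h u \<le> 0 then sector_coords u else
     if ?k u \<le> 0 then sector_coords (?f u) else sector_coords (?g u))" for u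
    by (cases u) (simp add: sphere_coords_def to_sector_def)
  have A: "continuous_on A (\<lambda>u. sector_coords (q u))" if "continuous_on A q" "q ` A \<subseteq> sector" for A and q :: "real \<times> real \<times> real \<Rightarrow> real \<times> real \<times> real"
    using continuous_on_compose2[OF continuous_on_sector_coords that] .
  have c2: "continuous_on {u \<in> cyclic_triples. 0 \<le> ?h u}
      (\<lambda>u. if ?k u \<le> 0 then sector_coords (?f u) else sector_coords (?g u))"
  proof (rule continuous_on_cases_le)
    show "continuous_on {t \<in> {u \<in> cyclic_triples. 0 \<le> ?h u}. ?k t \<le> 0} (\<lambda>u. sector_coords (?f u))"
      by (rule A) (auto intro!: continuous_intros simp: cyclic_triples_def sector_def min_def split: if_splits)
    show "continuous_on {t \<in> {u \<in> cyclic_triples. 0 \<le> ?h u}. 0 \<le> ?k t} (\<lambda>u. sector_coords (?g u))"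
      by (rule A) (auto intro!: continuous_intros simp: cyclic_triples_def sector_def min_def split: if_splits)
    show "continuous_on {u \<in> cyclic_triples. 0 \<le> ?h u} ?k" by (intro continuous_intros)
    show "sector_coords (?f u) = sector_coords (?g u)" if "?k u = 0" for u
      by (rule turn2) (use that in simp)
  qed
  have c1: "continuous_on {u \<in> cyclic_triples. ?h u \<le> 0} sector_coords"
    by (rule continuous_on_subset[OF continuous_on_sector_coords]) (auto simp: cyclic_triples_def sector_def)
  have c3: "continuous_on cyclic_triples ?h" by (intro continuous_intros)
  have c4: "sector_coords u = (if ?k u \<le> 0 then sector_coords (?f u) else sector_coords (?g u))"
    if "u \<in> cyclic_triples" "?h u = 0" for u
    using that sector_coords_turn[of "fst (snd u)" "fst u" "snd (snd u)"] turn[of "fst (snd u)" "fst u" "snd (snd u)"]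
    by (cases u) (auto simp: min_def split: if_splits)
  have "continuous_on cyclic_triples (\<lambda>u. if ?h u \<le> 0 then sector_coords u else
     if ?k u \<le> 0 then sector_coords (?f u) else sector_coords (?g u))"
    by (rule continuous_on_cases_le[OF c1 c2 c3 c4])
  then show ?thesis unfolding eq[abs_def] .
qed

text \<open>The triples \<open>(p, p, q)\<close> and \<open>(p, q, q)\<close> have the same image;
  \<open>w\<close> is half the mean of the points of the circle given by their coordinate sums and
  is therefore symmetric under the fold.\<close>

definition band_coords :: "real \<Rightarrow> real \<Rightarrow> complex \<times> complex" where
  "band_coords p q = (let w = (cis (2 * pi * (2 * p + q)) + cis (2 * pi * (p + 2 * q))) / 4
     in ((1 - norm w) *\<^sub>R cis (2 * pi * (p + q)), w))"

lemma sector_coords_degenerate: "sector_coords (x, x, z) = band_coords x z"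
proof -
  have w: "cis (2 * pi * (x + x + z)) * (complex_of_real (1 - 3 * 1 / 4) + complex_of_real (1 / 4) * cis (2 * pi * (z - x)))
     = (cis (2 * pi * (2 * x + z)) + cis (2 * pi * (x + 2 * z))) / 4"
    by (simp add: distrib_left cis_mult algebra_simps add_divide_distrib)
  have t: "(2 * (x + x + z) + (z - x)) / 3 = x + z" by (simp add: field_simps)
  have "sector_coords (x, x, z) = ray_coords 1 (x + x + z) (z - x)" by (simp add: sector_coords_def)
  then show ?thesis unfolding ray_coords_def band_coords_def Let_def w t .
qed

lemma band_coords_swap: "band_coords (q + of_int n) (p + 1 + of_int n) = band_coords p q"
  "band_coords (p + of_int n) (q + of_int n) = band_coords p q"
proof -
  have *: "cis (2 * pi * (2 * (q + of_int n) + (p + 1 + of_int n))) = cis (2 * pi * (p + 2 * q))"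
    "cis (2 * pi * ((q + of_int n) + 2 * (p + 1 + of_int n))) = cis (2 * pi * (2 * p + q))"
    "cis (2 * pi * ((q + of_int n) + (p + 1 + of_int n))) = cis (2 * pi * (p + q))"
    "cis (2 * pi * (2 * (p + of_int n) + (q + of_int n))) = cis (2 * pi * (2 * p + q))"
    "cis (2 * pi * ((p + of_int n) + 2 * (q + of_int n))) = cis (2 * pi * (p + 2 * q))"
    "cis (2 * pi * ((p + of_int n) + (q + of_int n))) = cis (2 * pi * (p + q))"
    unfolding cis_2pi_eq_iff
    by (rule exI[of _ "3 * n + 1"] exI[of _ "3 * n + 2"] exI[of _ "2 * n + 1"] exI[of _ "3 * n"] exI[of _ "2 * n"], simp)+
  show "band_coords (q + of_int n) (p + 1 + of_int n) = band_coords p q"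
    unfolding band_coords_def * by (simp only: add.commute)
  show "band_coords (p + of_int n) (q + of_int n) = band_coords p q"
    unfolding band_coords_def * ..
qed

text \<open>On the band this is the symmetry of \<open>band_coords\<close>. Off the band the two
  triples differ by a power of the screw motion; if it is more than a translation, lying in the same
  sector forces two smallest gaps to agree, and there the sectors fit.\<close>

lemma sector_coords_eq_if:
  assumes u: "u \<in> sector" and v: "v \<in> sector" and eq: "prism_map u = prism_map v"
  shows "sector_coords u = sector_coords v"
proof -
  obtain x y z x' y' z' where uv: "u = (x, y, z)" "v = (x', y', z')" by (cases u, cases v) auto
  have uc: "(x, y, z) \<in> cyclic_triples" and vc: "(x', y', z') \<in> cyclic_triples"
    using u v sector_subset by (auto simp: uv)
  show ?thesis
  proof (cases "x = y")
    case True
    have "x' = y' \<or> y' = z' \<or> z' = x' + 1"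
      using prism_map_eq_degenerate[OF uc vc] eq True by (simp add: uv)
    then have y': "y' = x'" using v by (auto simp: uv sector_def)
    have "{cis (2 * pi * x), cis (2 * pi * z)} = {cis (2 * pi * x'), cis (2 * pi * z')}"
      using eq by (simp add: uv True y')
    then obtain n :: int where "x' = x + of_int n \<and> z' = z + of_int n \<or> x' = z + of_int n \<and> z' = x + 1 + of_int n"
      using cis_pair_eq_iff[of x z x' z'] uc vc True y' by (auto simp: cyclic_triples_def)
    then show ?thesis
      using band_coords_swap[of z n x] band_coords_swap[of x n z]
      by (auto simp: uv sector_coords_degenerate y' True[symmetric])
  next
    case False
    then have lt: "x < y" "y < z" "z < x + 1" using u by (auto simp: uv sector_def)
    obtain n :: int where "(x', y', z') = (x + of_int n, y + of_int n, z + of_int n) \<or>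
      (x', y', z') = (y + of_int n, z + of_int n, x + 1 + of_int n) \<or>
      (x', y', z') = (z + of_int n, x + 1 + of_int n, y + 1 + of_int n)"
      using prism_map_eq_strict[OF lt vc] eq uv by metis
    then show ?thesis
    proof (elim disjE)
      assume "(x', y', z') = (x + of_int n, y + of_int n, z + of_int n)"
      then show ?thesis unfolding uv by (simp only: sector_coords_shift)
    next
      assume e: "(x', y', z') = (y + of_int n, z + of_int n, x + 1 + of_int n)"
      then have "y - x = z - y" using u v by (auto simp: uv sector_def)
      then show ?thesis unfolding uv e by (simp only: sector_coords_shift sector_coords_turn)
    next
      assume e: "(x', y', z') = (z + of_int n, x + 1 + of_int n, y + 1 + of_int n)"
      then have "x + 1 - z = y - x" using u v by (auto simp: uv sector_def)
      then have "sector_coords (z, x + 1, y + 1) = sector_coords (x + 1, y + 1, z + 1)"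
        using sector_coords_turn[of "x + 1" z "y + 1"] by simp
      also have "\<dots> = sector_coords (x, y, z)" using sector_coords_shift[of x 1 y z] by simp
      finally show ?thesis unfolding uv e by (simp only: sector_coords_shift)
    qed
  qed
qed

lemma sector_coords_eq_only_if:
  assumes u: "u \<in> sector" and v: "v \<in> sector" and eq: "sector_coords u = sector_coords v"
  shows "prism_map u = prism_map v"
proof -
  obtain x y z x' y' z' where uv: "u = (x, y, z)" "v = (x', y', z')" by (cases u, cases v) auto
  define r s t r' s' t' where d: "r = 1 - 3 * (y - x)" "s = x + y + z" "t = ((z - y) - (y - x)) / r"
    "r' = 1 - 3 * (y' - x')" "s' = x' + y' + z'" "t' = ((z' - y') - (y' - x')) / r'"
  have r: "0 \<le> r" "r \<le> 1" "0 \<le> r'" "r' \<le> 1" using u v by (auto simp: uv sector_def d)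
  have t: "0 \<le> t" "t \<le> 1" "0 \<le> t'" "t' \<le> 1"
    using u v r unfolding uv sector_def d by (auto simp: divide_le_eq_1)
  have rt: "r * t = (z - y) - (y - x)" "r' * t' = (z' - y') - (y' - x')"
    using u v by (auto simp: d uv sector_def)
  have "ray_coords r s t = ray_coords r' s' t'" using eq by (simp add: uv sector_coords_def d)
  from ray_coords_eq_cases[OF this r t] obtain n :: int where rr: "r = r'" and
    cs: "r = 0 \<and> s' = s + of_int n \<or> t' = t \<and> s' = s + 3 * of_int n \<or>
      t' = 1 - t \<and> s' = s + t + 1 + 3 * of_int n \<and> (r = 1 \<or> t = 0 \<or> t = 1)" by blast
  \<comment> \<open>The triple is recovered from its parameters; \<open>r * t\<close> stays a
    product so that the formulas also hold on the axis.\<close>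
  have xyz: "x = (s - 2 * (1 - r) / 3 - ((1 - r) / 3 + r * t)) / 3" "y = x + (1 - r) / 3" "z = y + (1 - r) / 3 + r * t"
    unfolding rt by (simp_all add: d field_simps)
  have xyz': "x' = (s' - 2 * (1 - r) / 3 - ((1 - r) / 3 + r * t')) / 3" "y' = x' + (1 - r) / 3" "z' = y' + (1 - r) / 3 + r * t'"
    unfolding rt rr by (simp_all add: rt) (simp_all add: d field_simps)
  have shift: "prism_map (x, y, z) = prism_map (x', y', z')" if "x' = x + of_int n" "y' = y + of_int n" "z' = z + of_int n" for n :: int
    using prism_map_shift(1)[of x n y z] that by simp
  have shift1: "prism_map (x, y, z) = prism_map (x', y', z')" if "x' = y + of_int n" "y' = z + of_int n" "z' = x + 1 + of_int n" for n :: int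
    using prism_map_shift(1)[of y n z "x + 1"] prism_map_shift(2)[of y z x] that by simp
  have shift2: "prism_map (x, y, z) = prism_map (x', y', z')" if "x' = z - 1 + of_int n" "y' = x + of_int n" "z' = y + of_int n" for n :: int
    using prism_map_shift(1)[of "z - 1" n x y] prism_map_shift(3)[of z x y] that by simp
  show ?thesis unfolding uv using cs
  proof (elim disjE conjE)
    \<comment> \<open>On the axis all gaps are 1/3, so raising \<open>s\<close> by 1 is one screw
      motion.\<close>
    assume 0: "r = 0" "s' = s + of_int n"
    define m where "m = n div 3"
    have "n mod 3 = 0 \<or> n mod 3 = 1 \<or> n mod 3 = 2" by auto
    moreover have "n = 3 * m + n mod 3" by (simp add: m_def)
    ultimately consider "n = 3 * m" | "n = 3 * m + 1" | "n = 3 * m + 2" by linarith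
    then show "prism_map (x, y, z) = prism_map (x', y', z')"
    proof cases
      case 1
      show ?thesis by (rule shift[of m]) (use 0 1 xyz xyz' in simp_all)
    next
      case 2
      show ?thesis by (rule shift1[of m]) (use 0 2 xyz xyz' in simp_all)
    next
      case 3
      show ?thesis by (rule shift2[of "m + 1"]) (use 0 3 xyz xyz' in simp_all)
    qed
  next
    assume *: "t' = t" "s' = s + 3 * of_int n"
    show "prism_map (x, y, z) = prism_map (x', y', z')"
      by (rule shift[of n]) (use * xyz xyz' in \<open>simp_all add: field_simps\<close>)
  next
    assume *: "t' = 1 - t" "s' = s + t + 1 + 3 * of_int n" "r = 1"
    have "y = x" "y' = x'" "x' = z + of_int n" "z' = x + 1 + of_int n"
      using * xyz xyz' by (simp_all add: field_simps)
    then show "prism_map (x, y, z) = prism_map (x', y', z')"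
      using prism_map_shift(1)[of z n z "x + 1"] by auto
  next
    assume *: "t' = 1 - t" "s' = s + t + 1 + 3 * of_int n" "t = 0"
    show "prism_map (x, y, z) = prism_map (x', y', z')"
      by (rule shift1[of n]) (use * xyz xyz' in \<open>simp_all add: field_simps\<close>)
  next
    assume *: "t' = 1 - t" "s' = s + t + 1 + 3 * of_int n" "t = 1"
    show "prism_map (x, y, z) = prism_map (x', y', z')"
      by (rule shift2[of "n + 1"]) (use * xyz xyz' in \<open>simp_all add: field_simps\<close>)
  qed
qed

lemma sphere_coords_eq_iff:
  assumes "u \<in> cyclic_triples" "v \<in> cyclic_triples"
  shows "sphere_coords u = sphere_coords v \<longleftrightarrow> prism_map u = prism_map v"
  using sector_coords_eq_if[OF to_sector_in to_sector_in, OF assms]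
    sector_coords_eq_only_if[OF to_sector_in to_sector_in, OF assms]
  unfolding sphere_coords_def prism_map_to_sector by blast

lemma sphere_coords_prism: "sphere_coords ` prism = join_sphere"
proof
  have "sector_coords v \<in> join_sphere" if "v \<in> sector" for v
  proof -
    obtain x y z where v: "v = (x, y, z)" by (cases v) auto
    show ?thesis unfolding v sector_coords_def prod.case
      by (rule ray_coords_in_join) (use that in \<open>auto simp: v sector_def\<close>)
  qed
  then show "sphere_coords ` prism \<subseteq> join_sphere"
    unfolding sphere_coords_def
    by (intro image_subsetI) (simp only: to_sector_in subsetD[OF prism_subset_cyclic_triples])
  show "join_sphere \<subseteq> sphere_coords ` prism"
  proof
    fix a assume "a \<in> join_sphere"
    then obtain r s t where rt: "0 \<le> r" "r \<le> 1" "0 \<le> t" "t \<le> 1" "ray_coords r s t = a"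
      using ray_coords_onto by (metis (no_types, lifting) surj_pair)
    define x where "x = (s - 2 * (1 - r) / 3 - ((1 - r) / 3 + r * t)) / 3"
    define y where "y = x + (1 - r) / 3"
    define z where "z = y + (1 - r) / 3 + r * t"
    define m where "m = r * t"
    have m: "0 \<le> m" "m \<le> r" using rt by (auto simp: m_def mult_left_le)
    have "y - x = (1 - r) / 3" unfolding y_def by simp
    moreover have "z - y = (1 - r) / 3 + m" unfolding z_def m_def by simp
    ultimately have "x \<le> y" "y - x \<le> z - y" "y - x \<le> x + 1 - z" using rt(1,2) m by argo+
    then have sec: "(x, y, z) \<in> sector" by (simp add: sector_def)
    have e1: "1 - 3 * (y - x) = r" by (simp add: y_def field_simps)
    have "3 * x = s - 2 * (1 - r) / 3 - ((1 - r) / 3 + r * t)" by (simp add: x_def)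
    then have e2: "x + y + z = s" unfolding z_def y_def by linarith
    have e3: "(z - y) - (y - x) = r * t" by (simp add: z_def y_def)
    have "sector_coords (x, y, z) = ray_coords r s (r * t / r)"
      by (simp only: sector_coords_def prod.case e1 e2 e3)
    then have "sector_coords (x, y, z) = a" using rt(5) by (cases "r = 0") (auto simp: ray_coords_0)
    moreover have "to_sector (x, y, z) = (x, y, z)" using sec by (simp add: to_sector_def sector_def)
    ultimately have "sphere_coords (x, y, z) = a" by (simp add: sphere_coords_def)
    moreover obtain v where "v \<in> prism" "prism_map v = prism_map (x, y, z)"
      using cyclic_triple_in_prism sec sector_subset by blast
    ultimately show "a \<in> sphere_coords ` prism"
      using sphere_coords_eq_iff[of v "(x, y, z)"] subsetD[OF sector_subset sec] subsetD[OF prism_subset_cyclic_triples, of v]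
      by (intro image_eqI[of _ _ v]) simp_all
  qed
qed

lemma sphere_coords_degenerate:
  assumes "(x, x, z) \<in> cyclic_triples" shows "sphere_coords (x, x, z) = band_coords x z"
  using assms by (simp add: sphere_coords_def to_sector_def cyclic_triples_def sector_coords_degenerate)

section \<open>The join as the one-point compactification of space\<close>

text \<open>A point of space at distance \<open>d\<close> from the third axis and at height \<open>z\<close> is described by \<open>v = (d - 2) + i z\<close>.
  The Moebius transformation with parameter \<open>tau\<close> preserves the unit disc, which is the cross section of the standard
  solid torus, and maps the half plane \<open>Re v \<ge> -2\<close> onto the disc of radius \<open>1 / tau\<close>.\<close>

definition tau :: real where "tau = 2 - sqrt 3"

lemma tau: "0 < tau" "tau < 1/2" "tau^2 = 4 * tau - 1"
proof -
  have "3/2 < sqrt 3" by (rule real_less_rsqrt) (simp add: power2_eq_square)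
  moreover have "sqrt 3 < 2" by (rule real_less_lsqrt) simp_all
  ultimately show "0 < tau" "tau < 1/2" by (auto simp: tau_def)
  show "tau^2 = 4 * tau - 1" by (simp add: tau_def power2_eq_square algebra_simps)
qed

definition moebius :: "real \<Rightarrow> complex \<Rightarrow> complex" where
  "moebius k v = (v + complex_of_real k) / (1 + complex_of_real k * v)"

lemma norm_moebius_aux:
  "(cmod (v + complex_of_real k))^2 - (cmod (1 + complex_of_real k * v))^2 = (1 - k^2) * ((cmod v)^2 - 1)"
  unfolding cmod_power2 by (simp add: algebra_simps power2_eq_square)

lemma norm_moebius_ge_1:
  assumes "\<bar>k\<bar> < 1" "1 + complex_of_real k * v \<noteq> 0"
  shows "1 \<le> cmod (moebius k v) \<longleftrightarrow> 1 \<le> cmod v" "cmod (moebius k v) = 1 \<longleftrightarrow> cmod v = 1"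
proof -
  let ?a = "cmod (v + complex_of_real k)" and ?b = "cmod (1 + complex_of_real k * v)"
  have k: "0 < 1 - k^2" using assms(1) by (simp add: abs_square_less_1)
  have b: "0 < ?b" using assms(2) by simp
  have m: "cmod (moebius k v) = ?a / ?b" by (simp add: moebius_def norm_divide)
  have "1 \<le> cmod (moebius k v) \<longleftrightarrow> ?b \<le> ?a" using b by (simp add: m le_divide_eq_1)
  also have "\<dots> \<longleftrightarrow> ?b^2 \<le> ?a^2" by (simp add: abs_le_square_iff[symmetric])
  also have "\<dots> \<longleftrightarrow> 0 \<le> (1 - k^2) * ((cmod v)^2 - 1)" using norm_moebius_aux[of v k] by linarith
  also have "\<dots> \<longleftrightarrow> 1 \<le> (cmod v)^2" using k by (simp add: zero_le_mult_iff)
  also have "\<dots> \<longleftrightarrow> 1 \<le> cmod v" using abs_le_square_iff[of 1 "cmod v"] by simp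
  finally show "1 \<le> cmod (moebius k v) \<longleftrightarrow> 1 \<le> cmod v" .
  have "cmod (moebius k v) = 1 \<longleftrightarrow> ?a = ?b" using b by (auto simp: m)
  also have "\<dots> \<longleftrightarrow> ?a^2 = ?b^2" by (simp add: power2_eq_iff_nonneg)
  also have "\<dots> \<longleftrightarrow> (1 - k^2) * ((cmod v)^2 - 1) = 0" using norm_moebius_aux[of v k] by linarith
  also have "\<dots> \<longleftrightarrow> (cmod v)^2 = 1^2" using k by simp
  also have "\<dots> \<longleftrightarrow> cmod v = 1" by (subst power2_eq_iff_nonneg) auto
  finally show "cmod (moebius k v) = 1 \<longleftrightarrow> cmod v = 1" .
qed

lemma moebius_inverse:
  assumes "\<bar>k\<bar> < 1" "1 + complex_of_real k * v \<noteq> 0"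
  shows "moebius (- k) (moebius k v) = v" "1 + complex_of_real (- k) * moebius k v \<noteq> 0"
proof -
  have "k^2 \<noteq> 1" using assms(1) by (metis abs_square_eq_1 less_irrefl)
  then have k: "1 - complex_of_real k * complex_of_real k \<noteq> 0"
    by (metis eq_iff_diff_eq_0 of_real_1 of_real_eq_iff of_real_mult power2_eq_square)
  let ?d = "1 + complex_of_real k * v"
  have 1: "moebius k v + complex_of_real (- k) = (1 - complex_of_real k * complex_of_real k) * v / ?d"
    using assms(2) by (simp add: moebius_def field_simps)
  have 2: "1 + complex_of_real (- k) * moebius k v = (1 - complex_of_real k * complex_of_real k) / ?d"
    using assms(2) by (simp add: moebius_def field_simps)
  show "1 + complex_of_real (- k) * moebius k v \<noteq> 0" unfolding 2 using k assms(2) by simp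
  show "moebius (- k) (moebius k v) = v"
    unfolding moebius_def[of "- k"] 1 2 using k assms(2) by simp
qed

lemma moebius_denom_nonzero:
  assumes "\<bar>k\<bar> * cmod v < 1" shows "1 + complex_of_real k * v \<noteq> 0"
proof
  assume "1 + complex_of_real k * v = 0"
  then have "complex_of_real k * v = - 1" by (simp add: eq_neg_iff_add_eq_0 add.commute)
  then have "cmod (complex_of_real k * v) = 1" by simp
  then show False using assms by (simp add: norm_mult)
qed

definition half_plane :: "complex set" where "half_plane = {v. - 2 \<le> Re v}"

lemma half_plane_denom: "v \<in> half_plane \<Longrightarrow> 1 + complex_of_real tau * v \<noteq> 0"
proof
  assume v: "v \<in> half_plane" "1 + complex_of_real tau * v = 0"
  then have "1 + tau * Re v = 0" by (auto simp: complex_eq_iff)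
  moreover have "tau * (- 2) \<le> tau * Re v" using v tau by (intro mult_left_mono) (auto simp: half_plane_def)
  ultimately show False using tau by linarith
qed

lemma norm_moebius_half_plane:
  assumes "1 + complex_of_real tau * v \<noteq> 0"
  shows "tau * cmod (moebius tau v) \<le> 1 \<longleftrightarrow> v \<in> half_plane"
    and "tau * cmod (moebius tau v) = 1 \<longleftrightarrow> Re v = - 2"
proof -
  let ?a = "cmod (v + complex_of_real tau)" and ?b = "cmod (1 + complex_of_real tau * v)"
  have b: "0 < ?b" using assms by simp
  have m: "tau * cmod (moebius tau v) = tau * ?a / ?b" by (simp add: moebius_def norm_divide)
  have "?b^2 - (tau * ?a)^2 = (1 - tau^2) * (1 + tau^2 + 2 * tau * Re v)"
    unfolding power_mult_distrib cmod_power2 by (simp add: algebra_simps power2_eq_square)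
  \<comment> \<open>The value of \<open>tau\<close> enters here: \<open>1 + tau^2 = 4 * tau\<close>
    puts the zero of this function of \<open>Re v\<close> at the third axis of space.\<close>
  also have "1 + tau^2 + 2 * tau * Re v = 2 * tau * (2 + Re v)" by (simp add: tau(3) algebra_simps)
  finally have eq: "?b^2 - (tau * ?a)^2 = (1 - tau^2) * (2 * tau) * (2 + Re v)" by simp
  have t: "0 < (1 - tau^2) * (2 * tau)" using tau by (intro mult_pos_pos) (auto simp: abs_square_less_1)
  have "tau * cmod (moebius tau v) \<le> 1 \<longleftrightarrow> tau * ?a \<le> ?b" using b by (simp add: m divide_le_eq_1)
  also have "\<dots> \<longleftrightarrow> (tau * ?a)^2 \<le> ?b^2"
    using abs_le_square_iff[of "tau * ?a" ?b] tau by (simp add: abs_mult)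
  also have "\<dots> \<longleftrightarrow> 0 \<le> (1 - tau^2) * (2 * tau) * (2 + Re v)" using eq by linarith
  also have "\<dots> \<longleftrightarrow> 0 \<le> 2 + Re v" using t by (metis mult_le_cancel_left_pos mult_zero_right)
  finally show "tau * cmod (moebius tau v) \<le> 1 \<longleftrightarrow> v \<in> half_plane" by (auto simp: half_plane_def)
  have "tau * cmod (moebius tau v) = 1 \<longleftrightarrow> tau * ?a = ?b" using b by (auto simp: m)
  also have "\<dots> \<longleftrightarrow> (tau * ?a)^2 = ?b^2"
    using tau by (simp add: power2_eq_iff_nonneg)
  also have "\<dots> \<longleftrightarrow> (1 - tau^2) * (2 * tau) * (2 + Re v) = 0" using eq by linarith
  also have "\<dots> \<longleftrightarrow> Re v = - 2" using t by (auto simp: add_eq_0_iff)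
  finally show "tau * cmod (moebius tau v) = 1 \<longleftrightarrow> Re v = - 2" .
qed

text \<open>Rescaled radially outside the unit disc so that the map is \<open>v / 2\<close> inside and continuous.\<close>

definition to_disc :: "complex \<Rightarrow> complex" where
  "to_disc v = (if cmod v \<le> 1 then v / 2 else
     (1/2 + (cmod (moebius tau v) - 1) / (2 * (1 / tau - 1))) *\<^sub>R moebius (- tau) (sgn (moebius tau v)))"

definition from_disc :: "complex \<Rightarrow> complex" where
  "from_disc w = (if cmod w \<le> 1/2 then 2 * w else
     moebius (- tau) ((1 + (2 * cmod w - 1) * (1 / tau - 1)) *\<^sub>R moebius tau (sgn w)))"

lemma tau_ratio: "0 < 1 / tau - 1" using tau by (simp add: field_simps)

lemma abs_tau: "\<bar>tau\<bar> < 1" "\<bar>- tau\<bar> < 1" using tau by auto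

lemma unit_denom: "cmod v = 1 \<Longrightarrow> 1 + complex_of_real tau * v \<noteq> 0" "cmod v = 1 \<Longrightarrow> 1 + complex_of_real (- tau) * v \<noteq> 0"
  using moebius_denom_nonzero[of tau v] moebius_denom_nonzero[of "- tau" v] tau by auto

text \<open>\<open>\<rho>\<close> becomes the modulus of the image; it grows from 1/2 to 1 while
  that of \<open>n\<close> grows from 1 to \<open>1 / tau\<close>. The value \<open>1 / tau\<close>
  of \<open>n\<close> itself is the image of infinity, so the point 1 of the disc stays free for
  it.\<close>

lemma to_disc_outer:
  assumes v: "v \<in> half_plane" "1 \<le> cmod v"
  defines "n \<equiv> moebius tau v"
  defines "\<rho> \<equiv> 1/2 + (cmod n - 1) / (2 * (1 / tau - 1))"
  shows "1 \<le> cmod n" "cmod n \<le> 1 / tau" "1/2 \<le> \<rho>" "\<rho> \<le> 1" "\<rho> = 1 \<longleftrightarrow> Re v = - 2" "cmod (sgn n) = 1"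
    "cmod (moebius (- tau) (sgn n)) = 1" "n \<noteq> complex_of_real (1 / tau)"
    "1 + (2 * \<rho> - 1) * (1 / tau - 1) = cmod n"
proof -
  note d = half_plane_denom[OF v(1)]
  show 1: "1 \<le> cmod n" using norm_moebius_ge_1(1)[OF abs_tau(1) d] v(2) by (simp add: n_def)
  have "tau * cmod n \<le> 1" using norm_moebius_half_plane(1)[OF d] v(1) by (simp add: n_def)
  then show 2: "cmod n \<le> 1 / tau" using tau by (simp add: field_simps)
  define D where "D = 1 / tau - 1"
  have D: "0 < D" using tau_ratio by (simp only: D_def)
  have \<rho>: "\<rho> = 1/2 + (cmod n - 1) / (2 * D)" by (simp only: \<rho>_def D_def)
  show "1/2 \<le> \<rho>" using 1 D by (simp add: \<rho>)
  have "cmod n - 1 \<le> D" using 2 by (simp add: D_def)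
  then show "\<rho> \<le> 1" using D by (simp add: \<rho> field_simps)
  have "\<rho> = 1 \<longleftrightarrow> cmod n - 1 = D" using D by (auto simp: \<rho> field_simps)
  also have "\<dots> \<longleftrightarrow> tau * cmod n = 1" using tau by (auto simp: D_def field_simps)
  finally show "\<rho> = 1 \<longleftrightarrow> Re v = - 2" using norm_moebius_half_plane(2)[OF d] by (simp add: n_def)
  have "n \<noteq> 0" using 1 by auto
  then show s: "cmod (sgn n) = 1" by (simp add: norm_sgn)
  show "cmod (moebius (- tau) (sgn n)) = 1"
    using norm_moebius_ge_1(2)[OF abs_tau(2) unit_denom(2)[OF s]] s by simp
  show "n \<noteq> complex_of_real (1 / tau)"
    using moebius_inverse(2)[OF abs_tau(1) d] tau by (auto simp: n_def)
  show "1 + (2 * \<rho> - 1) * (1 / tau - 1) = cmod n"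
    unfolding D_def[symmetric] using D by (simp add: \<rho> field_simps)
qed

lemma to_disc_eq_outer:
  assumes "v \<in> half_plane" "1 \<le> cmod v"
  shows "to_disc v = (1/2 + (cmod (moebius tau v) - 1) / (2 * (1 / tau - 1))) *\<^sub>R moebius (- tau) (sgn (moebius tau v))"
proof (cases "cmod v = 1")
  case True
  note d = half_plane_denom[OF assms(1)]
  have "cmod (moebius tau v) = 1" using norm_moebius_ge_1(2)[OF abs_tau(1) d] True by simp
  then show ?thesis
    using True moebius_inverse(1)[OF abs_tau(1) d] by (simp add: to_disc_def sgn_div_norm scaleR_conv_of_real)
qed (use assms in \<open>simp add: to_disc_def\<close>)

lemma norm_to_disc:
  assumes "v \<in> half_plane"
  shows "cmod (to_disc v) \<le> 1" "cmod (to_disc v) = 1 \<longleftrightarrow> Re v = - 2" "to_disc v \<noteq> 1" "from_disc (to_disc v) = v"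
proof -
  have "cmod (to_disc v) \<le> 1 \<and> (cmod (to_disc v) = 1 \<longleftrightarrow> Re v = - 2) \<and> to_disc v \<noteq> 1 \<and> from_disc (to_disc v) = v"
  proof (cases "cmod v \<le> 1")
    case True
    moreover have "Re v \<noteq> - 2" using abs_Re_le_cmod[of v] True by auto
    moreover have "v / 2 \<noteq> 1"
    proof
      assume "v / 2 = 1" then have "v = 2" by simp
      then show False using True by simp
    qed
    ultimately show ?thesis by (auto simp: to_disc_def from_disc_def norm_divide)
  next
    case False
    then have v: "v \<in> half_plane" "1 \<le> cmod v" using assms by auto
    define n where "n = moebius tau v"
    define \<rho> where "\<rho> = 1/2 + (cmod n - 1) / (2 * (1 / tau - 1))"
    define e where "e = moebius (- tau) (sgn n)"
    note o = to_disc_outer[OF v, folded n_def, folded \<rho>_def, folded e_def]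
    have w: "to_disc v = \<rho> *\<^sub>R e" using to_disc_eq_outer[OF v] by (simp add: n_def \<rho>_def e_def)
    have nw: "cmod (to_disc v) = \<rho>" using o by (simp add: w)
    have Be: "moebius tau e = sgn n"
      using moebius_inverse(1)[OF abs_tau(2) unit_denom(2)[OF o(6)]] by (simp add: e_def)
    have "cmod n \<noteq> 0" using o(1) by linarith
    then have nsgn: "cmod n *\<^sub>R sgn n = n" by (simp add: sgn_div_norm)
    have vn: "moebius (- tau) n = v"
      using moebius_inverse(1)[OF abs_tau(1) half_plane_denom[OF v(1)]] by (simp add: n_def)
    have "n = complex_of_real (1 / tau)" if "to_disc v = 1"
    proof -
      have "\<rho> = 1" using that nw by simp
      then have "e = 1" "cmod n = 1 / tau" using w that o(9) by auto
      then have "sgn n = 1" using Be unit_denom(1)[of 1] by (simp add: moebius_def)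
      then show ?thesis using nsgn \<open>cmod n = 1 / tau\<close> by (simp add: scaleR_conv_of_real)
    qed
    then have "to_disc v \<noteq> 1" using o(8) by blast
    moreover have "\<rho> \<noteq> 1/2"
    proof
      assume "\<rho> = 1/2"
      then have "2 * \<rho> - 1 = 0" by simp
      then have "cmod n = 1" using o(9) by (metis add.right_neutral mult_zero_left)
      then show False using norm_moebius_ge_1(2)[OF abs_tau(1) half_plane_denom[OF v(1)]] False by (simp add: n_def)
    qed
    then have "\<not> cmod (to_disc v) \<le> 1/2" using nw o(3) by simp
    then have fd: "from_disc (to_disc v) = moebius (- tau) ((1 + (2 * \<rho> - 1) * (1 / tau - 1)) *\<^sub>R moebius tau (sgn (to_disc v)))"
      by (simp add: from_disc_def nw)
    have "sgn (to_disc v) = e"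
      using o(3,7) by (simp add: w sgn_scaleR) (simp add: sgn_div_norm)
    then have "from_disc (to_disc v) = v" using fd by (simp only: o(9) Be nsgn vn)
    ultimately show ?thesis using nw o by simp
  qed
  then show "cmod (to_disc v) \<le> 1" "cmod (to_disc v) = 1 \<longleftrightarrow> Re v = - 2" "to_disc v \<noteq> 1" "from_disc (to_disc v) = v"
    by blast+
qed

lemma from_disc_outer:
  assumes w: "cmod w \<le> 1" "w \<noteq> 1" "1/2 \<le> cmod w"
  defines "n \<equiv> (1 + (2 * cmod w - 1) * (1 / tau - 1)) *\<^sub>R moebius tau (sgn w)"
  shows "cmod n = 1 + (2 * cmod w - 1) * (1 / tau - 1)" "1 + complex_of_real (- tau) * n \<noteq> 0" "tau * cmod n \<le> 1"
    "cmod (sgn w) = 1" "cmod (moebius tau (sgn w)) = 1"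
proof -
  show s: "cmod (sgn w) = 1" using w by (auto simp: norm_sgn)
  show m: "cmod (moebius tau (sgn w)) = 1"
    using norm_moebius_ge_1(2)[OF abs_tau(1) unit_denom(1)[OF s]] s by simp
  have p: "0 \<le> (2 * cmod w - 1) * (1 / tau - 1)" "(2 * cmod w - 1) * (1 / tau - 1) \<le> 1 * (1 / tau - 1)"
    using w tau_ratio by (auto intro!: mult_nonneg_nonneg mult_right_mono)
  show nn: "cmod n = 1 + (2 * cmod w - 1) * (1 / tau - 1)" using p m by (simp add: n_def)
  then have "cmod n \<le> 1 / tau" using p by simp
  then show tn: "tau * cmod n \<le> 1" using tau by (simp add: field_simps)
  show "1 + complex_of_real (- tau) * n \<noteq> 0"
  proof
    assume "1 + complex_of_real (- tau) * n = 0"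
    then have n: "n = complex_of_real (1 / tau)" using tau by (simp add: field_simps)
    then have "cmod n = 1 / tau" using tau by (simp add: norm_divide)
    then have "(2 * cmod w - 1) * (1 / tau - 1) = 1 * (1 / tau - 1)" using nn by (metis add_diff_cancel_left' mult_1)
    then have "2 * cmod w - 1 = 1" using tau_ratio by (metis less_irrefl mult_cancel_right)
    then have w1: "cmod w = 1" by simp
    then have "complex_of_real (1 / tau) * moebius tau (sgn w) = complex_of_real (1 / tau) * 1"
      using n by (simp add: n_def scaleR_conv_of_real)
    then have "moebius tau (sgn w) = 1" using tau by simp
    then have "sgn w = moebius (- tau) 1" using moebius_inverse(1)[OF abs_tau(1) unit_denom(1)[OF s]] by simp
    also have "\<dots> = 1" using unit_denom(2)[of 1] by (simp add: moebius_def)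
    finally show False using w1 w by (simp add: sgn_div_norm)
  qed
qed

lemma from_disc_props:
  assumes w: "cmod w \<le> 1" "w \<noteq> 1"
  shows "from_disc w \<in> half_plane" "to_disc (from_disc w) = w"
proof -
  have "from_disc w \<in> half_plane \<and> to_disc (from_disc w) = w"
  proof (cases "cmod w \<le> 1/2")
    case True
    then show ?thesis using abs_Re_le_cmod[of w]
      by (auto simp: from_disc_def half_plane_def to_disc_def norm_mult)
  next
    case False
    then have w3: "1/2 \<le> cmod w" by simp
    define n where "n = (1 + (2 * cmod w - 1) * (1 / tau - 1)) *\<^sub>R moebius tau (sgn w)"
    note o = from_disc_outer[OF w w3, folded n_def]
    define v where "v = moebius (- tau) n"
    have fv: "from_disc w = v" using False by (simp add: from_disc_def v_def n_def)
    have Bv: "moebius tau v = n" and d: "1 + complex_of_real tau * v \<noteq> 0"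
      using moebius_inverse[OF abs_tau(2) o(2)] by (auto simp: v_def)
    have hp: "v \<in> half_plane" using norm_moebius_half_plane(1)[OF d] o(3) by (simp add: Bv)
    have p: "0 < (2 * cmod w - 1) * (1 / tau - 1)" using False tau_ratio by (intro mult_pos_pos) auto
    then have n1: "1 < cmod n" using o(1) by simp
    have v1: "1 \<le> cmod v" using norm_moebius_ge_1(1)[OF abs_tau(1) d] n1 by (simp add: Bv)
    have "sgn n = moebius tau (sgn w)"
      using p o(5) unfolding n_def by (simp add: sgn_scaleR) (simp add: sgn_div_norm)
    then have "moebius (- tau) (sgn n) = sgn w"
      using moebius_inverse(1)[OF abs_tau(1) unit_denom(1)[OF o(4)]] by simp
    moreover have "1/2 + (cmod n - 1) / (2 * (1 / tau - 1)) = cmod w"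
      unfolding o(1) using tau_ratio by (simp add: field_simps)
    ultimately have "to_disc v = cmod w *\<^sub>R sgn w"
      using to_disc_eq_outer[OF hp v1] by (simp only: Bv)
    also have "\<dots> = w"
    proof -
      have "cmod w \<noteq> 0" using False by auto
      then show ?thesis by (simp add: sgn_div_norm)
    qed
    finally show ?thesis using hp fv by simp
  qed
  then show "from_disc w \<in> half_plane" "to_disc (from_disc w) = w" by blast+
qed

lemma continuous_on_moebius:
  assumes "continuous_on S f" "\<And>x. x \<in> S \<Longrightarrow> 1 + complex_of_real k * f x \<noteq> 0"
  shows "continuous_on S (\<lambda>x. moebius k (f x))"
  unfolding moebius_def using assms by (auto intro!: continuous_intros)

lemma continuous_on_to_disc: "continuous_on half_plane to_disc"
proof -
  have mb: "continuous_on {v \<in> half_plane. 1 \<le> cmod v} (moebius tau)"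
    by (rule continuous_on_moebius) (auto dest: half_plane_denom)
  have "continuous_on {v \<in> half_plane. 1 \<le> cmod v} (\<lambda>v. sgn (moebius tau v))"
    unfolding sgn_div_norm
    by (intro continuous_intros mb) (use to_disc_outer(1) in fastforce)
  then have "continuous_on {v \<in> half_plane. 1 \<le> cmod v} (\<lambda>v. moebius (- tau) (sgn (moebius tau v)))"
    by (rule continuous_on_moebius) (use to_disc_outer(6) unit_denom(2) in blast)
  then have c2: "continuous_on {v \<in> half_plane. 1 \<le> cmod v}
      (\<lambda>v. (1/2 + (cmod (moebius tau v) - 1) / (2 * (1 / tau - 1))) *\<^sub>R moebius (- tau) (sgn (moebius tau v)))"
    by (intro continuous_on_scaleR continuous_on_add continuous_on_divide continuous_on_diff continuous_on_norm
        continuous_on_const mb) (use tau_ratio in auto)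
  have c1: "continuous_on {v \<in> half_plane. cmod v \<le> 1} (\<lambda>v. v / 2)" by (intro continuous_intros) auto
  have "continuous_on half_plane (\<lambda>v. if cmod v \<le> 1 then v / 2 else
      (1/2 + (cmod (moebius tau v) - 1) / (2 * (1 / tau - 1))) *\<^sub>R moebius (- tau) (sgn (moebius tau v)))"
  proof (rule continuous_on_cases_le[OF c1 c2])
    show "continuous_on half_plane cmod" by (intro continuous_intros)
    show "v / 2 = (1/2 + (cmod (moebius tau v) - 1) / (2 * (1 / tau - 1))) *\<^sub>R moebius (- tau) (sgn (moebius tau v))"
      if "v \<in> half_plane" "cmod v = 1" for v
      using to_disc_eq_outer[of v] that by (simp add: to_disc_def)
  qed
  then show ?thesis by (simp only: to_disc_def[abs_def])
qed

lemma continuous_on_from_disc: "continuous_on {w. cmod w \<le> 1 \<and> w \<noteq> 1} from_disc"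
proof -
  let ?D = "{w. cmod w \<le> 1 \<and> w \<noteq> 1}"
  let ?O = "{w \<in> ?D. 1/2 \<le> cmod w}"
  let ?n = "\<lambda>w. (1 + (2 * cmod w - 1) * (1 / tau - 1)) *\<^sub>R moebius tau (sgn w)"
  have "continuous_on ?O sgn"
    unfolding sgn_div_norm[abs_def] by (intro continuous_intros) auto
  then have "continuous_on ?O (\<lambda>w. moebius tau (sgn w))"
    by (rule continuous_on_moebius) (use from_disc_outer(4) unit_denom(1) in blast)
  then have "continuous_on ?O ?n"
    by (intro continuous_on_scaleR continuous_on_add continuous_on_mult continuous_on_diff continuous_on_norm
        continuous_on_const continuous_on_id)
  then have c2: "continuous_on ?O (\<lambda>w. moebius (- tau) (?n w))"
    by (rule continuous_on_moebius) (use from_disc_outer(2) in blast)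
  have c1: "continuous_on {w \<in> ?D. cmod w \<le> 1/2} (\<lambda>w. 2 * w)" by (intro continuous_intros)
  have "continuous_on ?D (\<lambda>w. if cmod w \<le> 1/2 then 2 * w else moebius (- tau) (?n w))"
  proof (rule continuous_on_cases_le[OF c1 c2])
    show "continuous_on ?D cmod" by (intro continuous_intros)
    show "2 * w = moebius (- tau) (?n w)" if "w \<in> ?D" "cmod w = 1/2" for w
    proof -
      have "cmod (sgn w) = 1" using from_disc_outer(4)[of w] that by simp
      then have "moebius (- tau) (moebius tau (sgn w)) = sgn w"
        using moebius_inverse(1)[OF abs_tau(1) unit_denom(1)] by blast
      moreover have "sgn w = 2 * w" unfolding sgn_div_norm that(2) by (simp add: scaleR_conv_of_real)
      ultimately show ?thesis unfolding that(2) by simp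
    qed
  qed
  then show ?thesis by (simp only: from_disc_def[abs_def])
qed

lemma sgn_scaleR_sgn:
  fixes z :: "'a::real_normed_vector"
  assumes "0 < c" shows "sgn (c *\<^sub>R sgn z) = sgn z"
  using assms by (cases "z = 0") (simp_all add: sgn_scaleR sgn_div_norm[of "sgn z"] norm_sgn)

lemma norm_scaleR_sgn: "norm z *\<^sub>R sgn z = z" for z :: "'a::real_normed_vector"
  by (cases "z = 0") (simp_all add: sgn_div_norm)

text \<open>Cylindrical coordinates: \<open>u\<close> gives the direction from the third axis,
  \<open>v\<close> the distance and the height. The circle \<open>u = 0\<close> without
  \<open>(0, 1)\<close> becomes the axis itself, where \<open>sgn 0 = 0\<close> fits the distance 0;
  the point \<open>(0, 1)\<close> is kept for infinity.\<close>

definition join_to_space :: "complex \<times> complex \<Rightarrow> real \<times> real \<times> real" where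
  "join_to_space = (\<lambda>(u, w). let v = from_disc w; p = (2 + Re v) *\<^sub>R sgn u in (Re p, Im p, Im v))"

definition space_to_join :: "real \<times> real \<times> real \<Rightarrow> complex \<times> complex" where
  "space_to_join = (\<lambda>(x, y, z). let p = Complex x y; w = to_disc (Complex (cmod p - 2) z)
     in ((1 - cmod w) *\<^sub>R sgn p, w))"

lemma complex_minus_2_half_plane: "Complex (cmod p - 2) z \<in> half_plane"
  by (simp add: half_plane_def)

lemma space_to_join_in: "space_to_join q \<in> join_sphere - {(0, 1)}"
proof -
  obtain x y z where q: "q = (x, y, z)" by (cases q) auto
  let ?p = "Complex x y"
  let ?w = "to_disc (Complex (cmod ?p - 2) z)"
  note w = norm_to_disc[OF complex_minus_2_half_plane, of ?p z]
  have "cmod ((1 - cmod ?w) *\<^sub>R sgn ?p) = 1 - cmod ?w"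
  proof (cases "?p = 0")
    case True
    then show ?thesis using w(2) by simp
  next
    case False
    then show ?thesis using w(1) by (simp add: norm_sgn)
  qed
  then show ?thesis using w(3) by (simp add: space_to_join_def q Let_def)
qed

lemma join_to_space_to_join: "join_to_space (space_to_join q) = q"
proof -
  obtain x y z where q: "q = (x, y, z)" by (cases q) auto
  let ?p = "Complex x y"
  let ?w = "to_disc (Complex (cmod ?p - 2) z)"
  note w = norm_to_disc[OF complex_minus_2_half_plane, of ?p z]
  have "cmod ?p *\<^sub>R sgn ((1 - cmod ?w) *\<^sub>R sgn ?p) = ?p"
  proof (cases "?p = 0")
    case False
    then have "cmod ?w < 1" using w(1,2) by force
    then show ?thesis using norm_scaleR_sgn[of ?p] sgn_scaleR_sgn[of "1 - cmod ?w" ?p] by simp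
  qed simp
  moreover have "2 + (cmod ?p - 2) = cmod ?p" by simp
  ultimately show ?thesis
    unfolding space_to_join_def join_to_space_def q prod.case Let_def w(4) complex.sel by (simp only: complex.sel)
qed

lemma space_to_join_to_space:
  assumes "a \<in> join_sphere - {(0, 1)}" shows "space_to_join (join_to_space a) = a"
proof -
  obtain u w where a: "a = (u, w)" by (cases a) auto
  have nu: "cmod u = 1 - cmod w" using assms by (auto simp: a)
  then have w: "cmod w \<le> 1" "w \<noteq> 1" using assms norm_ge_zero[of u] unfolding a by (linarith, auto)
  note f = from_disc_props[OF w]
  let ?v = "from_disc w"
  let ?p = "(2 + Re ?v) *\<^sub>R sgn u"
  have rho: "0 \<le> 2 + Re ?v" "Re ?v = - 2 \<longleftrightarrow> cmod w = 1"
    using f norm_to_disc(2)[OF f(1)] by (auto simp: half_plane_def)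
  have np: "cmod ?p = 2 + Re ?v"
    using rho nu by (cases "u = 0") (auto simp: norm_sgn)
  have "(1 - cmod w) *\<^sub>R sgn ?p = u"
  proof (cases "u = 0")
    case False
    then have "cmod w \<noteq> 1" using nu by auto
    then have "0 < 2 + Re ?v" using rho by linarith
    then show ?thesis using norm_scaleR_sgn[of u] sgn_scaleR_sgn[of "2 + Re ?v" u] nu by simp
  qed simp
  moreover have "Complex (Re ?p) (Im ?p) = ?p" by (rule complex.collapse)
  moreover have "Complex (cmod ?p - 2) (Im ?v) = ?v" unfolding np by (simp add: complex_eq_iff)
  ultimately show ?thesis
    unfolding a join_to_space_def space_to_join_def prod.case Let_def using f(2) by (simp only:)
qed

lemma continuous_on_space_to_join: "continuous_on UNIV space_to_join"
proof -
  let ?p = "\<lambda>q :: real \<times> real \<times> real. Complex (fst q) (fst (snd q))"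
  let ?w = "\<lambda>q :: real \<times> real \<times> real. to_disc (Complex (cmod (?p q) - 2) (snd (snd q)))"
  have p: "continuous_on A ?p" for A unfolding Complex_eq by (intro continuous_intros)
  have "continuous_on UNIV (\<lambda>q. Complex (cmod (?p q) - 2) (snd (snd q)))"
    unfolding Complex_eq[of "cmod _ - 2"] by (intro continuous_intros p)
  then have w: "continuous_on UNIV ?w"
    by (rule continuous_on_compose2[OF continuous_on_to_disc]) (auto simp: complex_minus_2_half_plane)
  have "?p q \<noteq> 0" if "1 - cmod (?w q) \<noteq> 0" for q
  proof
    assume "?p q = 0"
    then show False using that norm_to_disc(2)[OF complex_minus_2_half_plane, of "?p q" "snd (snd q)"] by simp
  qed
  then have "continuous_on {q \<in> UNIV. 1 - cmod (?w q) \<noteq> 0} (\<lambda>q. sgn (?p q))"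
    unfolding sgn_div_norm by (intro continuous_intros p) auto
  then have "continuous_on UNIV (\<lambda>q. (1 - cmod (?w q)) *\<^sub>R sgn (?p q))"
    by (rule continuous_on_mult_bounded[OF continuous_on_diff[OF continuous_on_const continuous_on_norm[OF w]]])
      (simp add: norm_sgn)
  then have "continuous_on UNIV (\<lambda>q. ((1 - cmod (?w q)) *\<^sub>R sgn (?p q), ?w q))"
    using w by (rule continuous_on_Pair)
  moreover have "space_to_join = (\<lambda>q. ((1 - cmod (?w q)) *\<^sub>R sgn (?p q), ?w q))"
    by (simp add: fun_eq_iff space_to_join_def Let_def)
  ultimately show ?thesis by (simp only:)
qed

lemma continuous_on_join_to_space: "continuous_on (join_sphere - {(0, 1)}) join_to_space"
proof -
  let ?S = "join_sphere - {(0, 1)}"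
  let ?v = "\<lambda>a :: complex \<times> complex. from_disc (snd a)"
  have in_disc: "cmod (snd a) \<le> 1 \<and> snd a \<noteq> 1" if "a \<in> ?S" for a
  proof (cases a)
    case (Pair u w)
    then have "cmod u = 1 - cmod w" "(u, w) \<noteq> (0, 1)" using that by auto
    then show ?thesis using Pair norm_ge_zero[of u] by (cases "w = 1") auto
  qed
  have v: "continuous_on ?S ?v"
    by (rule continuous_on_compose2[OF continuous_on_from_disc]) (use in_disc in \<open>auto intro!: continuous_intros\<close>)
  have "fst a \<noteq> 0" if "a \<in> ?S" "2 + Re (?v a) \<noteq> 0" for a
  proof
    assume "fst a = 0"
    then have "cmod (snd a) = 1" using that(1) by (cases a) auto
    moreover note f = from_disc_props[of "snd a"]
    ultimately have "Re (?v a) = - 2" using in_disc[OF that(1)] norm_to_disc(2)[of "?v a"] by auto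
    with that(2) show False by simp
  qed
  then have "continuous_on {a \<in> ?S. 2 + Re (?v a) \<noteq> 0} (\<lambda>a. sgn (fst a))"
    unfolding sgn_div_norm by (intro continuous_intros) auto
  then have "continuous_on ?S (\<lambda>a. (2 + Re (?v a)) *\<^sub>R sgn (fst a))"
    by (rule continuous_on_mult_bounded[OF continuous_on_add[OF continuous_on_const continuous_on_Re[OF v]]])
      (simp add: norm_sgn)
  then have "continuous_on ?S (\<lambda>a. (Re ((2 + Re (?v a)) *\<^sub>R sgn (fst a)), Im ((2 + Re (?v a)) *\<^sub>R sgn (fst a)), Im (?v a)))"
    by (intro continuous_on_Pair continuous_on_Re continuous_on_Im v)
  moreover have "join_to_space = (\<lambda>a. (Re ((2 + Re (?v a)) *\<^sub>R sgn (fst a)), Im ((2 + Re (?v a)) *\<^sub>R sgn (fst a)), Im (?v a)))"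
    by (simp add: fun_eq_iff join_to_space_def Let_def)
  ultimately show ?thesis by (simp only:)
qed

text \<open>A neighbourhood of infinity is the complement of a compact set, and the inverse map
  \<open>g\<close> carries that set to a compact, hence closed, set that misses
  \<open>a\<close>.\<close>

lemma one_point_compactification_map:
  fixes f :: "'a::metric_space \<Rightarrow> 'b::euclidean_space"
  assumes S: "compact S" "a \<in> S"
    and f: "homeomorphism (S - {a}) UNIV f g"
  shows "continuous_map (top_of_set S) (Alexandroff_compactification euclidean) (\<lambda>y. if y = a then None else Some (f y))"
    (is "continuous_map _ ?Y ?\<Phi>")
  unfolding continuous_map_def
proof (intro conjI allI impI)
  show "?\<Phi> \<in> topspace (top_of_set S) \<rightarrow> topspace ?Y" by auto
  fix V assume "openin ?Y V"
  then consider U where "open U" "V = Some ` U"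
    | C where "compact C" "V = insert None (Some ` (- C))"
    by (auto simp: openin_Alexandroff_compactification Compl_eq_Diff_UNIV)
  then show "openin (top_of_set S) {x \<in> topspace (top_of_set S). ?\<Phi> x \<in> V}"
  proof cases
    case 1
    have "openin (top_of_set (S - {a})) ((S - {a}) \<inter> f -` U)"
      using f 1(1) by (intro continuous_openin_preimage_gen) (auto simp: homeomorphism_def)
    then obtain W where "open W" "(S - {a}) \<inter> f -` U = (S - {a}) \<inter> W" by (auto simp: openin_open)
    then have "{x \<in> S. ?\<Phi> x \<in> V} = S \<inter> (W - {a})" "open (W - {a})" using 1(2) by auto
    then show ?thesis by (auto simp: openin_open)
  next
    case 2
    have "compact (g ` C)"
      using f 2(1) by (intro compact_continuous_image) (auto simp: homeomorphism_def intro: continuous_on_subset)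
    moreover have "{x \<in> S. ?\<Phi> x \<in> V} = S \<inter> - (g ` C)"
    proof -
      have gf: "g c \<in> S - {a}" "f (g c) = c" for c using f by (auto simp: homeomorphism_def)
      have fg: "g (f x) = x" if "x \<in> S" "x \<noteq> a" for x using f that by (auto simp: homeomorphism_def)
      have "x \<in> g ` C \<longleftrightarrow> x \<noteq> a \<and> f x \<in> C" if "x \<in> S" for x
        using gf fg[OF that] by (metis DiffE image_iff insertI1)
      then show ?thesis unfolding 2(2) by auto
    qed
    ultimately show ?thesis by (auto simp: openin_open compact_imp_closed intro!: exI[of _ "- (g ` C)"])
  qed
qed

lemma homeomorphism_join_space: "homeomorphism (join_sphere - {(0, 1)}) UNIV join_to_space space_to_join"
  unfolding homeomorphism_def
proof (intro conjI ballI continuous_on_join_to_space continuous_on_space_to_join)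
  show "join_to_space ` (join_sphere - {(0, 1)}) = UNIV"
  proof (intro equalityI subset_UNIV subsetI)
    fix q show "q \<in> join_to_space ` (join_sphere - {(0, 1)})"
      by (rule image_eqI[where f = join_to_space and x = "space_to_join q"])
        (rule join_to_space_to_join[symmetric], rule space_to_join_in)
  qed
  show "space_to_join ` UNIV = join_sphere - {(0, 1)}"
  proof
    show "space_to_join ` UNIV \<subseteq> join_sphere - {(0, 1)}" by (intro image_subsetI space_to_join_in)
    show "join_sphere - {(0, 1)} \<subseteq> space_to_join ` UNIV"
    proof
      fix a :: "complex \<times> complex" assume "a \<in> join_sphere - {(0, 1)}"
      then show "a \<in> space_to_join ` UNIV"
        by (intro image_eqI[where f = space_to_join and x = "join_to_space a"])
          (rule space_to_join_to_space[symmetric], simp_all)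
    qed
  qed
next
  fix a :: "complex \<times> complex" assume "a \<in> join_sphere - {(0, 1)}"
  then show "space_to_join (join_to_space a) = a" by (rule space_to_join_to_space)
next
  fix q show "join_to_space (space_to_join q) = q" by (rule join_to_space_to_join)
qed


text \<open>On the band \<open>w\<close> has modulus at most 1/2, where \<open>from_disc\<close>
  only doubles. So \<open>v\<close> runs along the diameter in direction 3/2 of
  \<open>\<theta>\<close>, which is the cross section of the standard band.\<close>

lemma join_to_space_band: "join_to_space (band_coords p q) = three_half_twist (2 * pi * (p + q)) (cos (pi * (q - p)))"
  "band_coords p q \<noteq> (0, 1)"
proof -
  define \<theta> where "\<theta> = 2 * pi * (p + q)"
  define t where "t = cos (pi * (q - p))"
  let ?w = "(cis (2 * pi * (2 * p + q)) + cis (2 * pi * (p + 2 * q))) / 4"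
  have half: "3 * \<theta> / 2 = 3 * pi * (p + q)" by (simp add: \<theta>_def)
  have "cis (2 * pi * (2 * p + q)) = cis (3 * \<theta> / 2) * cis (- (pi * (q - p)))"
    "cis (2 * pi * (p + 2 * q)) = cis (3 * \<theta> / 2) * cis (pi * (q - p))"
    unfolding half by (simp_all add: cis_mult algebra_simps)
  moreover have "cis (- (pi * (q - p))) + cis (pi * (q - p)) = complex_of_real (2 * t)"
    by (rule complex_eqI) (simp_all add: t_def)
  ultimately have w: "?w = complex_of_real (t / 2) * cis (3 * \<theta> / 2)"
    by (simp add: distrib_left[symmetric])
  have "\<bar>t\<bar> \<le> 1" by (simp add: t_def)
  then have nw: "cmod ?w \<le> 1/2" unfolding w norm_mult by simp
  have v: "from_disc ?w = complex_of_real t * cis (3 * \<theta> / 2)"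
    unfolding from_disc_def using nw by (simp only: if_True w) simp
  have sg: "sgn ((1 - cmod ?w) *\<^sub>R cis \<theta>) = cis \<theta>" using nw by (simp add: sgn_scaleR sgn_div_norm)
  show "join_to_space (band_coords p q) = three_half_twist (2 * pi * (p + q)) (cos (pi * (q - p)))"
    unfolding band_coords_def join_to_space_def Let_def prod.case \<theta>_def[symmetric] t_def[symmetric] sg v
    by (simp add: three_half_twist_def)
  show "band_coords p q \<noteq> (0, 1)"
  proof
    assume "band_coords p q = (0, 1)"
    then have "?w = 1" by (simp add: band_coords_def Let_def)
    then have "cmod ?w = 1" by simp
    with nw show False by linarith
  qed
qed

section \<open>The gluing of the boundary\<close>

lemma realization_map_inj_on:
  assumes b: "b \<in> closed_simplex \<sigma>" and "inj_on f \<sigma>"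
  shows "v \<in> \<sigma> \<Longrightarrow> realization_map f b (f v) = b v" "w \<notin> f ` \<sigma> \<Longrightarrow> realization_map f b w = 0"
proof -
  have supp: "v \<in> \<sigma>" if "b v \<noteq> 0" for v using b that by (auto simp: closed_simplex_def)
  show "realization_map f b (f v) = b v" if "v \<in> \<sigma>"
  proof -
    have "{u. b u \<noteq> 0 \<and> f u = f v} = (if b v = 0 then {} else {v})"
      using supp that assms(2) by (auto simp: inj_on_def)
    then show ?thesis by (simp add: realization_map_def)
  qed
  show "realization_map f b w = 0" if "w \<notin> f ` \<sigma>"
  proof -
    have "{u. b u \<noteq> 0 \<and> f u = w} = {}" using supp that by auto
    then show ?thesis by (simp only: realization_map_def sum.empty)
  qed
qed

lemma realization_map_closed_simplex:
  assumes "inj_on f \<sigma>" shows "realization_map f ` closed_simplex \<sigma> = closed_simplex (f ` \<sigma>)"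
proof
  show "realization_map f ` closed_simplex \<sigma> \<subseteq> closed_simplex (f ` \<sigma>)"
  proof
    fix c assume "c \<in> realization_map f ` closed_simplex \<sigma>"
    then obtain b where b: "b \<in> closed_simplex \<sigma>" "c = realization_map f b" by blast
    note r = realization_map_inj_on[OF b(1) assms, folded b(2)]
    have "sum c (f ` \<sigma>) = sum b \<sigma>" using r(1) assms by (simp add: sum.reindex)
    moreover have "0 \<le> c w" for w using r b(1) by (cases "w \<in> f ` \<sigma>") (auto simp: closed_simplex_def)
    ultimately show "c \<in> closed_simplex (f ` \<sigma>)" using b(1) r(2) by (auto simp: closed_simplex_def)
  qed
  show "closed_simplex (f ` \<sigma>) \<subseteq> realization_map f ` closed_simplex \<sigma>"
  proof
    fix c assume c: "c \<in> closed_simplex (f ` \<sigma>)"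
    define b where "b v = (if v \<in> \<sigma> then c (f v) else 0)" for v
    have "sum b \<sigma> = sum c (f ` \<sigma>)" using assms by (simp add: b_def sum.reindex)
    then have b: "b \<in> closed_simplex \<sigma>" using c by (auto simp: closed_simplex_def b_def)
    have "realization_map f b w = c w" for w
    proof (cases "w \<in> f ` \<sigma>")
      case True
      then show ?thesis using realization_map_inj_on(1)[OF b assms] by (auto simp: b_def)
    next
      case False
      then show ?thesis using realization_map_inj_on(2)[OF b assms False] c by (auto simp: closed_simplex_def)
    qed
    then show "c \<in> realization_map f ` closed_simplex \<sigma>" using b by (intro image_eqI[of _ _ b]) auto
  qed
qed

lemma realization_map_inj_on_closed_simplex:
  assumes "inj_on f \<sigma>" shows "inj_on (realization_map f) (closed_simplex \<sigma>)"
proof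
  fix b c assume b: "b \<in> closed_simplex \<sigma>" and c: "c \<in> closed_simplex \<sigma>" and "realization_map f b = realization_map f c"
  then have "b v = c v" if "v \<in> \<sigma>" for v
    using realization_map_inj_on(1)[OF b assms that] realization_map_inj_on(1)[OF c assms that] by simp
  moreover have "b v = c v" if "v \<notin> \<sigma>" for v using b c that by (force simp: closed_simplex_def)
  ultimately have "b v = c v" for v by blast
  then show "b = c" by blast
qed

lemma generated_complex_image: "(`) f ` generated_complex F = generated_complex ((`) f ` F)"
proof
  show "(`) f ` generated_complex F \<subseteq> generated_complex ((`) f ` F)"
    by (auto simp: generated_complex_def)
  show "generated_complex ((`) f ` F) \<subseteq> (`) f ` generated_complex F"
  proof
    fix \<sigma> assume "\<sigma> \<in> generated_complex ((`) f ` F)"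
    then obtain T where T: "\<sigma> \<noteq> {}" "T \<in> F" "\<sigma> \<subseteq> f ` T" by (auto simp: generated_complex_def)
    then have "\<sigma> = f ` {v \<in> T. f v \<in> \<sigma>}" by auto
    moreover from this T have "{v \<in> T. f v \<in> \<sigma>} \<in> generated_complex F" by (auto simp: generated_complex_def)
    ultimately show "\<sigma> \<in> (`) f ` generated_complex F" by blast
  qed
qed

text \<open>The realization of \<open>prism_q\<close> written out coordinatewise. In this form its
  continuity is evident and the comparison on the boundary becomes linear algebra.\<close>

definition prism_fold :: "(nat \<Rightarrow> real) \<Rightarrow> nat \<Rightarrow> real" where
  "prism_fold b w = (if w \<le> 3 then b w + b (w + 4) else if 8 \<le> w \<and> w \<le> 11 then b w else 0)"

lemma prism_facets_le: "T \<in> prism_facets \<Longrightarrow> T \<subseteq> {..11}"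
  unfolding prism_facets_def by (elim insertE emptyE; simp)

lemma realization_prism_le:
  assumes "b \<in> realization prism_complex" "11 < v" shows "b v = 0"
  using assms prism_facets_le by (fastforce simp: realization_def closed_simplex_def prism_complex_def generated_complex_def)

lemma realization_map_prism_q:
  assumes "\<And>v. 11 < v \<Longrightarrow> b v = 0" shows "realization_map prism_q b = prism_fold b"
proof
  fix w
  have "realization_map prism_q b w = (\<Sum>v\<in>{..11}. if prism_q v = w then b v else 0)"
    unfolding realization_map_def
    by (rule sum.mono_neutral_cong_left) (use assms in \<open>auto, meson not_le\<close>)
  also have "{..11::nat} = {0,1,2,3,4,5,6,7,8,9,10,11}" by (auto simp: le_Suc_eq numeral_eq_Suc)
  also have "(\<Sum>v\<in>{0,1,2,3,4,5,6,7,8,9,10,11}. if prism_q v = w then b v else 0) = prism_fold b w"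
  proof (cases "w \<in> {0,1,2,3,8,9,10,11}")
    case True
    then show ?thesis by (elim insertE emptyE; simp add: prism_q_def prism_fold_def)
  next
    case False
    then have "\<not> w \<le> 3" "\<not> (8 \<le> w \<and> w \<le> 11)" by (auto simp: le_Suc_eq numeral_eq_Suc)
    with False show ?thesis by (auto simp: prism_q_def prism_fold_def)
  qed
  finally show "realization_map prism_q b w = prism_fold b w" .
qed

lemma image_prism_q_facets: "(`) prism_q ` prism_facets = barnette_facets"
  by (simp add: prism_facets_def barnette_facets_def prism_q_def insert_commute)

lemma image_prism_q_complex: "(`) prism_q ` prism_complex = barnette_sphere"
  unfolding prism_complex_def barnette_sphere_def generated_complex_image image_prism_q_facets ..

lemma inj_on_prism_q: "\<sigma> \<in> prism_complex \<Longrightarrow> inj_on prism_q \<sigma>"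
proof -
  have "inj_on prism_q T" if "T \<in> prism_facets" for T
    using that unfolding prism_facets_def by (elim insertE emptyE; simp add: prism_q_def)
  then show "\<sigma> \<in> prism_complex \<Longrightarrow> inj_on prism_q \<sigma>"
    by (auto simp: prism_complex_def generated_complex_def intro: inj_on_subset)
qed

section \<open>The sides of the prism and the triangles of the band\<close>

definition prism_side_list :: "nat list list" where
  "prism_side_list = [[0,1,8], [0,6,8], [0,6,10], [5,6,10], [1,2,9], [1,4,9], [1,4,8], [4,6,8], [0,2,10], [2,5,10], [2,5,9], [4,5,9]]"

definition prism_rim_list :: "nat list list" where
  "prism_rim_list = [[1,8], [6,8], [2,9], [4,9], [0,10], [5,10]]"

abbreviation "prism_side \<equiv> realization (list_complex prism_side_list)"
abbreviation "prism_rim \<equiv> realization (list_complex prism_rim_list)"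

text \<open>The pairs \<open>p \<le> q \<le> p + 1\<close> with \<open>0 \<le> p + q \<le> 1\<close>, where \<open>(p, q)\<close> with \<open>p + q = 0\<close> is glued to \<open>(q, p + 1)\<close>,
  form the Moebius band.  The edge \<open>[0,8]\<close> lies on the seam; \<open>pL\<close> and \<open>qL\<close> use its position at \<open>p + q = 0\<close>, whereas
  \<open>pR\<close> and \<open>qR\<close> use the one at \<open>p + q = 1\<close>.\<close>

definition pR :: "(nat \<Rightarrow> real) \<Rightarrow> real" where
  "pR c = c 1 / 3 - c 2 / 3 + c 8 / 2 - c 9 / 6 + c 10 / 6"
definition qR :: "(nat \<Rightarrow> real) \<Rightarrow> real" where
  "qR c = c 0 + c 1 / 3 + 2 * c 2 / 3 + c 8 / 2 + 5 * c 9 / 6 + c 10 / 6"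
definition pL :: "(nat \<Rightarrow> real) \<Rightarrow> real" where
  "pL c = c 1 / 3 - c 2 / 3 - c 8 / 2 - c 9 / 6 + c 10 / 6"
definition qL :: "(nat \<Rightarrow> real) \<Rightarrow> real" where
  "qL c = c 1 / 3 + 2 * c 2 / 3 + c 8 / 2 + 5 * c 9 / 6 + c 10 / 6"

definition cis_pair :: "real \<Rightarrow> real \<Rightarrow> complex set" where
  "cis_pair p q = {cis (2 * pi * p), cis (2 * pi * q)}"

text \<open>The triangles without 1 and 9, namely \<open>[0,2,8]\<close> and
  \<open>[0,2,10]\<close>, are read off at the beginning of the strip, the other four at its
  end.\<close>

definition band_pair :: "(nat \<Rightarrow> real) \<Rightarrow> complex set" where
  "band_pair c = (if c 1 = 0 \<and> c 9 = 0 then cis_pair (pL c) (qL c) else cis_pair (pR c) (qR c))"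

lemma prism_map_cis_pair:
  "prism_map (p, p, q) = cis_pair p q" "prism_map (p, q, q) = cis_pair p q" "prism_map (q - 1, p, p) = cis_pair p q"
  "prism_map (q - 1, p, q) = cis_pair p q" "prism_map (p, q, p + 1) = cis_pair p q"
  by (auto simp: cis_pair_def)

text \<open>The two positions differ only in the weights of 0 and 8, so they agree where these
  vanish. Along the seam \<open>[0,8]\<close> they are related by the glide.\<close>

lemma cis_pair_seam:
  assumes "c 0 = 0 \<and> c 8 = 0 \<or> c 1 = 0 \<and> c 2 = 0 \<and> c 9 = 0 \<and> c 10 = 0 \<and> c 0 + c 8 = 1"
  shows "cis_pair (pR c) (qR c) = cis_pair (pL c) (qL c)"
  using assms
proof
  assume "c 0 = 0 \<and> c 8 = 0"
  then show ?thesis by (simp add: pR_def qR_def pL_def qL_def)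
next
  assume *: "c 1 = 0 \<and> c 2 = 0 \<and> c 9 = 0 \<and> c 10 = 0 \<and> c 0 + c 8 = 1"
  then have "c 0 = 1 - c 8" by linarith
  with * have "pR c = qL c" "qR c = pL c + 1" by (simp_all add: pR_def qR_def pL_def qL_def)
  then show ?thesis by (auto simp: cis_pair_def)
qed

text \<open>On each of the twelve triangles two of the three coordinates agree modulo 1, and the two
  remaining values are affine in the weights. The premise of \<open>R\<close> concerns the edges
  shared with triangles of the other kind, where \<open>cis_pair_seam\<close> applies.\<close>

lemma prism_map_side:
  assumes "b \<in> prism_side"
  shows "prism_map (prism_linear b) = band_pair (prism_fold b)"
proof -
  let ?c = "prism_fold b"
  have c: "?c 0 = b 0 + b 4" "?c 1 = b 1 + b 5" "?c 2 = b 2 + b 6" "?c 8 = b 8" "?c 9 = b 9" "?c 10 = b 10"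
    by (simp_all add: prism_fold_def)
  note d = pR_def[of ?c, unfolded c] qR_def[of ?c, unfolded c] pL_def[of ?c, unfolded c] qL_def[of ?c, unfolded c]
  have R: "band_pair ?c = cis_pair (pR ?c) (qR ?c)"
    if "?c 1 = 0 \<Longrightarrow> ?c 9 = 0 \<Longrightarrow> ?c 0 = 0 \<and> ?c 8 = 0 \<or> ?c 1 = 0 \<and> ?c 2 = 0 \<and> ?c 9 = 0 \<and> ?c 10 = 0 \<and> ?c 0 + ?c 8 = 1"
    using that cis_pair_seam by (auto simp: band_pair_def)
  have L: "band_pair ?c = cis_pair (pL ?c) (qL ?c)" if "?c 1 = 0" "?c 9 = 0"
    using that by (simp add: band_pair_def)
  obtain T where T: "T \<in> set prism_side_list" "\<And>v. 0 \<le> b v" "\<And>v. v \<notin> set T \<Longrightarrow> b v = 0" "sum b (set T) = 1"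
    using realization_list_cases[OF assms] by blast
  have T': "T \<in> {[0,1,8], [0,6,8], [0,6,10], [5,6,10], [1,2,9], [1,4,9], [1,4,8], [4,6,8], [0,2,10], [2,5,10], [2,5,9], [4,5,9]}"
    using T(1) by (simp add: prism_side_list_def)
  note z = T(3)[of 0] T(3)[of 1] T(3)[of 2] T(3)[of 3] T(3)[of 4] T(3)[of 5] T(3)[of 6] T(3)[of 7] T(3)[of 8]
    T(3)[of 9] T(3)[of 10] T(3)[of 11]
  from T' show ?thesis
  proof (elim insertE emptyE)
    assume TT: "T = [0,1,8]"
    have z: "b 2 = 0" "b 3 = 0" "b 4 = 0" "b 5 = 0" "b 6 = 0" "b 7 = 0" "b 9 = 0" "b 10 = 0" "b 11 = 0" using z unfolding TT by simp_all
    have s: "b 0 + b 1 + b 8 = 1" using T(4) unfolding TT by simp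
    have "prism_linear b = (qR ?c - 1, pR ?c, pR ?c)"
      unfolding prism_linear_def d z prod.inject using s by (intro conjI; argo)
    moreover have "band_pair ?c = cis_pair (pR ?c) (qR ?c)"
      by (rule R) (unfold c z, use s in simp_all)
    ultimately show ?thesis by (simp only: prism_map_cis_pair(3))
  next
    assume TT: "T = [0,6,8]"
    have z: "b 1 = 0" "b 2 = 0" "b 3 = 0" "b 4 = 0" "b 5 = 0" "b 7 = 0" "b 9 = 0" "b 10 = 0" "b 11 = 0" using z unfolding TT by simp_all
    have s: "b 0 + b 6 + b 8 = 1" using T(4) unfolding TT by simp
    have "prism_linear b = (pL ?c, qL ?c, qL ?c)"
      unfolding prism_linear_def d z prod.inject using s by (intro conjI; argo)
    moreover have "band_pair ?c = cis_pair (pL ?c) (qL ?c)"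
      by (rule L) (unfold c z, use s in simp_all)
    ultimately show ?thesis by (simp only: prism_map_cis_pair(2))
  next
    assume TT: "T = [0,6,10]"
    have z: "b 1 = 0" "b 2 = 0" "b 3 = 0" "b 4 = 0" "b 5 = 0" "b 7 = 0" "b 8 = 0" "b 9 = 0" "b 11 = 0" using z unfolding TT by simp_all
    have s: "b 0 + b 6 + b 10 = 1" using T(4) unfolding TT by simp
    have "prism_linear b = (pL ?c, qL ?c, qL ?c)"
      unfolding prism_linear_def d z prod.inject using s by (intro conjI; argo)
    moreover have "band_pair ?c = cis_pair (pL ?c) (qL ?c)"
      by (rule L) (unfold c z, use s in simp_all)
    ultimately show ?thesis by (simp only: prism_map_cis_pair(2))
  next
    assume TT: "T = [5,6,10]"
    have z: "b 0 = 0" "b 1 = 0" "b 2 = 0" "b 3 = 0" "b 4 = 0" "b 7 = 0" "b 8 = 0" "b 9 = 0" "b 11 = 0" using z unfolding TT by simp_all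
    have s: "b 5 + b 6 + b 10 = 1" using T(4) unfolding TT by simp
    have "prism_linear b = (pR ?c, qR ?c, qR ?c)"
      unfolding prism_linear_def d z prod.inject using s by (intro conjI; argo)
    moreover have "band_pair ?c = cis_pair (pR ?c) (qR ?c)"
      by (rule R) (unfold c z, use s in simp_all)
    ultimately show ?thesis by (simp only: prism_map_cis_pair(2))
  next
    assume TT: "T = [1,2,9]"
    have z: "b 0 = 0" "b 3 = 0" "b 4 = 0" "b 5 = 0" "b 6 = 0" "b 7 = 0" "b 8 = 0" "b 10 = 0" "b 11 = 0" using z unfolding TT by simp_all
    have s: "b 1 + b 2 + b 9 = 1" using T(4) unfolding TT by simp
    have "prism_linear b = (qR ?c - 1, pR ?c, qR ?c)"
      unfolding prism_linear_def d z prod.inject using s by (intro conjI; argo)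
    moreover have "band_pair ?c = cis_pair (pR ?c) (qR ?c)"
      by (rule R) (unfold c z, use s in simp_all)
    ultimately show ?thesis by (simp only: prism_map_cis_pair(4))
  next
    assume TT: "T = [1,4,9]"
    have z: "b 0 = 0" "b 2 = 0" "b 3 = 0" "b 5 = 0" "b 6 = 0" "b 7 = 0" "b 8 = 0" "b 10 = 0" "b 11 = 0" using z unfolding TT by simp_all
    have s: "b 1 + b 4 + b 9 = 1" using T(4) unfolding TT by simp
    have "prism_linear b = (qR ?c - 1, pR ?c, qR ?c)"
      unfolding prism_linear_def d z prod.inject using s by (intro conjI; argo)
    moreover have "band_pair ?c = cis_pair (pR ?c) (qR ?c)"
      by (rule R) (unfold c z, use s in simp_all)
    ultimately show ?thesis by (simp only: prism_map_cis_pair(4))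
  next
    assume TT: "T = [1,4,8]"
    have z: "b 0 = 0" "b 2 = 0" "b 3 = 0" "b 5 = 0" "b 6 = 0" "b 7 = 0" "b 9 = 0" "b 10 = 0" "b 11 = 0" using z unfolding TT by simp_all
    have s: "b 1 + b 4 + b 8 = 1" using T(4) unfolding TT by simp
    have "prism_linear b = (qR ?c - 1, pR ?c, qR ?c)"
      unfolding prism_linear_def d z prod.inject using s by (intro conjI; argo)
    moreover have "band_pair ?c = cis_pair (pR ?c) (qR ?c)"
      by (rule R) (unfold c z, use s in simp_all)
    ultimately show ?thesis by (simp only: prism_map_cis_pair(4))
  next
    assume TT: "T = [4,6,8]"
    have z: "b 0 = 0" "b 1 = 0" "b 2 = 0" "b 3 = 0" "b 5 = 0" "b 7 = 0" "b 9 = 0" "b 10 = 0" "b 11 = 0" using z unfolding TT by simp_all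
    have s: "b 4 + b 6 + b 8 = 1" using T(4) unfolding TT by simp
    have "prism_linear b = (pL ?c, qL ?c, pL ?c + 1)"
      unfolding prism_linear_def d z prod.inject using s by (intro conjI; argo)
    moreover have "band_pair ?c = cis_pair (pL ?c) (qL ?c)"
      by (rule L) (unfold c z, use s in simp_all)
    ultimately show ?thesis by (simp only: prism_map_cis_pair(5))
  next
    assume TT: "T = [0,2,10]"
    have z: "b 1 = 0" "b 3 = 0" "b 4 = 0" "b 5 = 0" "b 6 = 0" "b 7 = 0" "b 8 = 0" "b 9 = 0" "b 11 = 0" using z unfolding TT by simp_all
    have s: "b 0 + b 2 + b 10 = 1" using T(4) unfolding TT by simp
    have "prism_linear b = (pL ?c, pL ?c, qL ?c)"
      unfolding prism_linear_def d z prod.inject using s by (intro conjI; argo)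
    moreover have "band_pair ?c = cis_pair (pL ?c) (qL ?c)"
      by (rule L) (unfold c z, use s in simp_all)
    ultimately show ?thesis by (simp only: prism_map_cis_pair(1))
  next
    assume TT: "T = [2,5,10]"
    have z: "b 0 = 0" "b 1 = 0" "b 3 = 0" "b 4 = 0" "b 6 = 0" "b 7 = 0" "b 8 = 0" "b 9 = 0" "b 11 = 0" using z unfolding TT by simp_all
    have s: "b 2 + b 5 + b 10 = 1" using T(4) unfolding TT by simp
    have "prism_linear b = (pR ?c, pR ?c, qR ?c)"
      unfolding prism_linear_def d z prod.inject using s by (intro conjI; argo)
    moreover have "band_pair ?c = cis_pair (pR ?c) (qR ?c)"
      by (rule R) (unfold c z, use s in simp_all)
    ultimately show ?thesis by (simp only: prism_map_cis_pair(1))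
  next
    assume TT: "T = [2,5,9]"
    have z: "b 0 = 0" "b 1 = 0" "b 3 = 0" "b 4 = 0" "b 6 = 0" "b 7 = 0" "b 8 = 0" "b 10 = 0" "b 11 = 0" using z unfolding TT by simp_all
    have s: "b 2 + b 5 + b 9 = 1" using T(4) unfolding TT by simp
    have "prism_linear b = (pR ?c, pR ?c, qR ?c)"
      unfolding prism_linear_def d z prod.inject using s by (intro conjI; argo)
    moreover have "band_pair ?c = cis_pair (pR ?c) (qR ?c)"
      by (rule R) (unfold c z, use s in simp_all)
    ultimately show ?thesis by (simp only: prism_map_cis_pair(1))
  next
    assume TT: "T = [4,5,9]"
    have z: "b 0 = 0" "b 1 = 0" "b 2 = 0" "b 3 = 0" "b 6 = 0" "b 7 = 0" "b 8 = 0" "b 10 = 0" "b 11 = 0" using z unfolding TT by simp_all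
    have s: "b 4 + b 5 + b 9 = 1" using T(4) unfolding TT by simp
    have "prism_linear b = (pR ?c, pR ?c, qR ?c)"
      unfolding prism_linear_def d z prod.inject using s by (intro conjI; argo)
    moreover have "band_pair ?c = cis_pair (pR ?c) (qR ?c)"
      by (rule R) (unfold c z, use s in simp_all)
    ultimately show ?thesis by (simp only: prism_map_cis_pair(1))
  qed
qed

text \<open>The zero patterns are those of \<open>[0,1,8]\<close>, \<open>[0,1,9]\<close>,
  \<open>[1,2,9]\<close> and \<open>[1,2,10]\<close>. In the coordinates \<open>pR\<close> and
  \<open>qR\<close> these triangles lie side by side without overlap.\<close>

lemma band_cell_unique:
  fixes a0 a1 a2 a8 a9 a10 b0 b1 b2 b8 b9 b10 :: real
  assumes nn: "0 \<le> a0" "0 \<le> a1" "0 \<le> a2" "0 \<le> a8" "0 \<le> a9" "0 \<le> a10"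
    "0 \<le> b0" "0 \<le> b1" "0 \<le> b2" "0 \<le> b8" "0 \<le> b9" "0 \<le> b10"
    and s: "a0 + a1 + a2 + a8 + a9 + a10 = 1" "b0 + b1 + b2 + b8 + b9 + b10 = 1"
    and p: "a1 / 3 - a2 / 3 + a8 / 2 - a9 / 6 + a10 / 6 = b1 / 3 - b2 / 3 + b8 / 2 - b9 / 6 + b10 / 6"
    and q: "a0 + a1 / 3 + 2 * a2 / 3 + a8 / 2 + 5 * a9 / 6 + a10 / 6 = b0 + b1 / 3 + 2 * b2 / 3 + b8 / 2 + 5 * b9 / 6 + b10 / 6"
    and a: "a2 = 0 \<and> a9 = 0 \<and> a10 = 0 \<or> a2 = 0 \<and> a8 = 0 \<and> a10 = 0 \<or> a0 = 0 \<and> a8 = 0 \<and> a10 = 0 \<or> a0 = 0 \<and> a8 = 0 \<and> a9 = 0"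
    and b: "b2 = 0 \<and> b9 = 0 \<and> b10 = 0 \<or> b2 = 0 \<and> b8 = 0 \<and> b10 = 0 \<or> b0 = 0 \<and> b8 = 0 \<and> b10 = 0 \<or> b0 = 0 \<and> b8 = 0 \<and> b9 = 0"
  shows "a0 = b0 \<and> a1 = b1 \<and> a2 = b2 \<and> a8 = b8 \<and> a9 = b9 \<and> a10 = b10"
proof -
  have "a8 = b8" "a9 = b9" "a10 = b10"
    using a b by (elim disjE conjE; insert nn s p q; linarith)+
  moreover from this have "a0 = b0" "a1 = b1" "a2 = b2" using s p q by linarith+
  ultimately show ?thesis by blast
qed

definition band_list :: "nat list list" where
  "band_list = [[0,1,8], [0,2,8], [0,1,9], [1,2,9], [0,2,10], [1,2,10]]"

lemma band_complex_eq: "band_complex = list_complex band_list"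
  by (simp add: band_complex_def band_list_def)

lemma band_cases:
  assumes "c \<in> realization band_complex"
  shows "\<And>v. 0 \<le> c v" "v \<notin> {0,1,2,8,9,10} \<Longrightarrow> c v = 0" "c 0 + c 1 + c 2 + c 8 + c 9 + c 10 = 1"
    "c 2 = 0 \<and> c 9 = 0 \<and> c 10 = 0 \<or> c 1 = 0 \<and> c 9 = 0 \<and> c 10 = 0 \<or> c 2 = 0 \<and> c 8 = 0 \<and> c 10 = 0 \<or>
     c 0 = 0 \<and> c 8 = 0 \<and> c 10 = 0 \<or> c 1 = 0 \<and> c 8 = 0 \<and> c 9 = 0 \<or> c 0 = 0 \<and> c 8 = 0 \<and> c 9 = 0"
proof -
  obtain T where T: "T \<in> set band_list" "\<And>v. 0 \<le> c v" "\<And>v. v \<notin> set T \<Longrightarrow> c v = 0" "sum c (set T) = 1"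
    using realization_list_cases assms unfolding band_complex_eq by blast
  show "\<And>v. 0 \<le> c v" by (rule T(2))
  have sub: "set T \<subseteq> {0,1,2,8,9,10}" using T(1) by (auto simp: band_list_def)
  then show "v \<notin> {0,1,2,8,9,10} \<Longrightarrow> c v = 0" using T(3) by blast
  have "sum c (set T) = sum c {0,1,2,8,9,10}" using sub T(3) by (intro sum.mono_neutral_left) auto
  then show "c 0 + c 1 + c 2 + c 8 + c 9 + c 10 = 1" using T(4) by simp
  show "c 2 = 0 \<and> c 9 = 0 \<and> c 10 = 0 \<or> c 1 = 0 \<and> c 9 = 0 \<and> c 10 = 0 \<or> c 2 = 0 \<and> c 8 = 0 \<and> c 10 = 0 \<or>
     c 0 = 0 \<and> c 8 = 0 \<and> c 10 = 0 \<or> c 1 = 0 \<and> c 8 = 0 \<and> c 9 = 0 \<or> c 0 = 0 \<and> c 8 = 0 \<and> c 9 = 0"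
    using T(1) T(3)[of 0] T(3)[of 1] T(3)[of 2] T(3)[of 8] T(3)[of 9] T(3)[of 10]
    unfolding band_list_def by (simp, elim disjE; simp)
qed

text \<open>The chosen positions keep \<open>p + q\<close> at least 0 and below 1, one period of the
  glide, so equal pairs have equal positions. The value 1/3 divides the two triangles without 1 and
  9 from the other four, and within each group the position determines the weights.\<close>

lemma band_pair_inj:
  assumes a: "a \<in> realization band_complex" and b: "b \<in> realization band_complex" and eq: "band_pair a = band_pair b"
  shows "a = b"
proof -
  note A = band_cases[OF a] and B = band_cases[OF b]
  note nA = A(1)[of 0] A(1)[of 1] A(1)[of 2] A(1)[of 8] A(1)[of 9] A(1)[of 10]
  note nB = B(1)[of 0] B(1)[of 1] B(1)[of 2] B(1)[of 8] B(1)[of 9] B(1)[of 10]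
  define p where "p c = (if c 1 = 0 \<and> c 9 = 0 then pL c else pR c)" for c
  define q where "q c = (if c 1 = 0 \<and> c 9 = 0 then qL c else qR c)" for c
  have bp: "band_pair c = {cis (2 * pi * p c), cis (2 * pi * q c)}" for c
    by (simp add: band_pair_def p_def q_def cis_pair_def)
  have range: "p c \<le> q c \<and> q c \<le> p c + 1 \<and> (if c 1 = 0 \<and> c 9 = 0 then 0 \<le> p c + q c \<and> p c + q c \<le> 1/3
      else 1/3 < p c + q c \<and> p c + q c < 1)" if c: "c \<in> realization band_complex" for c
  proof -
    note C = band_cases[OF c]
    note nC = C(1)[of 0] C(1)[of 1] C(1)[of 2] C(1)[of 8] C(1)[of 9] C(1)[of 10]
    show ?thesis
    proof (cases "c 1 = 0 \<and> c 9 = 0")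
      case True
      then show ?thesis using C(3) nC by (simp add: p_def q_def pL_def qL_def)
    next
      case False
      then have "0 < c 1 + c 9" using nC by linarith
      then have "pR c \<le> qR c" "qR c \<le> pR c + 1" "1/3 < pR c + qR c" "pR c + qR c < 1"
        unfolding pR_def qR_def using C(3) nC by linarith+
      then show ?thesis using False by (auto simp: p_def q_def)
    qed
  qed
  note ra = range[OF a] and rb = range[OF b]
  obtain n :: int where "p b = p a + of_int n \<and> q b = q a + of_int n \<or> p b = q a + of_int n \<and> q b = p a + 1 + of_int n"
    using eq cis_pair_eq_iff[of "p a" "q a" "p b" "q b"] ra rb unfolding bp by blast
  then have pq: "p a = p b \<and> q a = q b"
  proof
    assume *: "p b = p a + of_int n \<and> q b = q a + of_int n"
    then have e: "p b + q b = p a + q a + 2 * of_int n" by simp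
    have "2 * real_of_int n < 2" "- 2 < 2 * real_of_int n" using ra rb e by (auto split: if_splits)
    then have "n = 0" by linarith
    then show ?thesis using * by simp
  next
    assume *: "p b = q a + of_int n \<and> q b = p a + 1 + of_int n"
    then have e: "p b + q b = p a + q a + 1 + 2 * of_int n" by simp
    have "1 + 2 * real_of_int n < 1" "- 1 < 1 + 2 * real_of_int n" using ra rb e by (auto split: if_splits)
    then have "n < 0 \<and> - 1 < n" by linarith
    then show ?thesis by simp
  qed
  have "a 0 = b 0 \<and> a 1 = b 1 \<and> a 2 = b 2 \<and> a 8 = b 8 \<and> a 9 = b 9 \<and> a 10 = b 10"
  proof (cases "a 1 = 0 \<and> a 9 = 0")
    case True
    then have b0: "b 1 = 0 \<and> b 9 = 0" using ra rb pq by (auto split: if_splits)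
    have p': "- a 2 / 3 - a 8 / 2 + a 10 / 6 = - b 2 / 3 - b 8 / 2 + b 10 / 6"
      and q': "2 * a 2 / 3 + a 8 / 2 + a 10 / 6 = 2 * b 2 / 3 + b 8 / 2 + b 10 / 6"
      using pq True b0 by (auto simp: p_def q_def pL_def qL_def)
    have "a 8 = 0 \<or> a 10 = 0" "b 8 = 0 \<or> b 10 = 0" using A(4) B(4) by blast+
    then have "a 8 = b 8" using nA nB p' q' by (elim disjE; linarith)
    with p' q' have "a 2 = b 2" "a 10 = b 10" by linarith+
    with \<open>a 8 = b 8\<close> show ?thesis using True b0 A(3) B(3) by simp
  next
    case False
    then have b0: "\<not> (b 1 = 0 \<and> b 9 = 0)" using ra rb pq by (auto split: if_splits)
    have pq': "pR a = pR b" "qR a = qR b" using pq False b0 by (auto simp: p_def q_def)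
    have "a 2 = 0 \<and> a 9 = 0 \<and> a 10 = 0 \<or> a 2 = 0 \<and> a 8 = 0 \<and> a 10 = 0 \<or> a 0 = 0 \<and> a 8 = 0 \<and> a 10 = 0 \<or> a 0 = 0 \<and> a 8 = 0 \<and> a 9 = 0"
      using A(4) False by blast
    moreover have "b 2 = 0 \<and> b 9 = 0 \<and> b 10 = 0 \<or> b 2 = 0 \<and> b 8 = 0 \<and> b 10 = 0 \<or> b 0 = 0 \<and> b 8 = 0 \<and> b 10 = 0 \<or> b 0 = 0 \<and> b 8 = 0 \<and> b 9 = 0"
      using B(4) b0 by blast
    ultimately show ?thesis
      using band_cell_unique[OF nA nB A(3) B(3) pq'[unfolded pR_def qR_def]] by blast
  qed
  then have "a v = b v" for v using A(2)[of v] B(2)[of v] by (cases "v \<in> {0,1,2,8,9,10}") auto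
  then show ?thesis by blast
qed

section \<open>The whole boundary: sides, rim and the two caps\<close>

lemma prism_boundary_cases:
  assumes "b \<in> prism_boundary"
  obtains T where "T \<in> set prism_boundary_list" "\<And>v. 0 \<le> b v" "\<And>v. v \<notin> set T \<Longrightarrow> b v = 0" "sum b (set T) = 1"
  using realization_list_cases[OF assms] by blast

lemma prism_boundary_sum:
  assumes "b \<in> prism_boundary"
  shows "\<And>v. 0 \<le> b v" "\<And>v. 10 < v \<Longrightarrow> b v = 0"
    "b 0 + b 1 + b 2 + b 3 + b 4 + b 5 + b 6 + b 7 + b 8 + b 9 + b 10 = 1"
proof -
  obtain T where T: "T \<in> set prism_boundary_list" "\<And>v. 0 \<le> b v" "\<And>v. v \<notin> set T \<Longrightarrow> b v = 0" "sum b (set T) = 1"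
    using prism_boundary_cases[OF assms] by blast
  show "\<And>v. 0 \<le> b v" by (rule T(2))
  have sub: "set T \<subseteq> {0,1,2,3,4,5,6,7,8,9,10}"
    using T(1) unfolding prism_boundary_list_def by (simp, elim disjE; simp)
  then show "b v = 0" if "10 < v" for v using T(3)[of v] that by fastforce
  have "sum b (set T) = sum b {0,1,2,3,4,5,6,7,8,9,10}" using sub T(3) by (intro sum.mono_neutral_left) auto
  then show "b 0 + b 1 + b 2 + b 3 + b 4 + b 5 + b 6 + b 7 + b 8 + b 9 + b 10 = 1" using T(4) by (simp add: add.assoc)
qed

lemma prism_linear_gaps:
  assumes "b \<in> prism_boundary" "prism_linear b = (x, y, z)"
  shows "y - x = b 1 + b 6 + b 8 + (b 3 + b 7) / 3" "z - y = b 2 + b 4 + b 9 + (b 3 + b 7) / 3"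
    "x + 1 - z = b 0 + b 5 + b 10 + (b 3 + b 7) / 3" "x + y + z = b 4 + b 5 + b 6 + b 7 + (b 8 + b 9 + b 10) / 2"
proof -
  have "b 11 = 0" using prism_boundary_sum(2)[OF assms(1)] by simp
  then show "y - x = b 1 + b 6 + b 8 + (b 3 + b 7) / 3" "z - y = b 2 + b 4 + b 9 + (b 3 + b 7) / 3"
    "x + 1 - z = b 0 + b 5 + b 10 + (b 3 + b 7) / 3" "x + y + z = b 4 + b 5 + b 6 + b 7 + (b 8 + b 9 + b 10) / 2"
    using assms(2) prism_boundary_sum(3)[OF assms(1)] unfolding prism_linear_def prod.inject by argo+
qed

text \<open>Once the vertices of weight 0 are dropped, what is left of any facet of \<open>F\<close>
  lies in a facet of \<open>H\<close>; this containment is a finite check.\<close>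

lemma realization_restrict_list:
  assumes b: "b \<in> realization (list_complex F)" and z: "\<And>v. v \<in> set G \<Longrightarrow> b v = 0"
    and chk: "list_all (\<lambda>T. list_ex (list_subset (filter (\<lambda>v. list_all (\<lambda>g. v \<noteq> g) G) T)) H) F"
  shows "b \<in> realization (list_complex H)"
proof -
  obtain T where T: "T \<in> set F" "\<And>v. 0 \<le> b v" "\<And>v. v \<notin> set T \<Longrightarrow> b v = 0" "sum b (set T) = 1"
    using realization_list_cases[OF b] by blast
  obtain U where U: "U \<in> set H" "{v \<in> set T. v \<notin> set G} \<subseteq> set U"
    using chk T(1) unfolding list_all_iff list_ex_iff list_subset_iff by fastforce
  have 0: "b v = 0" if "v \<notin> set U" for v using U(2) T(3) z that by blast
  have "sum b (set T) = sum b (set T \<union> set U)" using T(3) by (intro sum.mono_neutral_left) auto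
  also have "\<dots> = sum b (set U)" using 0 by (intro sum.mono_neutral_right) auto
  finally show ?thesis using realization_listI[of U H b] U(1) T 0 by simp
qed

text \<open>The boundary vertices at which \<open>y - x\<close>, \<open>z - y\<close> and \<open>x + 1 - z\<close>, respectively, are positive.\<close>

definition prism_groups :: "nat list list" where
  "prism_groups = [[1,6,8,3,7], [2,4,9,3,7], [0,5,10,3,7]]"

definition prism_rim_groups :: "nat list list" where
  "prism_rim_groups = [[1,6,8,2,4,9,3,7], [1,6,8,0,5,10,3,7], [2,4,9,0,5,10,3,7]]"

lemma prism_side_check:
  "list_all (\<lambda>G. list_all (\<lambda>T. list_ex (list_subset (filter (\<lambda>v. list_all (\<lambda>g. v \<noteq> g) G) T)) prism_side_list) prism_boundary_list) prism_groups"
  by code_simp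

lemma prism_rim_check:
  "list_all (\<lambda>G. list_all (\<lambda>T. list_ex (list_subset (filter (\<lambda>v. list_all (\<lambda>g. v \<noteq> g) G) T)) prism_rim_list) prism_boundary_list)
     prism_rim_groups"
  by code_simp

lemma prism_side_subset: "prism_side \<subseteq> prism_boundary"
  by (rule realization_mono_list) code_simp

lemma prism_rim_subset: "prism_rim \<subseteq> prism_side"
  by (rule realization_mono_list) code_simp

definition list_disjoint :: "'v list \<Rightarrow> 'v list \<Rightarrow> bool" where
  "list_disjoint xs ys = list_all (\<lambda>x. list_all (\<lambda>y. x \<noteq> y) ys) xs"

lemma realization_list_zeros:
  assumes "b \<in> realization (list_complex F)" "list_all (\<lambda>T. list_ex (\<lambda>G. list_disjoint G T) Gs) F"
  shows "\<exists>G\<in>set Gs. \<forall>v\<in>set G. b v = 0"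
proof -
  obtain T where T: "T \<in> set F" "\<And>v. 0 \<le> b v" "\<And>v. v \<notin> set T \<Longrightarrow> b v = 0" "sum b (set T) = 1"
    using realization_list_cases[OF assms(1)] by blast
  have "list_ex (\<lambda>G. list_disjoint G T) Gs" using assms(2) T(1) by (simp add: list_all_iff)
  then obtain G where G: "G \<in> set Gs" "list_disjoint G T" by (auto simp: list_ex_iff)
  then have "v \<notin> set T" if "v \<in> set G" for v using that by (auto simp: list_disjoint_def list_all_iff)
  then show ?thesis using T(3) G(1) by blast
qed

lemma prism_side_groups: "list_all (\<lambda>T. list_ex (\<lambda>G. list_disjoint G T) prism_groups) prism_side_list"
  by code_simp

lemma prism_rim_groups: "list_all (\<lambda>T. list_ex (\<lambda>G. list_disjoint G T) prism_rim_groups) prism_rim_list"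
  by code_simp

lemma prism_side_zero:
  assumes "b \<in> prism_side" shows "\<exists>G\<in>set prism_groups. \<forall>v\<in>set G. b v = 0"
  using realization_list_zeros[OF assms prism_side_groups] .

lemma prism_rim_zero:
  assumes "b \<in> prism_rim" shows "\<exists>G\<in>set prism_rim_groups. \<forall>v\<in>set G. b v = 0"
  using realization_list_zeros[OF assms prism_rim_groups] .

lemma weighted_sum_eq_0_iff:
  fixes a b c d e :: real
  assumes "0 \<le> a" "0 \<le> b" "0 \<le> c" "0 \<le> d" "0 \<le> e"
  shows "a + b + c + (d + e) / 3 = 0 \<longleftrightarrow> a = 0 \<and> b = 0 \<and> c = 0 \<and> d = 0 \<and> e = 0"
proof
  assume *: "a + b + c + (d + e) / 3 = 0"
  then have "a = 0" "b = 0" "c = 0" "d = 0" "e = 0" using assms by argo+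
  then show "a = 0 \<and> b = 0 \<and> c = 0 \<and> d = 0 \<and> e = 0" by blast
qed simp

text \<open>Each gap is a positive combination of the weights in one group of vertices, so it is 0
  exactly when the group carries no weight. Which facets remain without one group, or without two,
  is a finite check.\<close>

lemma prism_linear_degenerate_iff:
  assumes b: "b \<in> prism_boundary" and xyz: "prism_linear b = (x, y, z)"
  shows "x = y \<or> y = z \<or> z = x + 1 \<longleftrightarrow> b \<in> prism_side"
    "x = y \<and> y = z \<or> x = y \<and> z = x + 1 \<or> y = z \<and> z = x + 1 \<longleftrightarrow> b \<in> prism_rim"
proof -
  note g = prism_linear_gaps[OF b xyz]
  note nn = prism_boundary_sum(1)[OF b]
  note nns = nn[of 0] nn[of 1] nn[of 2] nn[of 3] nn[of 4] nn[of 5] nn[of 6] nn[of 7] nn[of 8] nn[of 9] nn[of 10]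
  have xy: "x = y \<longleftrightarrow> (\<forall>v\<in>set [1,6,8,3,7]. b v = 0)"
    using g(1) weighted_sum_eq_0_iff[of "b 1" "b 6" "b 8" "b 3" "b 7"] nns by auto
  have yz: "y = z \<longleftrightarrow> (\<forall>v\<in>set [2,4,9,3,7]. b v = 0)"
    using g(2) weighted_sum_eq_0_iff[of "b 2" "b 4" "b 9" "b 3" "b 7"] nns by auto
  have zx: "z = x + 1 \<longleftrightarrow> (\<forall>v\<in>set [0,5,10,3,7]. b v = 0)"
    using g(3) weighted_sum_eq_0_iff[of "b 0" "b 5" "b 10" "b 3" "b 7"] nns by auto
  have side: "b \<in> prism_side" if "G \<in> set prism_groups" "\<forall>v\<in>set G. b v = 0" for G
  proof (rule realization_restrict_list[OF b])
    show "b v = 0" if "v \<in> set G" for v using that \<open>\<forall>v\<in>set G. b v = 0\<close> by blast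
    show "list_all (\<lambda>T. list_ex (list_subset (filter (\<lambda>v. list_all (\<lambda>g. v \<noteq> g) G) T)) prism_side_list) prism_boundary_list"
      using prism_side_check[unfolded list_all_iff[of _ prism_groups]] that(1) by (rule bspec)
  qed
  have rim: "b \<in> prism_rim" if "G \<in> set prism_rim_groups" "\<forall>v\<in>set G. b v = 0" for G
  proof (rule realization_restrict_list[OF b])
    show "b v = 0" if "v \<in> set G" for v using that \<open>\<forall>v\<in>set G. b v = 0\<close> by blast
    show "list_all (\<lambda>T. list_ex (list_subset (filter (\<lambda>v. list_all (\<lambda>g. v \<noteq> g) G) T)) prism_rim_list) prism_boundary_list"
      using prism_rim_check[unfolded list_all_iff[of _ prism_rim_groups]] that(1) by (rule bspec)
  qed
  have "x = y \<or> y = z \<or> z = x + 1 \<longleftrightarrow> (\<exists>G\<in>set prism_groups. \<forall>v\<in>set G. b v = 0)"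
    unfolding xy yz zx by (simp add: prism_groups_def)
  then show "x = y \<or> y = z \<or> z = x + 1 \<longleftrightarrow> b \<in> prism_side"
    using side prism_side_zero by metis
  have "x = y \<and> y = z \<or> x = y \<and> z = x + 1 \<or> y = z \<and> z = x + 1 \<longleftrightarrow> (\<exists>G\<in>set prism_rim_groups. \<forall>v\<in>set G. b v = 0)"
    unfolding xy yz zx by (auto simp: prism_rim_groups_def)
  then show "x = y \<and> y = z \<or> x = y \<and> z = x + 1 \<or> y = z \<and> z = x + 1 \<longleftrightarrow> b \<in> prism_rim"
    using rim prism_rim_zero by metis
qed

text \<open>The position in the bottom face of a folded point. The screw motion takes the vertices
  0, 1, 2, 3 to 4, 5, 6, 7, so a point of the top face is represented here as well.\<close>

definition cap_triple :: "(nat \<Rightarrow> real) \<Rightarrow> real \<times> real \<times> real" where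
  "cap_triple c = (- 2/3 * c 1 - 1/3 * c 2 - 1/3 * c 3, 1/3 * c 1 - 1/3 * c 2, 1/3 * c 1 + 2/3 * c 2 + 1/3 * c 3)"

lemma prism_cap:
  assumes b: "b \<in> prism_boundary" "b \<notin> prism_side"
  shows "prism_map (prism_linear b) = prism_map (cap_triple (prism_fold b))" "prism_fold b 3 > 0"
    "prism_fold b 0 + prism_fold b 1 + prism_fold b 2 + prism_fold b 3 = 1"
    "prism_fold b 0 = 0 \<or> prism_fold b 1 = 0 \<or> prism_fold b 2 = 0" "4 \<le> v \<Longrightarrow> prism_fold b v = 0"
    "0 \<le> prism_fold b v"
proof -
  obtain T where T: "T \<in> set prism_boundary_list" "\<And>v. 0 \<le> b v" "\<And>v. v \<notin> set T \<Longrightarrow> b v = 0" "sum b (set T) = 1"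
    using prism_boundary_cases[OF b(1)] by blast
  have "T \<notin> set prism_side_list" using b(2) realization_listI[of T prism_side_list b] T by blast
  then have T': "T \<in> {[0,1,3], [0,2,3], [1,2,3]} \<or> T \<in> {[4,5,7], [4,6,7], [5,6,7]}"
    using T(1) unfolding prism_boundary_list_def prism_side_list_def by auto
  have le7: "set T \<subseteq> {..7}" using T' by auto
  have z: "b v = 0" if "7 < v" for v using T(3)[of v] le7 that by fastforce
  have fold: "prism_fold b 0 = b 0 + b 4" "prism_fold b 1 = b 1 + b 5" "prism_fold b 2 = b 2 + b 6" "prism_fold b 3 = b 3 + b 7"
    by (simp_all add: prism_fold_def)
  have "\<not> (b 3 = 0 \<and> b 7 = 0)"
  proof
    assume *: "b 3 = 0 \<and> b 7 = 0"
    obtain x y zz where xyz: "prism_linear b = (x, y, zz)" by (cases "prism_linear b") auto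
    have "x = y \<or> y = zz \<or> zz = x + 1"
      using prism_linear_gaps[OF b(1) xyz] * T' T(3)[of 0] T(3)[of 1] T(3)[of 2] T(3)[of 4] T(3)[of 5] T(3)[of 6] z[of 8] z[of 9] z[of 10]
      by auto
    then show False using prism_linear_degenerate_iff(1)[OF b(1) xyz] b(2) by simp
  qed
  then show "prism_fold b 3 > 0" using T(2)[of 3] T(2)[of 7] unfolding fold by linarith
  show "prism_fold b v = 0" if "4 \<le> v" for v using that z[of v] by (simp add: prism_fold_def)
  show "0 \<le> prism_fold b v" using T(2) by (simp add: prism_fold_def)
  show "prism_fold b 0 + prism_fold b 1 + prism_fold b 2 + prism_fold b 3 = 1"
    using prism_boundary_sum(3)[OF b(1)] z unfolding fold by simp
  show "prism_fold b 0 = 0 \<or> prism_fold b 1 = 0 \<or> prism_fold b 2 = 0"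
    using T' T(3)[of 0] T(3)[of 1] T(3)[of 2] T(3)[of 4] T(3)[of 5] T(3)[of 6] unfolding fold by auto
  obtain x y w where cap: "cap_triple (prism_fold b) = (x, y, w)" by (cases "cap_triple (prism_fold b)") auto
  from T' show "prism_map (prism_linear b) = prism_map (cap_triple (prism_fold b))"
  proof
    assume "T \<in> {[0,1,3], [0,2,3], [1,2,3]}"
    then have "b 4 = 0 \<and> b 5 = 0 \<and> b 6 = 0 \<and> b 7 = 0" using T(3) by auto
    then have "prism_linear b = cap_triple (prism_fold b)" using z unfolding prism_linear_def cap_triple_def fold by simp
    then show ?thesis by simp
  next
    assume "T \<in> {[4,5,7], [4,6,7], [5,6,7]}"
    then have b0: "b 0 = 0 \<and> b 1 = 0 \<and> b 2 = 0 \<and> b 3 = 0" using T(3) by auto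
    have "b 4 = 1 - b 5 - b 6 - b 7" using prism_boundary_sum(3)[OF b(1)] z[of 8] z[of 9] z[of 10] b0 by simp
    then have "prism_linear b = (y, w, x + 1)"
      using cap b0 z[of 8] z[of 9] z[of 10] z[of 11] unfolding prism_linear_def cap_triple_def fold by auto
    then show ?thesis using prism_map_shift(2)[of y w x] cap by simp
  qed
qed

lemma prism_fold_side:
  assumes "b \<in> prism_side" shows "prism_fold b \<in> realization band_complex" "prism_fold b 3 = 0"
proof -
  obtain T where T: "T \<in> set prism_side_list" "\<And>v. 0 \<le> b v" "\<And>v. v \<notin> set T \<Longrightarrow> b v = 0" "sum b (set T) = 1"
    using realization_list_cases[OF assms] by blast
  have inj: "inj_on prism_q (set T)" and T': "prism_q ` set T \<in> band_complex"
    using T(1) unfolding prism_side_list_def band_complex_def generated_complex_def by (simp, elim disjE; simp add: prism_q_def)+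
  have "b \<in> closed_simplex (set T)" using T by (auto simp: closed_simplex_def)
  then have "realization_map prism_q b \<in> closed_simplex (prism_q ` set T)"
    using realization_map_closed_simplex[OF inj] by blast
  moreover have "realization_map prism_q b = prism_fold b"
    using prism_boundary_sum(2)[OF subsetD[OF prism_side_subset assms]] by (intro realization_map_prism_q) simp
  ultimately show "prism_fold b \<in> realization band_complex" using T' by (auto simp: realization_def)
  show "prism_fold b 3 = 0" using prism_side_zero[OF assms] by (auto simp: prism_fold_def prism_groups_def)
qed

text \<open>For one point on the sides and one off them both equations fail: the folded weight of 3
  is 0 only on the sides, and only there are the triples degenerate. Two points of the sides are
  compared in the band, two points of the caps in the bottom face.\<close>

lemma prism_fold_eq_boundary:
  assumes a: "a \<in> prism_boundary" and b: "b \<in> prism_boundary"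
  shows "prism_map (prism_linear a) = prism_map (prism_linear b) \<longleftrightarrow> prism_fold a = prism_fold b"
proof -
  have cyc: "prism_linear c \<in> cyclic_triples" if "c \<in> prism_boundary" for c
    using bij_betw_prism_homeo prism_boundary_subset prism_homeo_boundary[OF that] prism_subset_cyclic_triples that
    by (metis bij_betwE subsetD)
  obtain x y z x' y' z' where xyz: "prism_linear a = (x, y, z)" "prism_linear b = (x', y', z')"
    by (cases "prism_linear a"; cases "prism_linear b") auto
  consider "a \<in> prism_side" "b \<in> prism_side" | "a \<notin> prism_side" "b \<notin> prism_side"
    | "a \<in> prism_side \<longleftrightarrow> b \<notin> prism_side" by blast
  then show ?thesis
  proof cases
    case 1
    then show ?thesis using prism_map_side band_pair_inj prism_fold_side(1) by metis
  next
    case 3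
    then have "prism_fold a 3 \<noteq> prism_fold b 3"
      using prism_fold_side(2) prism_cap(2) a b by (metis less_irrefl)
    moreover have "prism_map (prism_linear a) \<noteq> prism_map (prism_linear b)"
    proof
      assume e: "prism_map (prism_linear a) = prism_map (prism_linear b)"
      have "x = y \<or> y = z \<or> z = x + 1 \<longleftrightarrow> x' = y' \<or> y' = z' \<or> z' = x' + 1"
        using prism_map_eq_degenerate[of x y z x' y' z'] prism_map_eq_degenerate[of x' y' z' x y z] e cyc[OF a] cyc[OF b]
        unfolding xyz by blast
      then show False using prism_linear_degenerate_iff(1)[OF a xyz(1)] prism_linear_degenerate_iff(1)[OF b xyz(2)] 3 by blast
    qed
    ultimately show ?thesis by auto
  next
    case 2
    note A = prism_cap[OF a 2(1)] and B = prism_cap[OF b 2(2)]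
    define c d where "c = prism_fold a" and "d = prism_fold b"
    note A = A[folded c_def] and B = B[folded d_def]
    note nA = A(6)[of 0] A(6)[of 1] A(6)[of 2] and nB = B(6)[of 0] B(6)[of 1] B(6)[of 2]
    have "c = d" if e: "prism_map (cap_triple c) = prism_map (cap_triple d)"
    proof -
      obtain u v w u' v' w' where t: "cap_triple c = (u, v, w)" "cap_triple d = (u', v', w')"
        by (cases "cap_triple c"; cases "cap_triple d") auto
      have g: "v - u = c 1 + c 3 / 3" "w - v = c 2 + c 3 / 3" "u + 1 - w = c 0 + c 3 / 3" "u + v + w = 0"
        using t(1) A(3) unfolding cap_triple_def prod.inject by argo+
      have g': "v' - u' = d 1 + d 3 / 3" "w' - v' = d 2 + d 3 / 3" "u' + 1 - w' = d 0 + d 3 / 3" "u' + v' + w' = 0"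
        using t(2) B(3) unfolding cap_triple_def prod.inject by argo+
      have lt: "u < v" "v < w" "w < u + 1" using g A(2) nA by linarith+
      have "u' \<le> v'" "v' \<le> w'" "w' \<le> u' + 1" using g' B(2) nB by linarith+
      then have "(u', v', w') \<in> cyclic_triples" by (simp add: cyclic_triples_def)
      from prism_map_eq_strict[OF lt this e[unfolded t]] obtain n :: int where
        n: "(u', v', w') = (u + of_int n, v + of_int n, w + of_int n) \<or>
          (u', v', w') = (v + of_int n, w + of_int n, u + 1 + of_int n) \<or>
          (u', v', w') = (w + of_int n, u + 1 + of_int n, v + 1 + of_int n)" by blast
      \<comment> \<open>Both triples have coordinate sum 0, whereas a nontrivial power of the screw
        motion would change it.\<close>
      have "real_of_int (3 * n) = 0 \<or> real_of_int (3 * n + 1) = 0 \<or> real_of_int (3 * n + 2) = 0"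
        using n g(4) g'(4) by auto
      then have "3 * n = 0 \<or> 3 * n + 1 = 0 \<or> 3 * n + 2 = 0" by (simp only: of_int_eq_0_iff)
      then have "n = 0" by presburger
      moreover from this have "u' + v' + w' = 1 \<or> u' + v' + w' = 2 \<or> (u', v', w') = (u, v, w)"
        using n g(4) by auto
      ultimately have eq: "(u', v', w') = (u, v, w)" using g'(4) by simp
      have gg: "c 1 + c 3 / 3 = d 1 + d 3 / 3" "c 2 + c 3 / 3 = d 2 + d 3 / 3" "c 0 + c 3 / 3 = d 0 + d 3 / 3"
        using g g' eq by simp_all
      \<comment> \<open>One of the weights of 0, 1, 2 vanishes, so a third of the weight of 3 is the
        smallest of the three gaps.\<close>
      have "c 3 = d 3" using A(4) B(4) gg nA nB by (elim disjE; linarith)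
      then have "c v = d v" for v
        using gg A(5)[of v] B(5)[of v] by (cases "4 \<le> v") (auto simp: not_le less_Suc_eq numeral_eq_Suc)
      then show "c = d" by blast
    qed
    then show ?thesis unfolding A(1) B(1) c_def[symmetric] d_def[symmetric] by auto
  qed
qed

text \<open>A simplex outside the boundary is determined by its image under \<open>prism_q\<close>.\<close>

lemma prism_interior_check:
  "list_all (\<lambda>F. list_all (\<lambda>S. if list_ex (list_subset S) prism_boundary_list then True else
     list_all (\<lambda>F'. let S' = filter (\<lambda>v. list_ex (\<lambda>w. prism_q v = prism_q w) S) F' in
       if list_subset (map prism_q S) (map prism_q S') then list_subset S S' \<and> list_subset S' S else True)
     prism_facet_list) (subseqs F)) prism_facet_list"
  by code_simp

text \<open>\<open>S\<close> is the support of \<open>a\<close>, and \<open>S'\<close> consists of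
  the vertices of a facet around \<open>b\<close> that lie over the image of \<open>S\<close>. Equal
  images make \<open>S'\<close> cover that image, so the finite check gives \<open>S = S'\<close>;
  injectivity of \<open>prism_q\<close> on facets then gives equal weights.\<close>

lemma prism_fold_eq_interior:
  assumes a: "a \<in> realization prism_complex" "a \<notin> prism_boundary" and b: "b \<in> realization prism_complex"
    and eq: "realization_map prism_q a = realization_map prism_q b"
  shows "a = b"
proof -
  obtain F where F: "F \<in> set prism_facet_list" "\<And>v. 0 \<le> a v" "\<And>v. v \<notin> set F \<Longrightarrow> a v = 0" "sum a (set F) = 1"
    using realization_list_cases a(1) unfolding prism_complex_eq by blast
  obtain F' where F': "F' \<in> set prism_facet_list" "\<And>v. 0 \<le> b v" "\<And>v. v \<notin> set F' \<Longrightarrow> b v = 0" "sum b (set F') = 1"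
    using realization_list_cases b unfolding prism_complex_eq by blast
  have aF: "a \<in> closed_simplex (set F)" and bF: "b \<in> closed_simplex (set F')"
    using F F' by (auto simp: closed_simplex_def)
  have "F \<noteq> []" "F' \<noteq> []" using F(4) F'(4) by auto
  then have inj: "inj_on prism_q (set F)" "inj_on prism_q (set F')"
    using F(1) F'(1) by (intro inj_on_prism_q; auto simp: prism_complex_eq generated_complex_def)+
  note ra = realization_map_inj_on[OF aF inj(1)] and rb = realization_map_inj_on[OF bF inj(2)]
  have "{v. a v \<noteq> 0} \<in> Pow (set F)" using F(3) by auto
  then have "{v. a v \<noteq> 0} \<in> set ` set (subseqs F)" by (simp only: subseqs_powset)
  then obtain S where S: "S \<in> set (subseqs F)" "set S = {v. a v \<noteq> 0}" by auto
  have nb: "\<not> list_ex (list_subset S) prism_boundary_list"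
  proof
    assume "list_ex (list_subset S) prism_boundary_list"
    then obtain T where T: "T \<in> set prism_boundary_list" "set S \<subseteq> set T" by (auto simp: list_ex_iff list_subset_iff)
    have "sum a (set F) = sum a (set S)" using S(2) F(3) by (intro sum.mono_neutral_right) auto
    also have "\<dots> = sum a (set T)" using S(2) T(2) by (intro sum.mono_neutral_left) auto
    finally have "a \<in> prism_boundary" using T S(2) F by (intro realization_listI[OF T(1)]) auto
    then show False using a(2) by simp
  qed
  define S' where "S' = filter (\<lambda>v. list_ex (\<lambda>w. prism_q v = prism_q w) S) F'"
  have chk: "if list_subset (map prism_q S) (map prism_q S') then list_subset S S' \<and> list_subset S' S else True"
    using prism_interior_check F(1) F'(1) S(1) nb unfolding list_all_iff Let_def S'_def by (metis (no_types, lifting))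
  have "prism_q ` set S \<subseteq> prism_q ` set S'"
  proof
    fix w assume "w \<in> prism_q ` set S"
    then obtain v where v: "v \<in> set S" "w = prism_q v" by blast
    then have "v \<in> set F" "a v \<noteq> 0" using S(2) F(3) by auto
    then have "realization_map prism_q b w \<noteq> 0" using ra(1) eq v by metis
    then obtain u where "u \<in> set F'" "w = prism_q u" using rb(2) by blast
    moreover from this have "u \<in> set S'" using v by (auto simp: S'_def list_ex_iff intro!: bexI[of _ v])
    ultimately show "w \<in> prism_q ` set S'" by blast
  qed
  then have SS: "set S = set S'" using chk by (auto simp: list_subset_iff)
  have "a v = b v" for v
  proof (cases "v \<in> set S")
    case True
    then have "v \<in> set F" "v \<in> set F'" using SS S F(3) by (auto simp: S'_def)
    then show ?thesis using ra(1) rb(1) eq by metis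
  next
    case False
    then have "a v = 0" using S(2) by auto
    moreover have "b v = 0"
    proof (rule ccontr)
      assume nz: "b v \<noteq> 0"
      then have v: "v \<in> set F'" using F'(3) by blast
      then have "realization_map prism_q a (prism_q v) \<noteq> 0" using rb(1) eq nz by metis
      then obtain u where "u \<in> set F" "prism_q v = prism_q u" using ra(2) by blast
      moreover from this have "a u \<noteq> 0" using ra(1) \<open>realization_map prism_q a (prism_q v) \<noteq> 0\<close> by metis
      ultimately have "v \<in> set S'" using v S(2) by (auto simp: S'_def list_ex_iff)
      then show False using False SS by simp
    qed
    ultimately show ?thesis by simp
  qed
  then show ?thesis by blast
qed

lemma prism_homeo_in: "b \<in> realization prism_complex \<Longrightarrow> prism_homeo b \<in> prism"
  using bij_betw_prism_homeo by (auto simp: bij_betw_def)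

text \<open>The coordinate sum at \<open>a\<close> is strictly between 0 and 1, so it differs from
  the one at \<open>b\<close> by less than 1, which rules out every nontrivial power of the screw
  motion.\<close>

lemma prism_map_eq_interior:
  assumes a: "a \<in> realization prism_complex" "a \<notin> prism_boundary" and b: "b \<in> realization prism_complex"
    and eq: "prism_map (prism_homeo a) = prism_map (prism_homeo b)"
  shows "a = b"
proof -
  obtain x y z x' y' z' where xyz: "prism_homeo a = (x, y, z)" "prism_homeo b = (x', y', z')"
    by (cases "prism_homeo a"; cases "prism_homeo b") auto
  have i: "x < y" "y < z" "z < x + 1" "0 < x + y + z" "x + y + z < 1"
    using prism_homeo_interior[OF a xyz(1)] by auto
  have j: "0 \<le> x' + y' + z'" "x' + y' + z' \<le> 1" "(x', y', z') \<in> cyclic_triples"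
    using prism_homeo_in[OF b] prism_subset_cyclic_triples unfolding xyz by (auto simp: prism_def)
  obtain n :: int where
    n: "(x', y', z') = (x + of_int n, y + of_int n, z + of_int n) \<or>
      (x', y', z') = (y + of_int n, z + of_int n, x + 1 + of_int n) \<or>
      (x', y', z') = (z + of_int n, x + 1 + of_int n, y + 1 + of_int n)"
    using prism_map_eq_strict[OF i(1-3) j(3) eq[unfolded xyz]] by blast
  then have "x' + y' + z' = x + y + z + of_int (3 * n) \<and> (x', y', z') = (x + of_int n, y + of_int n, z + of_int n) \<or>
      x' + y' + z' = x + y + z + of_int (3 * n + 1) \<or> x' + y' + z' = x + y + z + of_int (3 * n + 2)" by auto
  moreover have "m = 0" if "x' + y' + z' = x + y + z + of_int m" for m :: int
  proof -
    have "real_of_int m < 1" "- 1 < real_of_int m" using that i j by linarith+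
    then show ?thesis by linarith
  qed
  ultimately have "3 * n = 0 \<and> (x', y', z') = (x + of_int n, y + of_int n, z + of_int n) \<or> 3 * n + 1 = 0 \<or> 3 * n + 2 = 0" by blast
  moreover have "3 * n + 1 \<noteq> 0" "3 * n + 2 \<noteq> 0" by presburger+
  ultimately have "n = 0 \<and> (x', y', z') = (x + of_int n, y + of_int n, z + of_int n)" by simp
  then have "prism_homeo a = prism_homeo b" by (simp add: xyz)
  then show ?thesis using bij_betw_prism_homeo a(1) b by (auto simp: bij_betw_def inj_on_def)
qed

lemma prism_map_homeo_eq_iff:
  assumes a: "a \<in> realization prism_complex" and b: "b \<in> realization prism_complex"
  shows "prism_map (prism_homeo a) = prism_map (prism_homeo b) \<longleftrightarrow> realization_map prism_q a = realization_map prism_q b"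
proof (cases "a \<in> prism_boundary \<and> b \<in> prism_boundary")
  case True
  have "realization_map prism_q c = prism_fold c" if "c \<in> realization prism_complex" for c
    using realization_prism_le[OF that] by (intro realization_map_prism_q)
  then show ?thesis
    using prism_fold_eq_boundary True a b by (simp add: prism_homeo_boundary)
next
  case False
  then show ?thesis
    using prism_map_eq_interior[OF a _ b] prism_map_eq_interior[OF b _ a]
      prism_fold_eq_interior[OF a _ b] prism_fold_eq_interior[OF b _ a] by metis
qed

section \<open>The induced homeomorphisms\<close>

text \<open>All vertices of the type are indices, so the simplex is cut out by a closed condition
  from a product of intervals that shrink to the point 0 outside \<open>\<sigma>\<close>, and the
  product is compact by Tychonoff.\<close>

lemma compact_closed_simplex:
  fixes \<sigma> :: "'v set"
  assumes "finite \<sigma>" shows "compact (closed_simplex \<sigma>)"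
proof -
  define C where "C = (\<Pi>\<^sub>E v\<in>(UNIV :: 'v set). if v \<in> \<sigma> then {0..1} else {0 :: real})"
  have "compactin (product_topology (\<lambda>_. euclidean) UNIV) C"
    unfolding C_def by (subst compactin_PiE) auto
  then have "compact C" by (simp add: euclidean_product_topology)
  moreover have "closed {b :: 'v \<Rightarrow> real. sum b \<sigma> = 1}"
    by (intro closed_Collect_eq continuous_intros continuous_on_product_coordinates)
  moreover have "closed_simplex \<sigma> = C \<inter> {b. sum b \<sigma> = 1}"
  proof (intro equalityI subsetI)
    fix b assume b: "b \<in> closed_simplex \<sigma>"
    have "b v \<le> 1" if "v \<in> \<sigma>" for v
      using b member_le_sum[of v \<sigma> b] assms that by (auto simp: closed_simplex_def)
    then show "b \<in> C \<inter> {b. sum b \<sigma> = 1}" using b by (auto simp: C_def closed_simplex_def)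
  next
    fix b assume b: "b \<in> C \<inter> {b. sum b \<sigma> = 1}"
    then have "b v \<in> (if v \<in> \<sigma> then {0..1} else {0})" for v by (auto simp: C_def PiE_iff)
    from this have *: "b v \<in> (if v \<in> \<sigma> then {0..1} else {0})" for v .
    have "0 \<le> b v" "v \<notin> \<sigma> \<Longrightarrow> b v = 0" for v
      using *[of v] by (cases "v \<in> \<sigma>"; simp)+
    with b show "b \<in> closed_simplex \<sigma>" by (auto simp: closed_simplex_def)
  qed
  ultimately show ?thesis by (simp add: compact_Int_closed)
qed

lemma compact_realization:
  assumes "finite K" "\<And>\<sigma>. \<sigma> \<in> K \<Longrightarrow> finite \<sigma>" shows "compact (realization K)"
  unfolding realization_def using assms by (intro compact_UN compact_closed_simplex)

lemma continuous_map_top_of_set: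
  assumes "continuous_on S f" "f ` S \<subseteq> T" shows "continuous_map (top_of_set S) (top_of_set T) f"
  using assms by auto

lemma homeomorphic_map_compact:
  fixes S :: "'a::topological_space set" and T :: "'b::metric_space set"
  assumes "compact S" "continuous_on S f" "bij_betw f S T"
  shows "homeomorphic_map (top_of_set S) (top_of_set T) f"
proof (rule continuous_imp_homeomorphic_map)
  show "continuous_map (top_of_set S) (top_of_set T) f" using assms by (auto simp: bij_betw_def)
  show "compact_space (top_of_set S)" using assms(1) by (simp add: compact_space_subtopology)
  show "Hausdorff_space (top_of_set T)" by (rule Hausdorff_space_subtopology[OF Hausdorff_space_euclidean])
qed (use assms in \<open>auto simp: bij_betw_def\<close>)

lemma realization_map_realization:
  assumes "\<And>\<sigma>. \<sigma> \<in> K \<Longrightarrow> inj_on f \<sigma>"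
  shows "realization_map f ` realization K = realization ((`) f ` K)"
  unfolding realization_def image_UN using realization_map_closed_simplex[OF assms] by auto

lemma complex_dim_generated:
  assumes "finite F" "F \<noteq> {}" "\<And>\<tau>. \<tau> \<in> F \<Longrightarrow> card \<tau> = Suc n"
  shows "complex_dim (generated_complex F) = n"
proof -
  have fin: "finite \<tau>" if "\<tau> \<in> F" for \<tau> using assms(3)[OF that] by (intro card_ge_0_finite) simp
  have "Max (card ` generated_complex F) = Suc n"
  proof (rule Max_eqI)
    show "finite (card ` generated_complex F)" using finite_generated_complex[OF assms(1) fin] by simp
    show "y \<le> Suc n" if "y \<in> card ` generated_complex F" for y
      using that assms(3) fin by (auto simp: generated_complex_def) (metis card_mono)
    obtain \<tau> where "\<tau> \<in> F" using assms(2) by auto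
    moreover from this have "card \<tau> = Suc n" by (rule assms(3))
    moreover from this have "\<tau> \<noteq> {}" by auto
    ultimately have "\<tau> \<in> generated_complex F" "card \<tau> = Suc n" by (auto simp: generated_complex_def)
    then show "Suc n \<in> card ` generated_complex F" by force
  qed
  then show ?thesis by (simp add: complex_dim_def)
qed

lemma finite_prism_complex: "finite prism_complex" "\<sigma> \<in> prism_complex \<Longrightarrow> finite \<sigma>"
  and abstract_prism_complex: "abstract_complex prism_complex"
proof -
  have f: "finite T" if "T \<in> prism_facets" for T using prism_facets_le[OF that] finite_subset by blast
  have "finite prism_facets" by (simp add: prism_facets_def)
  then show "finite prism_complex" unfolding prism_complex_def using f by (rule finite_generated_complex)
  show "abstract_complex prism_complex" unfolding prism_complex_def using f by (rule abstract_complex_generated)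
  then show "\<sigma> \<in> prism_complex \<Longrightarrow> finite \<sigma>" by (auto simp: abstract_complex_def)
qed

lemma homeomorphic_map_prism_homeo:
  "homeomorphic_map (top_of_set (realization prism_complex)) (top_of_set prism) prism_homeo"
  by (intro homeomorphic_map_compact compact_realization finite_prism_complex continuous_on_prism_homeo bij_betw_prism_homeo)

lemma barnette_subset: "generated_complex F \<subseteq> barnette_sphere"
  if "\<And>T. T \<in> F \<Longrightarrow> \<exists>U\<in>barnette_facets. T \<subseteq> U"
  using that by (fastforce simp: barnette_sphere_def generated_complex_def)

lemma abstract_barnette: "abstract_complex barnette_sphere"
  unfolding barnette_sphere_def by (rule abstract_complex_generated) (auto simp: barnette_facets_def)

lemma realization_map_prism_q_onto: "realization_map prism_q ` realization prism_complex = realization barnette_sphere"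
  using realization_map_realization[of prism_complex prism_q] inj_on_prism_q image_prism_q_complex by auto

lemma continuous_on_realization_map_prism_q: "continuous_on (realization prism_complex) (realization_map prism_q)"
proof -
  have "continuous_on (realization prism_complex) prism_fold"
  proof (rule continuous_on_coordinatewise_then_product)
    fix w show "continuous_on (realization prism_complex) (\<lambda>b. prism_fold b w)"
    proof -
      have c: "continuous_on (realization prism_complex) (\<lambda>b. b v)" for v
        by (rule continuous_on_subset[OF continuous_on_product_coordinates subset_UNIV])
      consider "w \<le> 3" | "\<not> w \<le> 3" "8 \<le> w \<and> w \<le> 11" | "\<not> w \<le> 3" "\<not> (8 \<le> w \<and> w \<le> 11)" by blast
      then show ?thesis
        by cases (simp_all only: prism_fold_def if_True if_False simp_thms c continuous_on_add continuous_on_const)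
    qed
  qed
  moreover have "realization_map prism_q b = prism_fold b" if "b \<in> realization prism_complex" for b
    using realization_prism_le[OF that] by (intro realization_map_prism_q)
  ultimately show ?thesis using continuous_on_cong by metis
qed

text \<open>\<open>realization_map prism_q\<close> is carried over to the prism by the inverse
  \<open>k\<close> of \<open>prism_homeo\<close>; its fibres there are the classes.\<close>

lemma prism_quotient_barnette:
  obtains qbar where "homeomorphic_map prism_quotient (top_of_set (realization barnette_sphere)) qbar"
    "\<And>b. b \<in> realization prism_complex \<Longrightarrow> qbar (prism_class (prism_homeo b)) = realization_map prism_q b"
proof -
  obtain k where k: "homeomorphic_maps (top_of_set (realization prism_complex)) (top_of_set prism) prism_homeo k"
    using homeomorphic_map_prism_homeo by (auto simp: homeomorphic_map_maps)
  then have kc: "continuous_map (top_of_set prism) (top_of_set (realization prism_complex)) k"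
    and kh: "\<And>b. b \<in> realization prism_complex \<Longrightarrow> k (prism_homeo b) = b"
    and hk: "\<And>u. u \<in> prism \<Longrightarrow> prism_homeo (k u) = u"
    by (auto simp: homeomorphic_maps_def)
  have kin: "k u \<in> realization prism_complex" if "u \<in> prism" for u
    using kc that by (auto simp: continuous_map_def)
  have "continuous_map (top_of_set (realization prism_complex)) (top_of_set (realization barnette_sphere)) (realization_map prism_q)"
    using continuous_on_realization_map_prism_q realization_map_prism_q_onto by auto
  then have 1: "continuous_map (top_of_set prism) (top_of_set (realization barnette_sphere)) (realization_map prism_q \<circ> k)"
    using kc continuous_map_compose by blast
  have "k ` prism = realization prism_complex" using kin kh prism_homeo_in by (auto simp: image_iff) metis
  then have 2: "(realization_map prism_q \<circ> k) ` prism = topspace (top_of_set (realization barnette_sphere))"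
    using realization_map_prism_q_onto by (simp only: image_comp[symmetric] topspace_euclidean_subtopology)
  have 3: "(realization_map prism_q \<circ> k) u = (realization_map prism_q \<circ> k) v \<longleftrightarrow> prism_map u = prism_map v"
    if "u \<in> prism" "v \<in> prism" for u v
    using prism_map_homeo_eq_iff[OF kin[OF that(1)] kin[OF that(2)]] hk that by simp
  obtain qbar where q: "homeomorphic_map prism_quotient (top_of_set (realization barnette_sphere)) qbar"
    "\<And>u. u \<in> prism \<Longrightarrow> qbar (prism_class u) = (realization_map prism_q \<circ> k) u"
    by (rule prism_quotient_homeomorphism[OF 1 2 _ 3]) (auto intro: Hausdorff_space_subtopology[OF Hausdorff_space_euclidean])
  then show ?thesis using that prism_homeo_in kh by simp
qed

text \<open>Degenerate triples violate the strict inequalities of the interior, so they come from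
  boundary points, where the map is linear in the weights and the vanishing gaps have been
  identified.\<close>

lemma prism_homeo_S: "prism_homeo ` prism_side = prism_S"
  and prism_homeo_D: "prism_homeo ` prism_rim = prism_D"
proof -
  have ex: "\<exists>b\<in>prism_boundary. u = prism_homeo b" if "u \<in> prism" "u = (x, y, z)" "x = y \<or> y = z \<or> z = x + 1" for u x y z
  proof -
    have "u \<in> prism_homeo ` realization prism_complex"
      using that(1) by (simp only: bij_betw_imp_surj_on[OF bij_betw_prism_homeo])
    then obtain b where b: "b \<in> realization prism_complex" "u = prism_homeo b" by (elim imageE)
    then have "b \<in> prism_boundary" using prism_homeo_interior[of b x y z] that by auto
    then show ?thesis using b by blast
  qed
  have deg: "x = y \<or> y = z \<or> z = x + 1 \<longleftrightarrow> b \<in> prism_side"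
    "x = y \<and> y = z \<or> x = y \<and> z = x + 1 \<or> y = z \<and> z = x + 1 \<longleftrightarrow> b \<in> prism_rim"
    if "b \<in> prism_boundary" "prism_homeo b = (x, y, z)" for b x y z
    using prism_linear_degenerate_iff[of b x y z] that prism_homeo_boundary by auto
  have inP: "prism_homeo b \<in> prism" if "b \<in> prism_boundary" for b
    using prism_homeo_in prism_boundary_subset that by blast
  show "prism_homeo ` prism_side = prism_S"
  proof
    show "prism_homeo ` prism_side \<subseteq> prism_S"
    proof
      fix u assume "u \<in> prism_homeo ` prism_side"
      then obtain b where b: "b \<in> prism_side" "u = prism_homeo b" by blast
      obtain x y z where u: "u = (x, y, z)" by (cases u) auto
      have bb: "b \<in> prism_boundary" using b(1) prism_side_subset by blast
      have "(x, y, z) \<in> prism" "x = y \<or> y = z \<or> z = x + 1"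
        using inP[OF bb] deg(1)[OF bb, of x y z] b u by simp_all
      then show "u \<in> prism_S" unfolding u prism_S_def by simp
    qed
    show "prism_S \<subseteq> prism_homeo ` prism_side"
    proof
      fix u assume u: "u \<in> prism_S"
      obtain x y z where xyz: "u = (x, y, z)" by (cases u) auto
      have d: "u \<in> prism" "x = y \<or> y = z \<or> z = x + 1" using u by (auto simp: prism_S_def xyz)
      obtain b where b: "b \<in> prism_boundary" "u = prism_homeo b" using ex[OF d(1) xyz d(2)] by blast
      then show "u \<in> prism_homeo ` prism_side" using deg(1)[OF b(1), of x y z] xyz d(2) by auto
    qed
  qed
  have D: "(x, y, z) \<in> prism_D \<longleftrightarrow> (x, y, z) \<in> prism \<and> (x = y \<and> y = z \<or> x = y \<and> z = x + 1 \<or> y = z \<and> z = x + 1)" for x y z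
    by (auto simp: prism_D_def)
  show "prism_homeo ` prism_rim = prism_D"
  proof
    show "prism_homeo ` prism_rim \<subseteq> prism_D"
    proof
      fix u assume "u \<in> prism_homeo ` prism_rim"
      then obtain b where b: "b \<in> prism_rim" "u = prism_homeo b" by blast
      obtain x y z where u: "u = (x, y, z)" by (cases u) auto
      have bb: "b \<in> prism_boundary" using b(1) prism_rim_subset prism_side_subset by blast
      have "(x, y, z) \<in> prism" "x = y \<and> y = z \<or> x = y \<and> z = x + 1 \<or> y = z \<and> z = x + 1"
        using inP[OF bb] deg(2)[OF bb, of x y z] b u by simp_all
      then show "u \<in> prism_D" unfolding u D by simp
    qed
    show "prism_D \<subseteq> prism_homeo ` prism_rim"
    proof
      fix u assume u: "u \<in> prism_D"
      obtain x y z where xyz: "u = (x, y, z)" by (cases u) auto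
      have d: "u \<in> prism" "x = y \<and> y = z \<or> x = y \<and> z = x + 1 \<or> y = z \<and> z = x + 1"
        using u D[of x y z] by (simp_all add: xyz)
      then have "x = y \<or> y = z \<or> z = x + 1" by blast
      then obtain b where b: "b \<in> prism_boundary" "u = prism_homeo b" using ex[OF d(1) xyz] by blast
      then show "u \<in> prism_homeo ` prism_rim" using deg(2)[OF b(1), of x y z] xyz d(2) by auto
    qed
  qed
qed

lemma image_prism_q_side: "(`) prism_q ` list_complex prism_side_list = band_complex"
proof -
  have "(`) prism_q ` set ` set prism_side_list = {{0,1,8}, {0,2,8}, {0,1,9}, {1,2,9}, {0,2,10}, {1,2,10}}"
    by (simp add: prism_side_list_def prism_q_def insert_commute)
  then show ?thesis by (simp only: generated_complex_image band_complex_def)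
qed

lemma image_prism_q_rim: "(`) prism_q ` list_complex prism_rim_list = band_boundary_complex"
proof -
  have "(`) prism_q ` set ` set prism_rim_list = {{1,8}, {2,8}, {0,9}, {2,9}, {0,10}, {1,10}}"
    by (simp add: prism_rim_list_def prism_q_def insert_commute)
  then show ?thesis by (simp only: generated_complex_image band_boundary_complex_def)
qed

lemma prism_side_complex_subset: "list_complex prism_rim_list \<subseteq> prism_complex"
  "list_complex prism_side_list \<subseteq> prism_complex"
proof -
  have "list_all (\<lambda>T. list_ex (list_subset T) prism_facet_list) prism_rim_list"
    "list_all (\<lambda>T. list_ex (list_subset T) prism_facet_list) prism_side_list" by code_simp+
  then show "list_complex prism_rim_list \<subseteq> prism_complex"
    "list_complex prism_side_list \<subseteq> prism_complex"
    unfolding prism_complex_eq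
    by (fastforce simp: list_all_iff list_ex_iff list_subset_iff generated_complex_def)+
qed

lemma realization_map_prism_q_side:
  "realization_map prism_q ` prism_side = realization band_complex"
  "realization_map prism_q ` prism_rim = realization band_boundary_complex"
  using realization_map_realization[of "list_complex prism_side_list" prism_q]
    realization_map_realization[of "list_complex prism_rim_list" prism_q]
    prism_side_complex_subset inj_on_prism_q image_prism_q_side image_prism_q_rim by (metis subsetD)+

text \<open>Each full turn of \<open>\<theta>\<close> adds three half turns to the cross section and
  so reverses the sign of \<open>t\<close>, which preserves both the band and its edge.\<close>

lemma three_half_twist_in_band:
  assumes "-1 \<le> t" "t \<le> 1"
  shows "three_half_twist \<theta> t \<in> standard_band"
    "t = -1 \<or> t = 1 \<Longrightarrow> three_half_twist \<theta> t \<in> standard_band_boundary"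
proof -
  define n where "n = \<lfloor>\<theta> / (2 * pi)\<rfloor>"
  define \<theta>' where "\<theta>' = \<theta> - 2 * pi * of_int n"
  define \<epsilon> :: real where "\<epsilon> = (if even n then 1 else -1)"
  have "of_int n \<le> \<theta> / (2 * pi)" "\<theta> / (2 * pi) \<le> of_int n + 1" unfolding n_def by linarith+
  then have \<theta>': "0 \<le> \<theta>'" "\<theta>' \<le> 2 * pi" by (simp_all add: \<theta>'_def field_simps)
  have 1: "cis \<theta> = cis \<theta>'"
  proof -
    have "cis \<theta> = cis (\<theta>' + 2 * pi * (0 + of_int n))" by (simp add: \<theta>'_def)
    also have "\<dots> = cis \<theta>' * cis (2 * pi * (0 + of_int n))" by (simp only: cis_mult)
    also have "cis (2 * pi * (0 + of_int n)) = 1" unfolding cis_2pi_add_int by simp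
    finally show ?thesis by simp
  qed
  have 2: "cis (3 * \<theta> / 2) = complex_of_real \<epsilon> * cis (3 * \<theta>' / 2)"
  proof -
    have "3 * \<theta> / 2 = 3 * \<theta>' / 2 + 2 * pi * (0 + of_int n) + pi * of_int n" by (simp add: \<theta>'_def field_simps)
    then have "cis (3 * \<theta> / 2) = cis (3 * \<theta>' / 2) * cis (2 * pi * (0 + of_int n)) * cis (pi * of_int n)"
      by (simp only: cis_mult)
    also have "cis (2 * pi * (0 + of_int n)) = 1" unfolding cis_2pi_add_int by simp
    also have "cis (pi * of_int n) = complex_of_real \<epsilon>"
      by (rule complex_eqI) (simp_all add: \<epsilon>_def)
    finally show ?thesis by (simp add: mult.commute)
  qed
  have "cos \<theta> = cos \<theta>'" "sin \<theta> = sin \<theta>'" "cos (3 * \<theta> / 2) = \<epsilon> * cos (3 * \<theta>' / 2)" "sin (3 * \<theta> / 2) = \<epsilon> * sin (3 * \<theta>' / 2)"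
    using arg_cong[OF 1, of Re] arg_cong[OF 1, of Im] arg_cong[OF 2, of Re] arg_cong[OF 2, of Im] by simp_all
  then have eq: "three_half_twist \<theta> t = three_half_twist \<theta>' (\<epsilon> * t)"
    unfolding three_half_twist_def by (simp add: mult_ac)
  have "-1 \<le> \<epsilon> * t" "\<epsilon> * t \<le> 1" using assms by (auto simp: \<epsilon>_def)
  then show "three_half_twist \<theta> t \<in> standard_band"
    unfolding eq standard_band_def using \<theta>' by (intro CollectI exI[of _ \<theta>'] exI[of _ "\<epsilon> * t"]) auto
  show "three_half_twist \<theta> t \<in> standard_band_boundary" if "t = -1 \<or> t = 1"
  proof -
    have "\<epsilon> * t \<in> {-1, 1}" using that by (auto simp: \<epsilon>_def)
    then show ?thesis
      unfolding eq standard_band_boundary_def using \<theta>' by (intro CollectI exI[of _ \<theta>'] exI[of _ "\<epsilon> * t"]) auto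
  qed
qed

section \<open>The images of S and D in the 3-sphere\<close>

definition prism_to_space :: "real \<times> real \<times> real \<Rightarrow> (real \<times> real \<times> real) option" where
  "prism_to_space u = (if sphere_coords u = (0, 1) then None else Some (join_to_space (sphere_coords u)))"

lemma compact_join_sphere: "compact join_sphere"
proof -
  have eq: "join_sphere = {a. norm (fst a) + norm (snd a) = 1}" by auto
  have "closed join_sphere" unfolding eq by (intro closed_Collect_eq continuous_intros)
  moreover have "bounded join_sphere"
  proof (rule boundedI)
    fix a :: "complex \<times> complex" assume "a \<in> join_sphere"
    then show "norm a \<le> 1" using norm_Pair_le[of "fst a" "snd a"] by (auto simp: case_prod_unfold)
  qed
  ultimately show ?thesis by (simp add: compact_eq_bounded_closed)
qed

lemma join_to_space_inj:
  assumes "a \<in> join_sphere - {(0, 1)}" "b \<in> join_sphere - {(0, 1)}" "join_to_space a = join_to_space b"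
  shows "a = b"
  using assms space_to_join_to_space by metis

lemma prism_to_space_homeomorphism:
  obtains \<Phi> where "homeomorphic_map prism_quotient S3_top \<Phi>" "\<And>u. u \<in> prism \<Longrightarrow> \<Phi> (prism_class u) = prism_to_space u"
proof -
  let ?g = "\<lambda>a. if a = (0, 1) then None else Some (join_to_space a)"
  have "(0, 1) \<in> join_sphere" by simp
  then have g: "continuous_map (top_of_set join_sphere) S3_top ?g"
    by (rule one_point_compactification_map[OF compact_join_sphere _ homeomorphism_join_space])
  have "continuous_map (top_of_set prism) (top_of_set join_sphere) sphere_coords"
    using continuous_on_subset[OF continuous_on_sphere_coords prism_subset_cyclic_triples] sphere_coords_prism
    by (intro continuous_map_top_of_set) simp_all
  then have "continuous_map (top_of_set prism) S3_top (?g \<circ> sphere_coords)"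
    using g by (rule continuous_map_compose)
  then have 1: "continuous_map (top_of_set prism) S3_top prism_to_space"
    by (simp only: prism_to_space_def[abs_def] comp_def)
  have onto: "s \<in> prism_to_space ` prism" for s
  proof (cases s)
    case None
    have "(0, 1) \<in> sphere_coords ` prism" unfolding sphere_coords_prism by simp
    then obtain u where "u \<in> prism" "sphere_coords u = (0, 1)" by (metis imageE)
    then show ?thesis using None by (intro image_eqI[of _ _ u]) (simp_all add: prism_to_space_def)
  next
    case (Some q)
    have sj: "space_to_join q \<in> join_sphere" "space_to_join q \<noteq> (0, 1)"
      using DiffD1[OF space_to_join_in] DiffD2[OF space_to_join_in[of q]] by auto
    then obtain u where "u \<in> prism" "sphere_coords u = space_to_join q" by (metis imageE sphere_coords_prism)
    then show ?thesis using Some sj join_to_space_to_join by (intro image_eqI[of _ _ u]) (simp_all add: prism_to_space_def)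
  qed
  then have 2: "prism_to_space ` prism = topspace S3_top"
  proof -
    have "topspace S3_top = UNIV" by (simp add: UNIV_option_conv)
    moreover have "prism_to_space ` prism = UNIV" using onto by (intro equalityI subset_UNIV subsetI)
    ultimately show ?thesis by (simp only:)
  qed
  have 3: "prism_to_space u = prism_to_space v \<longleftrightarrow> prism_map u = prism_map v" if "u \<in> prism" "v \<in> prism" for u v
  proof -
    have in_join: "sphere_coords u \<in> join_sphere" "sphere_coords v \<in> join_sphere"
      using imageI[OF that(1), of sphere_coords] imageI[OF that(2), of sphere_coords] unfolding sphere_coords_prism .
    have "prism_to_space u = prism_to_space v \<longleftrightarrow> sphere_coords u = sphere_coords v"
    proof (cases "sphere_coords u = (0, 1) \<or> sphere_coords v = (0, 1)")
      case True
      then show ?thesis by (auto simp: prism_to_space_def)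
    next
      case False
      then have "sphere_coords u \<in> join_sphere - {(0, 1)}" "sphere_coords v \<in> join_sphere - {(0, 1)}"
        using in_join by simp_all
      then have "join_to_space (sphere_coords u) = join_to_space (sphere_coords v) \<longleftrightarrow> sphere_coords u = sphere_coords v"
        using join_to_space_inj by metis
      then show ?thesis using False by (simp add: prism_to_space_def)
    qed
    then show ?thesis
      using sphere_coords_eq_iff[of u v] that subsetD[OF prism_subset_cyclic_triples] by simp
  qed
  have "Hausdorff_space S3_top"
    by (simp add: Hausdorff_space_Alexandroff_compactification locally_compact_space_euclidean)
  from prism_quotient_homeomorphism[OF 1 2 this 3] show ?thesis using that by blast
qed

text \<open>The triple \<open>(p, p, q)\<close> may lie outside the prism; this is why
  \<open>sphere_coords\<close> is compared with \<open>prism_map\<close> on all of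
  \<open>cyclic_triples\<close>.\<close>

lemma prism_to_space_band:
  assumes u: "u \<in> cyclic_triples" "prism_map u = prism_map (p, p, q)" and pq: "p \<le> q" "q \<le> p + 1"
  shows "prism_to_space u = Some (three_half_twist (2 * pi * (p + q)) (cos (pi * (q - p))))"
proof -
  have c: "(p, p, q) \<in> cyclic_triples" using pq by (simp add: cyclic_triples_def)
  have "sphere_coords u = band_coords p q"
    using sphere_coords_eq_iff[OF u(1) c] u(2) sphere_coords_degenerate[OF c] by simp
  then show ?thesis using join_to_space_band by (simp add: prism_to_space_def)
qed

lemma prism_S_pair:
  assumes "u \<in> prism_S"
  shows "\<exists>p q. p \<le> q \<and> q \<le> p + 1 \<and> prism_map u = prism_map (p, p, q) \<and> (u \<in> prism_D \<longrightarrow> q = p \<or> q = p + 1)"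
proof -
  obtain x y z where u: "u = (x, y, z)" by (cases u) auto
  have o: "x \<le> y" "y \<le> z" "z \<le> x + 1" and d: "x = y \<or> y = z \<or> z = x + 1"
    using assms by (auto simp: prism_S_def prism_def u)
  have D: "u \<in> prism_D \<Longrightarrow> x = y \<and> y = z \<or> x = y \<and> z = x + 1 \<or> y = z \<and> z = x + 1"
    by (auto simp: prism_D_def u)
  from d show ?thesis
  proof (elim disjE)
    assume e: "x = y"
    show ?thesis
      by (rule exI[where x = x], rule exI[where x = z]) (use e D o in \<open>auto simp: u simp del: prism_map.simps\<close>)
  next
    assume e: "y = z"
    then have m: "prism_map u = prism_map (x, x, z)" by (simp add: u)
    show ?thesis
      by (rule exI[where x = x], rule exI[where x = z]) (use e D o m in auto)
  next
    assume e: "z = x + 1"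
    then have m: "prism_map u = prism_map (x, x, y)" by (simp add: u insert_commute)
    show ?thesis
      by (rule exI[where x = x], rule exI[where x = y]) (use e D o m in auto)
  qed
qed

text \<open>The representative of \<open>(p, p, q)\<close> in the prism is degenerate because
  degeneracy depends on the image only. When the image is a single point, all its coordinates agree
  modulo 1.\<close>

lemma prism_pair_S:
  assumes "p \<le> q" "q \<le> p + 1"
  shows "\<exists>u\<in>prism_S. prism_map u = prism_map (p, p, q) \<and> (q = p \<or> q = p + 1 \<longrightarrow> u \<in> prism_D)"
proof -
  have c: "(p, p, q) \<in> cyclic_triples" using assms by (simp add: cyclic_triples_def)
  obtain u where u: "u \<in> prism" "prism_map u = prism_map (p, p, q)" using cyclic_triple_in_prism[OF c] by blast
  obtain x y z where xyz: "u = (x, y, z)" by (cases u) auto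
  have uc: "(x, y, z) \<in> cyclic_triples" using u(1) prism_subset_cyclic_triples by (auto simp: xyz)
  have "x = y \<or> y = z \<or> z = x + 1"
    using prism_map_eq_degenerate[OF c uc] u(2) by (simp add: xyz)
  then have S: "u \<in> prism_S" using u(1) by (simp add: prism_S_def xyz)
  have "u \<in> prism_D" if "q = p \<or> q = p + 1"
  proof -
    have "prism_map u = {cis (2 * pi * p)}" using u(2) that by auto
    then have "cis (2 * pi * y) = cis (2 * pi * x)" "cis (2 * pi * z) = cis (2 * pi * x)" by (auto simp: xyz)
    moreover have o: "x \<le> y" "y \<le> z" "z \<le> x + 1" using uc by (auto simp: cyclic_triples_def)
    ultimately have "(y = x \<or> y = x + 1) \<and> (z = x \<or> z = x + 1)"
      using cis_2pi_eq_unit_interval[of y x x] cis_2pi_eq_unit_interval[of z x x] by auto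
    then show ?thesis using u(1) o by (auto simp: prism_D_def xyz)
  qed
  then show ?thesis using S u(2) by blast
qed

lemma prism_to_space_S: "prism_to_space ` prism_S = Some ` standard_band"
  and prism_to_space_D: "prism_to_space ` prism_D = Some ` standard_band_boundary"
proof -
  have S: "u \<in> cyclic_triples" if "u \<in> prism_S" for u
    using that prism_subset_cyclic_triples by (auto simp: prism_S_def)
  have DS: "prism_D \<subseteq> prism_S" by (auto simp: prism_D_def prism_S_def)
  have pre: "\<exists>u\<in>prism_S. prism_to_space u = Some (three_half_twist \<theta> t) \<and> (t = -1 \<or> t = 1 \<longrightarrow> u \<in> prism_D)"
    if t: "-1 \<le> t" "t \<le> 1" for \<theta> t
  proof -
    \<comment> \<open>The gap \<open>q - p\<close> is read off from \<open>t\<close>, and the sum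
      \<open>p + q\<close> is the angle \<open>\<theta>\<close> in turns.\<close>
    define g where "g = arccos t / pi"
    define p where "p = (\<theta> / (2 * pi) - g) / 2"
    define q where "q = (\<theta> / (2 * pi) + g) / 2"
    have g: "0 \<le> g" "g \<le> 1" using arccos_lbound[OF t] arccos_ubound[OF t] by (simp_all add: g_def)
    have e: "q - p = g" "p + q = \<theta> / (2 * pi)" by (simp_all add: p_def q_def field_simps)
    have pq: "p \<le> q" "q \<le> p + 1" using e g by linarith+
    obtain u where u: "u \<in> prism_S" "prism_map u = prism_map (p, p, q)" "q = p \<or> q = p + 1 \<longrightarrow> u \<in> prism_D"
      using prism_pair_S[OF pq] by blast
    have "2 * pi * (p + q) = \<theta>" "cos (pi * (q - p)) = t"
      unfolding e using t by (simp_all add: g_def cos_arccos)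
    then have "prism_to_space u = Some (three_half_twist \<theta> t)"
      using prism_to_space_band[OF S[OF u(1)] u(2) pq] by simp
    moreover have "u \<in> prism_D" if "t = -1 \<or> t = 1"
    proof -
      have "g = 0 \<or> g = 1" using that by (auto simp: g_def)
      then show ?thesis using u(3) e(1) by auto
    qed
    ultimately show ?thesis using u(1) by blast
  qed
  show "prism_to_space ` prism_S = Some ` standard_band"
  proof
    show "prism_to_space ` prism_S \<subseteq> Some ` standard_band"
    proof
      fix s assume "s \<in> prism_to_space ` prism_S"
      then obtain u where u: "u \<in> prism_S" "s = prism_to_space u" by blast
      obtain p q where "p \<le> q" "q \<le> p + 1" "prism_map u = prism_map (p, p, q)" using prism_S_pair[OF u(1)] by blast
      then have "s = Some (three_half_twist (2 * pi * (p + q)) (cos (pi * (q - p))))"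
        using prism_to_space_band[OF S[OF u(1)]] u(2) by simp
      then show "s \<in> Some ` standard_band" using three_half_twist_in_band(1) by simp
    qed
    show "Some ` standard_band \<subseteq> prism_to_space ` prism_S"
    proof
      fix s assume "s \<in> Some ` standard_band"
      then obtain \<theta> t where "s = Some (three_half_twist \<theta> t)" "-1 \<le> t" "t \<le> 1" by (auto simp: standard_band_def)
      then show "s \<in> prism_to_space ` prism_S" using pre[of t \<theta>] by force
    qed
  qed
  show "prism_to_space ` prism_D = Some ` standard_band_boundary"
  proof
    show "prism_to_space ` prism_D \<subseteq> Some ` standard_band_boundary"
    proof
      fix s assume "s \<in> prism_to_space ` prism_D"
      then obtain u where u: "u \<in> prism_D" "s = prism_to_space u" by blast
      have uS: "u \<in> prism_S" using u(1) DS by blast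
      obtain p q where pq: "p \<le> q" "q \<le> p + 1" "prism_map u = prism_map (p, p, q)" "q = p \<or> q = p + 1"
        using prism_S_pair[OF uS] u(1) by blast
      then have s: "s = Some (three_half_twist (2 * pi * (p + q)) (cos (pi * (q - p))))"
        using prism_to_space_band[OF S[OF uS]] u(2) by simp
      have "cos (pi * (q - p)) = -1 \<or> cos (pi * (q - p)) = 1" using pq(4) by auto
      then show "s \<in> Some ` standard_band_boundary" using three_half_twist_in_band(2) s by auto
    qed
    show "Some ` standard_band_boundary \<subseteq> prism_to_space ` prism_D"
    proof
      fix s assume "s \<in> Some ` standard_band_boundary"
      then obtain \<theta> t where "s = Some (three_half_twist \<theta> t)" "t = -1 \<or> t = 1" by (auto simp: standard_band_boundary_def)
      then show "s \<in> prism_to_space ` prism_D" using pre[of t \<theta>] by force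
    qed
  qed
qed

lemma prism_twisted_band:
  "twisted_band_with_boundary prism_quotient (prism_class ` prism_S) (prism_class ` prism_D)"
proof -
  obtain \<Phi> where \<Phi>: "homeomorphic_map prism_quotient S3_top \<Phi>" "\<And>u. u \<in> prism \<Longrightarrow> \<Phi> (prism_class u) = prism_to_space u"
    using prism_to_space_homeomorphism by blast
  have sub: "prism_S \<subseteq> prism" "prism_D \<subseteq> prism" by (auto simp: prism_S_def prism_D_def)
  have "\<Phi> ` prism_class ` A = prism_to_space ` A" if "A \<subseteq> prism" for A
    using \<Phi>(2) that unfolding image_image by (intro image_cong) auto
  moreover have "prism_class ` A \<subseteq> topspace prism_quotient" if "A \<subseteq> prism" for A
    using that by (auto simp: prism_quotient_def)
  ultimately show ?thesis
    unfolding twisted_band_with_boundary_def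
    using \<Phi>(1) sub prism_to_space_S prism_to_space_D by (intro exI[of _ \<Phi>]) simp
qed

lemma generated_complex_facts:
  assumes "finite F" "F \<noteq> {}" "\<And>\<tau>. \<tau> \<in> F \<Longrightarrow> card \<tau> = Suc n" "\<And>T. T \<in> F \<Longrightarrow> \<exists>U\<in>barnette_facets. T \<subseteq> U"
  shows "subcomplex (generated_complex F) barnette_sphere" "complex_dim (generated_complex F) = n"
    "complex_facets (generated_complex F) = F"
proof -
  have "finite \<tau>" if "\<tau> \<in> F" for \<tau> using assms(3)[OF that] by (intro card_ge_0_finite) simp
  then have "abstract_complex (generated_complex F)" by (rule abstract_complex_generated)
  then show "subcomplex (generated_complex F) barnette_sphere"
    using barnette_subset[OF assms(4)] abstract_barnette by (simp add: subcomplex_def)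
  show "complex_dim (generated_complex F) = n" by (rule complex_dim_generated[OF assms(1-3)])
  show "complex_facets (generated_complex F) = F" using complex_facets_generated_uniform[OF assms(3)] .
qed

lemma band_complex_facts:
  "subcomplex band_complex barnette_sphere" "complex_dim band_complex = 2"
  "complex_vertices band_complex = {0,1,2,8,9,10}"
  "complex_facets band_complex = {{0,1,8}, {0,2,8}, {0,1,9}, {1,2,9}, {0,2,10}, {1,2,10}}"
proof -
  let ?F = "{{0,1,8}, {0,2,8}, {0,1,9}, {1,2,9}, {0,2,10}, {1,2,10}} :: nat set set"
  have card: "card \<tau> = Suc 2" if "\<tau> \<in> ?F" for \<tau> using that by (elim insertE emptyE; simp)
  have sub: "\<exists>U\<in>barnette_facets. T \<subseteq> U" if "T \<in> ?F" for T
    using that unfolding barnette_facets_def by (elim insertE emptyE; simp)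
  note f = generated_complex_facts[OF _ _ card sub]
  show "subcomplex band_complex barnette_sphere" "complex_dim band_complex = 2"
    "complex_facets band_complex = ?F" unfolding band_complex_def by (rule f; simp)+
  show "complex_vertices band_complex = {0,1,2,8,9,10}"
    unfolding band_complex_def complex_vertices_generated by auto
qed

lemma band_boundary_complex_facts:
  "subcomplex band_boundary_complex barnette_sphere" "complex_dim band_boundary_complex = 1"
  "complex_vertices band_boundary_complex = {0,1,2,8,9,10}"
  "complex_facets band_boundary_complex = {{1,8}, {2,8}, {0,9}, {2,9}, {0,10}, {1,10}}"
proof -
  let ?F = "{{1,8}, {2,8}, {0,9}, {2,9}, {0,10}, {1,10}} :: nat set set"
  have card: "card \<tau> = Suc 1" if "\<tau> \<in> ?F" for \<tau> using that by (elim insertE emptyE; simp)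
  have sub: "\<exists>U\<in>barnette_facets. T \<subseteq> U" if "T \<in> ?F" for T
    using that unfolding barnette_facets_def by (elim insertE emptyE; simp)
  note f = generated_complex_facts[OF _ _ card sub]
  show "subcomplex band_boundary_complex barnette_sphere" "complex_dim band_boundary_complex = 1"
    "complex_facets band_boundary_complex = ?F" unfolding band_boundary_complex_def by (rule f; simp)+
  show "complex_vertices band_boundary_complex = {0,1,2,8,9,10}"
    unfolding band_boundary_complex_def complex_vertices_generated by auto
qed

lemma prism_homeo_vertices:
  "prism_homeo (vertex_point 0) = P0" "prism_homeo (vertex_point 1) = P1" "prism_homeo (vertex_point 2) = P2"
  "prism_homeo (vertex_point 4) = P4" "prism_homeo (vertex_point 5) = P5" "prism_homeo (vertex_point 6) = P6"
  "prism_homeo (vertex_point 3) = barycenter3 P0 P1 P2" "prism_homeo (vertex_point 7) = barycenter3 P4 P5 P6"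
  "prism_homeo (vertex_point 8) = midpoint P1 P6" "prism_homeo (vertex_point 9) = midpoint P2 P4"
  "prism_homeo (vertex_point 10) = midpoint P0 P5"
  by (subst prism_homeo_vertex; simp add: prism_linear_def vertex_point_def P0_def P1_def P2_def P4_def P5_def P6_def
      barycenter3_def midpoint_def)+

lemma prism_homeo_apex: "prism_homeo (vertex_point 11) \<in> interior prism"
proof -
  let ?U = "{u. fst u < fst (snd u)} \<inter> {u. fst (snd u) < snd (snd u)} \<inter> {u. snd (snd u) < fst u + 1} \<inter>
      {u. 0 < fst u + fst (snd u) + snd (snd u)} \<inter> {u :: real \<times> real \<times> real. fst u + fst (snd u) + snd (snd u) < 1}"
  have op: "open ?U" by (intro open_Int open_Collect_less continuous_intros)
  have sub: "?U \<subseteq> prism" by (auto simp: prism_def)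
  have "prism_homeo (vertex_point 11) = (- 1/6, 1/6, 1/2)"
    by (subst prism_homeo_vertex; simp add: prism_linear_def vertex_point_def)
  then have "prism_homeo (vertex_point 11) \<in> ?U" by simp
  then show ?thesis using interior_maximal[OF sub op] by (rule rev_subsetD)
qed

lemma simplicial_map_prism_q: "simplicial_map prism_complex barnette_sphere prism_q"
  using abstract_prism_complex abstract_barnette image_prism_q_complex by (auto simp: simplicial_map_def)

lemma prism_rel_iff: "u \<in> prism \<Longrightarrow> v \<in> prism \<Longrightarrow> (u, v) \<in> prism_rel \<longleftrightarrow> prism_map u = prism_map v"
  by (simp add: prism_rel_def)

section \<open>The induced complex on the quotient\<close>

abbreviation "prism_vertex \<equiv> induced_vertex prism_homeo prism_class"

lemma vertex_point_in_realization:
  assumes "v \<in> complex_vertices prism_complex" shows "vertex_point v \<in> realization prism_complex"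
proof -
  obtain \<sigma> where \<sigma>: "\<sigma> \<in> prism_complex" "v \<in> \<sigma>" using assms by (auto simp: complex_vertices_def)
  then have "vertex_point v \<in> closed_simplex \<sigma>"
    using finite_prism_complex(2)[OF \<sigma>(1)] by (auto simp: closed_simplex_def vertex_point_def)
  with \<sigma>(1) show ?thesis by (auto simp: realization_def)
qed

lemma realization_map_vertex_point: "realization_map f (vertex_point v) = vertex_point (f v)"
proof
  fix w
  have "{u. vertex_point v u \<noteq> 0 \<and> f u = w} = (if w = f v then {v} else {})"
    by (auto simp: vertex_point_def)
  then show "realization_map f (vertex_point v) w = vertex_point (f v) w"
    by (auto simp: realization_map_def vertex_point_def)
qed

text \<open>The comparison of \<open>prism_map\<close> with \<open>realization_map prism_q\<close>,
  applied to vertices.\<close>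

lemma prism_vertex_eq_iff:
  assumes "v \<in> complex_vertices prism_complex" "w \<in> complex_vertices prism_complex"
  shows "prism_vertex v = prism_vertex w \<longleftrightarrow> prism_q v = prism_q w"
proof -
  note vw = vertex_point_in_realization[OF assms(1)] vertex_point_in_realization[OF assms(2)]
  have "prism_vertex v = prism_vertex w \<longleftrightarrow> realization_map prism_q (vertex_point v) = realization_map prism_q (vertex_point w)"
    unfolding induced_vertex_def prism_class_eq_iff[OF prism_homeo_in[OF vw(1)] prism_homeo_in[OF vw(2)]]
    by (rule prism_map_homeo_eq_iff[OF vw])
  also have "\<dots> \<longleftrightarrow> vertex_point (prism_q v) = (vertex_point (prism_q w) :: nat \<Rightarrow> real)"
    unfolding realization_map_vertex_point ..
  also have "\<dots> \<longleftrightarrow> prism_q v = prism_q w"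
  proof
    assume "vertex_point (prism_q v) = (vertex_point (prism_q w) :: nat \<Rightarrow> real)"
    from fun_cong[OF this, of "prism_q v"] show "prism_q v = prism_q w"
      by (simp add: vertex_point_def split: if_splits)
  qed simp
  finally show ?thesis .
qed

lemma prism_q_idem: "v \<in> complex_vertices prism_complex \<Longrightarrow> prism_q v \<in> complex_vertices prism_complex \<and> prism_q (prism_q v) = prism_q v"
  unfolding complex_vertices_prism by (elim insertE emptyE; simp add: prism_q_def)

lemma prism_q_barnette: "v \<in> complex_vertices barnette_sphere \<Longrightarrow> v \<in> complex_vertices prism_complex \<and> prism_q v = v"
  unfolding complex_vertices_prism complex_vertices_barnette by (elim insertE emptyE; simp add: prism_q_def)

lemma prism_vertex_q: "v \<in> complex_vertices prism_complex \<Longrightarrow> prism_vertex (prism_q v) = prism_vertex v"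
  using prism_vertex_eq_iff[of "prism_q v" v] prism_q_idem[of v] by simp

lemma prism_complex_vertices: "\<sigma> \<in> prism_complex \<Longrightarrow> \<sigma> \<subseteq> complex_vertices prism_complex"
  "\<tau> \<in> barnette_sphere \<Longrightarrow> \<tau> \<subseteq> complex_vertices barnette_sphere"
  by (auto simp: complex_vertices_def)

lemma inj_on_prism_vertex: "inj_on prism_vertex (complex_vertices barnette_sphere)"
proof
  fix v w assume v: "v \<in> complex_vertices barnette_sphere" and w: "w \<in> complex_vertices barnette_sphere"
    and "prism_vertex v = prism_vertex w"
  then show "v = w"
    using prism_vertex_eq_iff[of v w] prism_q_barnette[OF v] prism_q_barnette[OF w] by simp
qed

abbreviation "prism_induced \<equiv> induced_complex prism_complex prism_homeo prism_class"

text \<open>The class of a vertex depends only on its image under \<open>prism_q\<close>, so every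
  induced simplex comes from a simplex of the Barnette sphere.\<close>

lemma prism_induced_eq: "prism_induced = (`) prism_vertex ` barnette_sphere"
proof -
  have eq: "prism_vertex ` \<sigma> = prism_vertex ` prism_q ` \<sigma>" if "\<sigma> \<in> prism_complex" for \<sigma>
    using prism_vertex_q prism_complex_vertices(1)[OF that] unfolding image_image by (intro image_cong) auto
  have "prism_induced = (\<lambda>\<sigma>. prism_vertex ` prism_q ` \<sigma>) ` prism_complex"
    unfolding induced_complex_def by (rule image_cong[OF refl eq])
  also have "\<dots> = (`) prism_vertex ` (`) prism_q ` prism_complex" by blast
  finally show ?thesis by (simp only: image_prism_q_complex)
qed

lemma abstract_complex_image:
  assumes "abstract_complex K" shows "abstract_complex ((`) f ` K)"
  unfolding abstract_complex_def
proof (intro ballI conjI allI impI)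
  fix \<sigma> assume "\<sigma> \<in> (`) f ` K"
  then obtain \<rho> where \<rho>: "\<rho> \<in> K" "\<sigma> = f ` \<rho>" by blast
  show "finite \<sigma>" "\<sigma> \<noteq> {}" using \<rho> assms by (auto simp: abstract_complex_def)
  fix \<tau> assume \<tau>: "\<tau> \<subseteq> \<sigma>" "\<tau> \<noteq> {}"
  then have "\<tau> = f ` {v \<in> \<rho>. f v \<in> \<tau>}" using \<rho> by auto
  moreover have "{v \<in> \<rho>. f v \<in> \<tau>} \<noteq> {}" using \<tau> \<rho> by auto
  then have "{v \<in> \<rho>. f v \<in> \<tau>} \<in> K" using assms \<rho>(1) unfolding abstract_complex_def by (metis (no_types, lifting) mem_Collect_eq subsetI)
  ultimately show "\<tau> \<in> (`) f ` K" by blast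
qed

lemma simplicial_iso_induced:
  "\<exists>qv. simplicial_iso prism_induced barnette_sphere qv \<and>
     (\<forall>i\<in>complex_vertices prism_complex. qv (prism_vertex i) = prism_q i)"
proof -
  let ?V = "complex_vertices barnette_sphere"
  define qv where "qv = inv_into ?V prism_vertex"
  have qv: "qv (prism_vertex i) = i" if "i \<in> ?V" for i
    unfolding qv_def using inv_into_f_f[OF inj_on_prism_vertex that] .
  have V: "complex_vertices prism_induced = prism_vertex ` ?V"
    unfolding prism_induced_eq complex_vertices_def by auto
  have bij: "bij_betw qv (prism_vertex ` ?V) ?V"
    unfolding qv_def using inj_on_prism_vertex by (intro bij_betw_inv_into) (simp add: bij_betw_def)
  have inv: "inv_into (prism_vertex ` ?V) qv i = prism_vertex i" if "i \<in> ?V" for i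
    using bij qv[OF that] that by (metis bij_betw_imp_inj_on imageI inv_into_f_f)
  have abs: "abstract_complex prism_induced"
    unfolding prism_induced_eq by (rule abstract_complex_image[OF abstract_barnette])
  have "qv ` \<sigma> \<in> barnette_sphere" if "\<sigma> \<in> prism_induced" for \<sigma>
  proof -
    obtain \<tau> where \<tau>: "\<tau> \<in> barnette_sphere" "\<sigma> = prism_vertex ` \<tau>" using \<open>\<sigma> \<in> prism_induced\<close> unfolding prism_induced_eq by blast
    have "qv ` \<sigma> = (\<lambda>i. i) ` \<tau>"
      unfolding \<tau>(2) image_image using qv prism_complex_vertices(2)[OF \<tau>(1)] by (intro image_cong) auto
    then show ?thesis using \<tau>(1) by simp
  qed
  moreover have "inv_into (prism_vertex ` ?V) qv ` \<tau> \<in> prism_induced" if "\<tau> \<in> barnette_sphere" for \<tau>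
  proof -
    have "inv_into (prism_vertex ` ?V) qv ` \<tau> = prism_vertex ` \<tau>"
      using inv prism_complex_vertices(2)[OF that] by (intro image_cong) auto
    then show ?thesis using that unfolding prism_induced_eq by blast
  qed
  ultimately have "simplicial_iso prism_induced barnette_sphere qv"
    unfolding simplicial_iso_def simplicial_map_def V using bij abs abstract_barnette by blast
  moreover have "qv (prism_vertex i) = prism_q i" if "i \<in> complex_vertices prism_complex" for i
  proof -
    have "prism_q i \<in> ?V"
      using that unfolding complex_vertices_prism complex_vertices_barnette by (elim insertE emptyE; simp add: prism_q_def)
    then show ?thesis using qv prism_vertex_q[OF that] by metis
  qed
  ultimately show ?thesis by blast
qed

lemma induces_decomposition_prism:
  assumes qbar: "homeomorphic_map prism_quotient (top_of_set (realization barnette_sphere)) qbar"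
    and q: "\<And>b. b \<in> realization prism_complex \<Longrightarrow> qbar (prism_class (prism_homeo b)) = realization_map prism_q b"
  shows "induces_decomposition prism_complex prism_homeo prism_class prism_quotient"
proof -
  let ?V = "complex_vertices barnette_sphere"
  \<comment> \<open>\<open>J\<close> reads off the weights at the classes of the eight Barnette
    vertices and so inverts the realization of the vertex map. Composed with the inverse of
    \<open>qbar\<close> it gives the decomposition of the quotient.\<close>
  define J where "J b i = (if i \<in> ?V then b (prism_vertex i) else 0)" for b :: "(real \<times> real \<times> real) set \<Rightarrow> real" and i
  have finV: "finite ?V" by (simp add: complex_vertices_barnette)
  have J: "J (realization_map prism_vertex c) = c" if c: "c \<in> realization barnette_sphere" for c
  proof -
    obtain \<tau> where \<tau>: "\<tau> \<in> barnette_sphere" "c \<in> closed_simplex \<tau>" using c by (auto simp: realization_def)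
    have tV: "\<tau> \<subseteq> ?V" by (rule prism_complex_vertices(2)[OF \<tau>(1)])
    have inj: "inj_on prism_vertex \<tau>" using inj_on_prism_vertex tV by (rule inj_on_subset)
    have "J (realization_map prism_vertex c) i = c i" for i
    proof (cases "i \<in> \<tau>")
      case True
      then show ?thesis using realization_map_inj_on(1)[OF \<tau>(2) inj True] tV by (auto simp: J_def)
    next
      case False
      then have "c i = 0" using \<tau>(2) by (auto simp: closed_simplex_def)
      moreover have "realization_map prism_vertex c (prism_vertex i) = 0" if "i \<in> ?V"
      proof (rule realization_map_inj_on(2)[OF \<tau>(2) inj])
        show "prism_vertex i \<notin> prism_vertex ` \<tau>"
          using inj_on_image_mem_iff[OF inj_on_prism_vertex that tV] False by simp
      qed
      ultimately show ?thesis by (simp add: J_def)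
    qed
    then show ?thesis by blast
  qed
  have onto: "realization_map prism_vertex ` realization barnette_sphere = realization prism_induced"
    unfolding prism_induced_eq
    by (rule realization_map_realization) (use inj_on_prism_vertex prism_complex_vertices(2) inj_on_subset in blast)
  have "bij_betw J (realization prism_induced) (realization barnette_sphere)"
  proof (rule bij_betw_byWitness[where f' = "realization_map prism_vertex"])
    show "\<forall>b\<in>realization prism_induced. realization_map prism_vertex (J b) = b" using J unfolding onto[symmetric] by auto
    show "\<forall>c\<in>realization barnette_sphere. J (realization_map prism_vertex c) = c" using J by blast
    show "J ` realization prism_induced \<subseteq> realization barnette_sphere" using J unfolding onto[symmetric] by auto
    show "realization_map prism_vertex ` realization barnette_sphere \<subseteq> realization prism_induced" using onto by blast
  qed
  moreover have "continuous_on (realization prism_induced) J"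
  proof (rule continuous_on_coordinatewise_then_product)
    fix i
    have "continuous_on (realization prism_induced) (\<lambda>b. b (prism_vertex i))"
      by (rule continuous_on_subset[OF continuous_on_product_coordinates subset_UNIV])
    then show "continuous_on (realization prism_induced) (\<lambda>b. J b i)"
      by (cases "i \<in> ?V") (simp_all add: J_def)
  qed
  moreover have fin: "finite prism_induced"
    unfolding induced_complex_def using finite_prism_complex(1) by simp
  moreover have abs: "abstract_complex prism_induced"
    unfolding prism_induced_eq by (rule abstract_complex_image[OF abstract_barnette])
  then have "compact (realization prism_induced)"
    using fin by (intro compact_realization) (auto simp: abstract_complex_def)
  ultimately have Jh: "homeomorphic_map (top_of_set (realization prism_induced)) (top_of_set (realization barnette_sphere)) J"
    by (intro homeomorphic_map_compact)
  obtain r where r: "homeomorphic_maps prism_quotient (top_of_set (realization barnette_sphere)) qbar r"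
    using qbar by (auto simp: homeomorphic_map_maps)
  then have "homeomorphic_map (top_of_set (realization barnette_sphere)) prism_quotient r"
    using homeomorphic_maps_sym homeomorphic_maps_map by blast
  then have "homeomorphic_map (top_of_set (realization prism_induced)) prism_quotient (r \<circ> J)"
    by (rule homeomorphic_map_compose[OF Jh])
  then have "simplicial_decomposition prism_induced prism_quotient (r \<circ> J)"
    using fin abs by (simp add: simplicial_decomposition_def)
  moreover have "(r \<circ> J) (realization_map prism_vertex u) = prism_class (prism_homeo u)" if u: "u \<in> realization prism_complex" for u
  proof -
    have supp: "v \<in> complex_vertices prism_complex" if "u v \<noteq> 0" for v
      using u that by (auto simp: realization_def closed_simplex_def complex_vertices_def)
    have "J (realization_map prism_vertex u) i = realization_map prism_q u i" for i
    proof (cases "i \<in> ?V")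
      case True
      \<comment> \<open>Two vertices have the same class exactly when \<open>prism_q\<close>
        identifies them, so both realizations add up the weights over the same fibres.\<close>
      have "{v. u v \<noteq> 0 \<and> prism_vertex v = prism_vertex i} = {v. u v \<noteq> 0 \<and> prism_q v = i}"
        using supp prism_q_barnette[OF True] prism_vertex_eq_iff by metis
      then show ?thesis using True by (simp add: J_def realization_map_def)
    next
      case False
      have "prism_q v \<in> ?V" if "v \<in> complex_vertices prism_complex" for v
        using that unfolding complex_vertices_prism complex_vertices_barnette by (elim insertE emptyE; simp add: prism_q_def)
      then have "{v. u v \<noteq> 0 \<and> prism_q v = i} = {}" using supp False by auto
      then show ?thesis using False by (simp only: J_def realization_map_def if_False sum.empty)
    qed
    then have "J (realization_map prism_vertex u) = qbar (prism_class (prism_homeo u))" using q[OF u] by auto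
    moreover have "prism_class (prism_homeo u) \<in> topspace prism_quotient"
      using prism_homeo_in[OF u] by (simp add: prism_quotient_def)
    ultimately show ?thesis using r by (simp add: homeomorphic_maps_def)
  qed
  moreover have "inj_on (\<lambda>u. prism_class (prism_homeo u)) (closed_simplex \<sigma>)" if \<sigma>: "\<sigma> \<in> prism_complex" for \<sigma>
  proof
    fix a b assume ab: "a \<in> closed_simplex \<sigma>" "b \<in> closed_simplex \<sigma>" "prism_class (prism_homeo a) = prism_class (prism_homeo b)"
    then have "a \<in> realization prism_complex" "b \<in> realization prism_complex" using \<sigma> by (auto simp: realization_def)
    then have "realization_map prism_q a = realization_map prism_q b" using ab(3) q by metis
    then show "a = b" using realization_map_inj_on_closed_simplex[OF inj_on_prism_q[OF \<sigma>]] ab by (auto simp: inj_on_def)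
  qed
  ultimately show ?thesis unfolding induces_decomposition_def by blast
qed

theorem mainTheorem2:
  shows "(\<exists>pbar. homeomorphic_map prism_quotient (symmetric_potency 3 circle_top) pbar \<and>
            (\<forall>u\<in>prism. pbar (prism_class u) = prism_map u)) \<and>
    (\<exists>h. simplicial_decomposition prism_complex (top_of_set prism) h \<and>
       h (vertex_point 0) = P0 \<and> h (vertex_point 1) = P1 \<and> h (vertex_point 2) = P2 \<and>
       h (vertex_point 4) = P4 \<and> h (vertex_point 5) = P5 \<and> h (vertex_point 6) = P6 \<and>
       h (vertex_point 3) = barycenter3 P0 P1 P2 \<and> h (vertex_point 7) = barycenter3 P4 P5 P6 \<and>
       h (vertex_point 8) = midpoint P1 P6 \<and> h (vertex_point 9) = midpoint P2 P4 \<and>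
       h (vertex_point 10) = midpoint P0 P5 \<and> h (vertex_point 11) \<in> interior prism \<and>
       simplicial_map prism_complex barnette_sphere prism_q \<and>
       induces_decomposition prism_complex h prism_class prism_quotient \<and>
       (\<exists>qv. simplicial_iso (induced_complex prism_complex h prism_class) barnette_sphere qv \<and>
          (\<forall>i\<in>complex_vertices prism_complex. qv (induced_vertex h prism_class i) = prism_q i)) \<and>
       (\<forall>u\<in>realization prism_complex. \<forall>v\<in>realization prism_complex.
          (h u, h v) \<in> prism_rel \<longleftrightarrow> realization_map prism_q u = realization_map prism_q v) \<and>
       (\<exists>qbar. homeomorphic_map prism_quotient (top_of_set (realization barnette_sphere)) qbar \<and>
          (\<forall>u\<in>realization prism_complex. qbar (prism_class (h u)) = realization_map prism_q u) \<and>
          (\<lambda>\<sigma>. qbar ` prism_class ` h ` closed_simplex \<sigma>) ` prism_complex =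
            closed_simplex ` barnette_sphere \<and>
          subcomplex band_complex barnette_sphere \<and>
          complex_dim band_complex = 2 \<and>
          complex_vertices band_complex = {0,1,2,8,9,10} \<and>
          complex_facets band_complex = {{0,1,8}, {0,2,8}, {0,1,9}, {1,2,9}, {0,2,10}, {1,2,10}} \<and>
          qbar ` prism_class ` prism_S = realization band_complex \<and>
          subcomplex band_boundary_complex barnette_sphere \<and>
          complex_dim band_boundary_complex = 1 \<and>
          complex_vertices band_boundary_complex = {0,1,2,8,9,10} \<and>
          complex_facets band_boundary_complex = {{1,8}, {2,8}, {0,9}, {2,9}, {0,10}, {1,10}} \<and>
          qbar ` prism_class ` prism_D = realization band_boundary_complex \<and>
          twisted_band_with_boundary prism_quotient
            (prism_class ` prism_S) (prism_class ` prism_D)))"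
proof -
  obtain qbar where qbar: "homeomorphic_map prism_quotient (top_of_set (realization barnette_sphere)) qbar"
    and q: "\<And>b. b \<in> realization prism_complex \<Longrightarrow> qbar (prism_class (prism_homeo b)) = realization_map prism_q b"
    using prism_quotient_barnette by blast
  \<comment> \<open>Through this equation the claims about simplices, about S and about D become
    claims about images under \<open>prism_q\<close>.\<close>
  have img: "qbar ` prism_class ` prism_homeo ` A = realization_map prism_q ` A" if "A \<subseteq> realization prism_complex" for A
    using q that unfolding image_image by (intro image_cong) auto
  have simp_sub: "closed_simplex \<sigma> \<subseteq> realization prism_complex" if "\<sigma> \<in> prism_complex" for \<sigma>
    using that by (auto simp: realization_def)
  have cells: "(\<lambda>\<sigma>. qbar ` prism_class ` prism_homeo ` closed_simplex \<sigma>) ` prism_complex = closed_simplex ` barnette_sphere"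
  proof -
    have "(\<lambda>\<sigma>. qbar ` prism_class ` prism_homeo ` closed_simplex \<sigma>) ` prism_complex = (\<lambda>\<sigma>. closed_simplex (prism_q ` \<sigma>)) ` prism_complex"
      using img[OF simp_sub] realization_map_closed_simplex[OF inj_on_prism_q] by (intro image_cong) auto
    also have "\<dots> = closed_simplex ` (`) prism_q ` prism_complex" by (simp only: image_image)
    finally show ?thesis by (simp only: image_prism_q_complex)
  qed
  have side: "prism_side \<subseteq> realization prism_complex" "prism_rim \<subseteq> realization prism_complex"
    using prism_side_subset prism_rim_subset prism_boundary_subset by blast+
  have S: "qbar ` prism_class ` prism_S = realization band_complex"
    unfolding prism_homeo_S[symmetric] img[OF side(1)] by (rule realization_map_prism_q_side(1))
  have D: "qbar ` prism_class ` prism_D = realization band_boundary_complex"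
    unfolding prism_homeo_D[symmetric] img[OF side(2)] by (rule realization_map_prism_q_side(2))
  have ker: "\<forall>u\<in>realization prism_complex. \<forall>v\<in>realization prism_complex.
      (prism_homeo u, prism_homeo v) \<in> prism_rel \<longleftrightarrow> realization_map prism_q u = realization_map prism_q v"
    using prism_rel_iff[OF prism_homeo_in prism_homeo_in] prism_map_homeo_eq_iff by blast
  have dec: "simplicial_decomposition prism_complex (top_of_set prism) prism_homeo"
    using finite_prism_complex(1) abstract_prism_complex homeomorphic_map_prism_homeo
    by (simp add: simplicial_decomposition_def)
  show ?thesis
    by (rule conjI[OF prism_quotient_symmetric_potency], rule exI[of _ prism_homeo])
      (intro conjI exI[of _ qbar] qbar dec prism_homeo_vertices prism_homeo_apex simplicial_map_prism_q
        induces_decomposition_prism[OF qbar q] simplicial_iso_induced ker cells band_complex_facts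
        band_boundary_complex_facts S D prism_twisted_band ballI q; assumption)
qed

end
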